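(* There is a fixed constant $K$ such that if $H$ is a $q$-sparse graph and $p=Kq\log^2 n$, then \[ N(H,F)<\mathbb E_pX_F\qquad\text{for every } F\subseteq H. \] Furthermore, there is a fixed constant $\alpha>0$ such that the same conclusion, $N(H,F)<\mathbb E_pX_F$ for every $F\subseteq H$, holds if $H$ is $q$-sparse with $q=\alpha p<1/(3n)$.
   Context: Here $n$ is a positive integer, $q\in[0,1]$, and the constants $K$ and $\alpha$ do not depend on $n$, $q$ or $H$. All graphs are finite and simple; $e_J=|E(J)|$; $\log=\log_2$ and $\log^2 n=(\log n)^2$. A copy of $J$ in $G$ is an (unlabeled, not necessarily induced) subgraph of $G$ isomorphic to $J$; $N(G,J)$ is the number of copies of $J$ in $G$. $F\subseteq H$ means $F$ is a (not necessarily induced) subgraph of $H$. $G_{n,p}$ is the Erdős–Rényi random graph on vertex set $\{1,\dots,n\}$, containing each edge of $K_n$ independently with probability $p$, and $\mathbb E_pX_J=\mathbb E\,N(G_{n,p},J)=N(K_n,J)\,p^{e_J}$ is the expected number of copies of $J$ in $G_{n,p}$; if $p>1$, $\mathbb E_pX_J$ is read as $N(K_n,J)\,p^{e_J}$. For $q\in[0,1]$, a graph $J$ is $q$-sparse (with respect to $n$) if $\mathbb E_qX_I\ge 1$ for every $I\subseteq J$.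
   Formalization: The inequality N(H,F) < E_pX_F is stated only for F ⊆ H with at least one edge; for edgeless F it can fail (the empty graph gives 1 < 1; a single vertex gives n < n when H has n vertices). *)

theory Defs
  imports "HOL-Probability.Probability"
begin

type_synonym 'a graph = "'a set \<times> 'a set set"

abbreviation verts :: "'a graph \<Rightarrow> 'a set" where "verts G \<equiv> fst G"
abbreviation edges :: "'a graph \<Rightarrow> 'a set set" where "edges G \<equiv> snd G"

definition simple_graph :: "'a graph \<Rightarrow> bool" where
  "simple_graph G \<longleftrightarrow> finite (verts G) \<and> (\<forall>e\<in>edges G. e \<subseteq> verts G \<and> card e = 2)"

definition subgraph :: "'a graph \<Rightarrow> 'a graph \<Rightarrow> bool" where
  "subgraph F G \<longleftrightarrow> simple_graph F \<and> verts F \<subseteq> verts G \<and> edges F \<subseteq> edges G"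

definition graph_iso :: "'a graph \<Rightarrow> 'b graph \<Rightarrow> bool" where
  "graph_iso G J \<longleftrightarrow>
     (\<exists>f. bij_betw f (verts G) (verts J) \<and> edges J = (\<lambda>e. f ` e) ` edges G)"

definition copies :: "'a graph \<Rightarrow> 'b graph \<Rightarrow> 'a graph set" where
  "copies G J = {F. subgraph F G \<and> graph_iso F J}"

definition num_copies :: "'a graph \<Rightarrow> 'b graph \<Rightarrow> nat" where
  "num_copies G J = card (copies G J)"

definition K_graph :: "nat \<Rightarrow> nat graph" where
  "K_graph n = ({1..n}, {e. e \<subseteq> {1..n} \<and> card e = 2})"

definition random_graph :: "nat \<Rightarrow> real \<Rightarrow> nat graph pmf" where
  "random_graph n p =
     map_pmf (\<lambda>\<omega>. ({1..n}, {e \<in> edges (K_graph n). \<omega> e}))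
       (Pi_pmf (edges (K_graph n)) False (\<lambda>_. bernoulli_pmf p))"

(* Only used for p \<ge> 0.  For p > 1 there is no random graph and the closed formula serves as
   the definition; expected_copies_eq shows that it is also the value for 0 \<le> p \<le> 1. *)
definition expected_copies :: "nat \<Rightarrow> real \<Rightarrow> 'a graph \<Rightarrow> real" where
  "expected_copies n p J =
     (if p \<le> 1 then measure_pmf.expectation (random_graph n p) (\<lambda>G. real (num_copies G J))
      else real (num_copies (K_graph n) J) * p ^ card (edges J))"

definition q_sparse :: "nat \<Rightarrow> real \<Rightarrow> 'a graph \<Rightarrow> bool" where
  "q_sparse n q J \<longleftrightarrow> (\<forall>I. subgraph I J \<longrightarrow> expected_copies n q I \<ge> 1)"

lemma finite_edges_K_graph: "finite (edges (K_graph n))"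
  by (rule finite_subset[of _ "Pow {1..n}"]) (auto simp: K_graph_def)

lemma finite_copies_K_graph: "finite (copies (K_graph n) J)"
proof (rule finite_subset)
  show "copies (K_graph n) J \<subseteq> Pow {1..n} \<times> Pow (edges (K_graph n))"
    by (auto simp: copies_def subgraph_def K_graph_def)
qed (simp add: finite_edges_K_graph)

lemma card_edges_graph_iso:
  assumes "simple_graph F" "graph_iso F J"
  shows "card (edges J) = card (edges F)"
proof -
  obtain f where f: "bij_betw f (verts F) (verts J)" "edges J = (\<lambda>e. f ` e) ` edges F"
    using assms(2) by (auto simp: graph_iso_def)
  have "inj_on (\<lambda>e. f ` e) (edges F)"
    using f(1) assms(1) by (intro inj_onI)
      (metis bij_betw_def inj_on_image_eq_iff simple_graph_def)
  then show ?thesis using f(2) by (simp add: card_image)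
qed

lemma expected_copies_eq:
  assumes "0 \<le> p"
  shows "expected_copies n p J = real (num_copies (K_graph n) J) * p ^ card (edges J)"
proof (cases "p \<le> 1")
  case True
  let ?E = "edges (K_graph n)" and ?C = "copies (K_graph n) J"
  let ?M = "Pi_pmf ?E False (\<lambda>_. bernoulli_pmf p)"
  let ?G = "\<lambda>\<omega>. ({1..n}, {e \<in> ?E. \<omega> e})"
  let ?A = "\<lambda>F. Pi ?E (\<lambda>e. if e \<in> edges F then {True} else UNIV)"
  have count: "real (num_copies (?G \<omega>) J) = (\<Sum>F\<in>?C. indicator (?A F) \<omega>)" for \<omega>
  proof -
    have "copies (?G \<omega>) J = {F \<in> ?C. \<omega> \<in> ?A F}"
      by (auto simp: copies_def subgraph_def K_graph_def Pi_def split: if_splits)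
    also have "\<dots> = ?C \<inter> {F. \<omega> \<in> ?A F}" by blast
    finally have "real (num_copies (?G \<omega>) J) = (\<Sum>F\<in>?C. if \<omega> \<in> ?A F then 1 else 0)"
      using finite_copies_K_graph[of n J]
      by (simp add: num_copies_def sum.If_cases)
    then show ?thesis by (simp add: indicator_def of_bool_def)
  qed
  have prob: "measure_pmf.prob ?M (?A F) = p ^ card (edges J)" if F: "F \<in> ?C" for F
  proof -
    have sub: "edges F \<subseteq> ?E" and card: "card (edges J) = card (edges F)"
      using F card_edges_graph_iso[of F J] by (simp_all add: copies_def subgraph_def)
    have "measure_pmf.prob ?M (?A F) =
            (\<Prod>e\<in>?E. measure_pmf.prob (bernoulli_pmf p) (if e \<in> edges F then {True} else UNIV))"
      by (rule measure_Pi_pmf_Pi[OF finite_edges_K_graph])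
    also have "\<dots> = (\<Prod>e\<in>?E. if e \<in> edges F then p else 1)"
      using assms True by (intro prod.cong) (auto simp: measure_pmf_single)
    also have "\<dots> = p ^ card (edges F)"
      using sub by (simp add: prod.If_cases finite_edges_K_graph Int_absorb1)
    finally show ?thesis using card by simp
  qed
  have "expected_copies n p J = measure_pmf.expectation ?M (\<lambda>\<omega>. \<Sum>F\<in>?C. indicator (?A F) \<omega>)"
    using True by (simp only: expected_copies_def random_graph_def integral_map_pmf count if_True)
  also have "\<dots> = (\<Sum>F\<in>?C. measure_pmf.expectation ?M (indicator (?A F)))"
    by (rule Bochner_Integration.integral_sum)
       (simp add: measure_pmf.emeasure_eq_measure)
  also have "\<dots> = (\<Sum>F\<in>?C. p ^ card (edges J))"
    using prob by (intro sum.cong) auto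
  finally show ?thesis by (simp add: num_copies_def)
qed (simp add: expected_copies_def)

end

theory Submission
  imports Defs
begin

text \<open>
  Multiplied by the number of automorphisms of \<open>F\<close>, numbers of copies become numbers
  of embeddings (\<open>card_emb_eq\<close>). If \<open>F\<close> has \<open>v\<close> vertices
  and \<open>e\<close> edges, it therefore suffices to bound the number of embeddings of
  \<open>F\<close> into \<open>H\<close> by \<open>(a n)\<^sup>v (C q)\<^sup>e\<close>; constants
  per vertex are absorbed by the edges (\<open>num_copies_less_if_emb_bound\<close>).

  Sparsity is used through packings (\<open>packing\<close>). If \<open>H\<close> contains
  \<open>m\<close> edge-disjoint pieces with \<open>k\<close> edges each, then their union has at
  least \<open>1 / q\<^sup>k\<^sup>m\<close> copies in the complete graph. A copy is given by a
  set of \<open>m\<close> out of \<open>t\<close> possible images of pieces, so \<open>m! \<le> (t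
  q\<^sup>k)\<^sup>m\<close> and hence \<open>m = O(t q\<^sup>k)\<close>: a packing is never much
  larger than the expected number of pieces in the random graph.

  For the bound with \<open>log\<^sup>2 n\<close>, all subgraphs of \<open>H\<close> have density
  at most \<open>c = log n / log (1 / q)\<close>. Therefore the edges of \<open>H\<close> can
  distribute their weight over their ends so that no vertex carries more than \<open>c\<close>
  (\<open>fractional_orientation\<close>). Let an edge point away from an end that carries at
  least \<open>1 / log n\<close> of it; then at most \<open>log\<^sup>2 n\<close> edges point away
  from a vertex. Fix which edges of \<open>F\<close> are sent to edges pointing away from which of
  their ends. This makes \<open>F\<close> a directed graph. Its vertices are embedded one strong
  component at a time, beginning with the sinks. Once one vertex of a component has been placed,
  the others follow along arcs, at a cost of \<open>log\<^sup>2 n\<close> each. The first vertex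
  is placed with the help of a maximal packing of extensions. The edges from the component to
  earlier vertices carry nearly all of their weight at the component, so the expected number of
  extensions is not small, and the packing is about as large at most, up to factors charged to
  these edges (\<open>card_extensions\<close>).

  If \<open>q < 1 / (3 n)\<close>, the components of \<open>H\<close> are trees, and a connected
  \<open>F\<close> embeds into a single component. By packing, the number of components isomorphic
  to a given tree is bounded by the expected number of its copies. Summing over labelled trees
  leads to counting trees on \<open>{1..u}\<close> together with an embedded \<open>F\<close>, of
  which there are at most \<open>u! / (u - v)! \<cdot> u\<^sup>u\<^sup>-\<^sup>v\<close>, and the
  sum over \<open>u\<close> is dominated by a geometric series with ratio \<open>e / 3 < 1\<close>
  (\<open>card_emb_connected_le\<close>). Disconnected \<open>F\<close> follow by multiplication.
\<close>

section \<open>Embeddings and copies\<close>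

text \<open>Embeddings are extensional, so that there are finitely many of them and an embedding is
  determined by its values on the vertices.\<close>
definition emb :: "'b graph \<Rightarrow> 'a graph \<Rightarrow> ('a \<Rightarrow> 'b) set" where
  "emb G F = {\<phi> \<in> verts F \<rightarrow>\<^sub>E verts G. inj_on \<phi> (verts F) \<and> (\<forall>e\<in>edges F. \<phi> ` e \<in> edges G)}"

definition image_graph :: "('a \<Rightarrow> 'b) \<Rightarrow> 'a graph \<Rightarrow> 'b graph" where
  "image_graph f G = (f ` verts G, (\<lambda>e. f ` e) ` edges G)"

lemma verts_image_graph [simp]: "verts (image_graph f G) = f ` verts G"
  and edges_image_graph [simp]: "edges (image_graph f G) = (\<lambda>e. f ` e) ` edges G"
  by (simp_all add: image_graph_def)

lemma simple_graphD:
  assumes "simple_graph G"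
  shows "finite (verts G)" "e \<in> edges G \<Longrightarrow> e \<subseteq> verts G" "e \<in> edges G \<Longrightarrow> card e = 2"
    "finite (edges G)"
proof -
  show "finite (verts G)" "e \<in> edges G \<Longrightarrow> e \<subseteq> verts G" "e \<in> edges G \<Longrightarrow> card e = 2"
    using assms by (auto simp: simple_graph_def)
  show "finite (edges G)"
    by (rule finite_subset[of _ "Pow (verts G)"]) (use assms in \<open>auto simp: simple_graph_def\<close>)
qed

lemma finite_emb: "finite (verts F) \<Longrightarrow> finite (verts G) \<Longrightarrow> finite (emb G F)"
  by (rule finite_subset[of _ "verts F \<rightarrow>\<^sub>E verts G"]) (auto simp: emb_def intro: finite_PiE)

lemma inj_on_image_edges:
  assumes "simple_graph G" "inj_on f (verts G)"
  shows "inj_on (\<lambda>e. f ` e) (edges G)"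
  using assms by (meson inj_onI inj_on_image_eq_iff simple_graphD(2))

lemma simple_graph_image_graph:
  assumes "simple_graph G" "inj_on f (verts G)"
  shows "simple_graph (image_graph f G)"
  unfolding simple_graph_def
proof (intro conjI ballI)
  show "finite (verts (image_graph f G))" using assms by (simp add: simple_graphD)
  fix e' assume "e' \<in> edges (image_graph f G)"
  then obtain e where e: "e \<in> edges G" "e' = f ` e" by auto
  then have "e \<subseteq> verts G" "card e = 2" using simple_graphD[OF assms(1)] by auto
  then show "e' \<subseteq> verts (image_graph f G)" "card e' = 2"
    using e assms(2) by (auto simp: card_image inj_on_subset)
qed

lemma image_graph_cong:
  assumes "simple_graph G" "\<And>x. x \<in> verts G \<Longrightarrow> f x = g x"
  shows "image_graph f G = image_graph g G"
proof -
  have "f ` e = g ` e" if "e \<in> edges G" for e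
    using assms simple_graphD(2)[OF assms(1) that] by (intro image_cong) auto
  then show ?thesis using assms(2) by (simp add: image_graph_def)
qed

lemma image_graph_comp: "image_graph f (image_graph g G) = image_graph (f \<circ> g) G"
  by (auto simp: image_graph_def image_image image_comp)

lemma image_graph_id:
  assumes "simple_graph G" "\<And>x. x \<in> verts G \<Longrightarrow> f x = x"
  shows "image_graph f G = G"
  using image_graph_cong[OF assms(1), of f id] assms(2) by (simp add: image_graph_def)

lemma copies_eq_image_emb:
  assumes J: "simple_graph J"
  shows "copies G J = (\<lambda>\<phi>. image_graph \<phi> J) ` emb G J"
proof (intro equalityI subsetI)
  fix C assume "C \<in> copies G J"
  then obtain f where C: "subgraph C G" and f: "bij_betw f (verts C) (verts J)"
      "edges J = (\<lambda>e. f ` e) ` edges C"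
    by (auto simp: copies_def graph_iso_def)
  define h where "h = restrict (inv_into (verts C) f) (verts J)"
  have sC: "simple_graph C" using C by (simp add: subgraph_def)
  have J_eq: "J = image_graph f C" using f by (simp add: image_graph_def bij_betw_def prod_eq_iff)
  have C_eq: "image_graph h J = C"
    unfolding J_eq image_graph_comp using f(1)
    by (intro image_graph_id sC) (auto simp: J_eq h_def bij_betw_def)
  have hV: "h ` verts J = verts C" using C_eq verts_image_graph[of h J] by simp
  have hE: "(\<lambda>e. h ` e) ` edges J = edges C" using C_eq edges_image_graph[of h J] by simp
  have "h \<in> emb G J"
    unfolding emb_def
  proof (intro CollectI conjI ballI)
    show "h \<in> verts J \<rightarrow>\<^sub>E verts G"
      using hV C by (intro PiE_I) (auto simp: h_def subgraph_def)
    show "inj_on h (verts J)"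
      using bij_betw_inv_into[OF f(1)] by (simp add: h_def bij_betw_def)
    show "h ` e \<in> edges G" if "e \<in> edges J" for e
      using hE C that by (auto simp: subgraph_def)
  qed
  then show "C \<in> (\<lambda>\<phi>. image_graph \<phi> J) ` emb G J" using C_eq by blast
next
  fix C assume "C \<in> (\<lambda>\<phi>. image_graph \<phi> J) ` emb G J"
  then obtain \<phi> where C: "C = image_graph \<phi> J" and \<phi>: "\<phi> \<in> emb G J" by auto
  have inj: "inj_on \<phi> (verts J)" using \<phi> by (simp add: emb_def)
  have "subgraph C G" using \<phi> simple_graph_image_graph[OF J inj] by (auto simp: C subgraph_def emb_def)
  moreover have "image_graph (inv_into (verts J) \<phi>) C = J"
    unfolding C image_graph_comp using inj by (intro image_graph_id J) auto
  then have "graph_iso C J"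
    unfolding graph_iso_def
    using bij_betw_inv_into[OF inj_on_imp_bij_betw[OF inj]] C
    by (metis edges_image_graph verts_image_graph)
  ultimately show "C \<in> copies G J" by (simp add: copies_def)
qed

lemma finite_copies: "simple_graph J \<Longrightarrow> finite (verts G) \<Longrightarrow> finite (copies G J)"
  by (simp add: copies_eq_image_emb finite_emb simple_graphD)

lemma card_le_fibres:
  fixes c :: real
  assumes "finite A" "f ` A \<subseteq> B" "finite B" "\<And>b. b \<in> B \<Longrightarrow> real (card {a\<in>A. f a = b}) \<le> c"
  shows "real (card A) \<le> real (card B) * c"
proof -
  have "card A = (\<Sum>b\<in>B. card {a\<in>A. f a = b})"
    using sum.group[OF assms(1,3,2), of "\<lambda>_. 1::nat"] by simp
  then have "real (card A) = (\<Sum>b\<in>B. real (card {a\<in>A. f a = b}))" by simp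
  also have "\<dots> \<le> (\<Sum>b\<in>B. c)" by (intro sum_mono assms(4))
  finally show ?thesis by simp
qed

lemma image_graph_self_emb:
  assumes "simple_graph F" "\<alpha> \<in> emb F F"
  shows "image_graph \<alpha> F = F"
proof -
  have fin: "finite (verts F)" "finite (edges F)" using assms(1) by (auto simp: simple_graphD)
  have inj: "inj_on \<alpha> (verts F)" "\<alpha> ` verts F \<subseteq> verts F" "(\<lambda>e. \<alpha> ` e) ` edges F \<subseteq> edges F"
    using assms(2) by (auto simp: emb_def)
  have "\<alpha> ` verts F = verts F" using inj fin by (simp add: endo_inj_surj)
  moreover have "(\<lambda>e. \<alpha> ` e) ` edges F = edges F"
    using inj inj_on_image_edges[OF assms(1) inj(1)] fin by (simp add: endo_inj_surj)
  ultimately show ?thesis by (simp add: image_graph_def)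
qed

lemma emb_compose:
  assumes F: "simple_graph F" and "\<phi> \<in> emb G E" "\<alpha> \<in> emb E F"
  shows "compose (verts F) \<phi> \<alpha> \<in> emb G F"
proof -
  have "compose (verts F) \<phi> \<alpha> ` e = \<phi> ` \<alpha> ` e" if "e \<in> edges F" for e
    using simple_graphD(2)[OF F that] by (auto simp: compose_def image_image intro!: image_cong)
  moreover have "inj_on (compose (verts F) \<phi> \<alpha>) (verts F)"
    using assms(2,3) by (auto simp: emb_def compose_def inj_on_def PiE_iff)
  ultimately show ?thesis using assms(2,3) by (auto simp: emb_def compose_def)
qed

text \<open>Every copy of \<open>F\<close> is the image of an embedding, and once one such embedding
  is chosen, the others with the same image differ from it by an automorphism. Comparing numbers of
  copies of \<open>F\<close> in two graphs is therefore the same as comparing numbers of embeddings,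
  which are easier to count step by step.\<close>
lemma card_emb_eq:
  assumes F: "simple_graph F" and G: "finite (verts G)"
  shows "card (emb G F) = num_copies G F * card (emb F F)"
proof -
  let ?V = "verts F"
  have fib: "card {\<phi> \<in> emb G F. image_graph \<phi> F = C} = card (emb F F)" if CF: "C \<in> copies G F" for C
  proof -
    obtain \<phi>0 where \<phi>0: "\<phi>0 \<in> emb G F" and C: "C = image_graph \<phi>0 F"
      using CF unfolding copies_eq_image_emb[OF F] by blast
    have inj: "inj_on \<phi>0 ?V" using \<phi>0 by (simp add: emb_def)
    have "bij_betw (compose ?V \<phi>0) (emb F F) {\<phi> \<in> emb G F. image_graph \<phi> F = C}"
      unfolding bij_betw_def
    proof (intro conjI equalityI subsetI)
      show "inj_on (compose ?V \<phi>0) (emb F F)"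
      proof (rule inj_onI)
        fix \<alpha> \<beta> assume ab: "\<alpha> \<in> emb F F" "\<beta> \<in> emb F F" "compose ?V \<phi>0 \<alpha> = compose ?V \<phi>0 \<beta>"
        show "\<alpha> = \<beta>"
        proof (rule PiE_ext)
          show "\<alpha> \<in> ?V \<rightarrow>\<^sub>E ?V" "\<beta> \<in> ?V \<rightarrow>\<^sub>E ?V" using ab by (auto simp: emb_def)
          fix x assume x: "x \<in> ?V"
          have "\<phi>0 (\<alpha> x) = \<phi>0 (\<beta> x)" using ab(3) x by (metis compose_eq)
          moreover have "\<alpha> x \<in> ?V" "\<beta> x \<in> ?V" using ab(1,2) x by (auto simp: emb_def)
          ultimately show "\<alpha> x = \<beta> x" by (rule inj_onD[OF inj])
        qed
      qed
    next
      fix \<phi> assume "\<phi> \<in> compose ?V \<phi>0 ` emb F F"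
      then obtain \<alpha> where \<alpha>: "\<alpha> \<in> emb F F" "\<phi> = compose ?V \<phi>0 \<alpha>" by auto
      have "image_graph \<phi> F = image_graph (\<phi>0 \<circ> \<alpha>) F"
        by (rule image_graph_cong[OF F]) (simp add: \<alpha>(2) compose_def)
      also have "\<dots> = C"
        unfolding C image_graph_comp[symmetric] image_graph_self_emb[OF F \<alpha>(1)] ..
      finally show "\<phi> \<in> {\<phi> \<in> emb G F. image_graph \<phi> F = C}"
        using emb_compose[OF F \<phi>0 \<alpha>(1)] \<alpha>(2) by simp
    next
      fix \<phi> assume "\<phi> \<in> {\<phi> \<in> emb G F. image_graph \<phi> F = C}"
      then have \<phi>: "\<phi> \<in> emb G F" "image_graph \<phi> F = C" by auto
      define \<alpha> where "\<alpha> = restrict (inv_into ?V \<phi>0 \<circ> \<phi>) ?V"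
      have V: "\<phi> ` ?V = \<phi>0 ` ?V" and E: "(\<lambda>e. \<phi> ` e) ` edges F = (\<lambda>e. \<phi>0 ` e) ` edges F"
        using \<phi>(2) C by (metis verts_image_graph, metis edges_image_graph)
      have \<alpha>V: "\<alpha> x \<in> ?V" "\<phi>0 (\<alpha> x) = \<phi> x" if x: "x \<in> ?V" for x
      proof -
        have "\<phi> x \<in> \<phi>0 ` ?V" using V x by blast
        then show "\<alpha> x \<in> ?V" "\<phi>0 (\<alpha> x) = \<phi> x"
          using x by (simp_all add: \<alpha>_def inv_into_into f_inv_into_f)
      qed
      have "inj_on \<alpha> ?V"
        using \<phi>(1) \<alpha>V(2) by (intro inj_onI) (metis (mono_tags, lifting) emb_def inj_onD mem_Collect_eq)
      moreover have "\<alpha> ` e \<in> edges F" if e: "e \<in> edges F" for e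
      proof -
        obtain e' where e': "e' \<in> edges F" "\<phi> ` e = \<phi>0 ` e'" using E e by blast
        have eV: "e \<subseteq> ?V" "e' \<subseteq> ?V" using simple_graphD(2)[OF F] e e'(1) by auto
        have "\<phi>0 ` \<alpha> ` e = \<phi> ` e"
          unfolding image_image using eV(1) \<alpha>V(2) by (intro image_cong refl) blast
        moreover have "\<alpha> ` e \<subseteq> ?V" using eV(1) \<alpha>V(1) by blast
        ultimately have "\<alpha> ` e = e'" using inj eV(2) e'(2) by (metis inj_on_image_eq_iff)
        then show ?thesis using e' by simp
      qed
      ultimately have "\<alpha> \<in> emb F F" using \<alpha>V(1) by (auto simp: emb_def \<alpha>_def)
      moreover have "\<phi> = compose ?V \<phi>0 \<alpha>"
        using \<phi>(1) \<alpha>V by (intro extensionalityI[of _ ?V]) (auto simp: emb_def compose_def PiE_iff)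
      ultimately show "\<phi> \<in> compose ?V \<phi>0 ` emb F F" by blast
    qed
    then show ?thesis by (simp add: bij_betw_same_card)
  qed
  have "card (emb G F) = (\<Sum>C\<in>copies G F. card {\<phi> \<in> emb G F. image_graph \<phi> F = C})"
    using sum.group[of "emb G F" "copies G F" "\<lambda>\<phi>. image_graph \<phi> F" "\<lambda>_. 1::nat"]
      finite_emb[OF simple_graphD(1)[OF F] G] finite_copies[OF F G]
    by (simp add: copies_eq_image_emb[OF F])
  then show ?thesis using fib by (simp add: num_copies_def)
qed

lemma card_emb_self_pos:
  assumes "simple_graph F" shows "card (emb F F) > 0"
proof -
  have "restrict id (verts F) ` e \<in> edges F" if "e \<in> edges F" for e
  proof -
    have "restrict id (verts F) ` e = id ` e"
      using simple_graphD(2)[OF assms that] by (intro image_cong refl) auto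
    then show ?thesis using that by simp
  qed
  then have "restrict id (verts F) \<in> emb F F"
    unfolding emb_def by (intro CollectI conjI ballI) (auto simp: inj_on_def)
  then show ?thesis using finite_emb[of F F] simple_graphD(1)[OF assms] card_gt_0_iff by blast
qed

lemma verts_K_graph [simp]: "verts (K_graph n) = {1..n}"
  by (simp add: K_graph_def)

lemma emb_K_graph:
  assumes "simple_graph F"
  shows "emb (K_graph n) F = {\<phi> \<in> verts F \<rightarrow>\<^sub>E {1..n}. inj_on \<phi> (verts F)}"
proof -
  have "\<phi> ` e \<in> edges (K_graph n)"
    if "\<phi> \<in> verts F \<rightarrow>\<^sub>E {1..n}" "inj_on \<phi> (verts F)" "e \<in> edges F" for \<phi> :: "'a \<Rightarrow> nat" and e
  proof -
    have e: "e \<subseteq> verts F" "card e = 2" using simple_graphD[OF assms] that(3) by auto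
    then have "card (\<phi> ` e) = 2" using that(2) by (simp add: card_image inj_on_subset)
    moreover have "\<phi> ` e \<subseteq> {1..n}" using e(1) that(1) by blast
    ultimately show ?thesis by (simp add: K_graph_def)
  qed
  then show ?thesis by (auto simp: emb_def K_graph_def)
qed

lemma graph_iso_trans: "graph_iso A B \<Longrightarrow> graph_iso B C \<Longrightarrow> graph_iso A C"
proof -
  assume "graph_iso A B" "graph_iso B C"
  then obtain f where "bij_betw f (verts A) (verts B)" "edges B = (\<lambda>e. f ` e) ` edges A"
    unfolding graph_iso_def by blast
  moreover from \<open>graph_iso B C\<close> obtain g where
      "bij_betw g (verts B) (verts C)" "edges C = (\<lambda>e. g ` e) ` edges B"
    unfolding graph_iso_def by blast
  ultimately have "bij_betw (g \<circ> f) (verts A) (verts C) \<and> edges C = (\<lambda>e. (g \<circ> f) ` e) ` edges A"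
    by (auto simp: bij_betw_trans image_comp image_image)
  then show ?thesis unfolding graph_iso_def by blast
qed

lemma graph_iso_sym:
  assumes "simple_graph A" "graph_iso A B"
  shows "graph_iso B A"
proof -
  obtain f where f: "bij_betw f (verts A) (verts B)" "edges B = (\<lambda>e. f ` e) ` edges A"
    using assms(2) unfolding graph_iso_def by blast
  have B: "B = image_graph f A" using f by (simp add: image_graph_def bij_betw_def prod_eq_iff)
  have "image_graph (inv_into (verts A) f) B = A"
    unfolding B image_graph_comp using f(1)
    by (intro image_graph_id assms(1)) (auto simp: bij_betw_def inv_into_f_f)
  then have "edges A = (\<lambda>e. inv_into (verts A) f ` e) ` edges B" using edges_image_graph by metis
  then show ?thesis unfolding graph_iso_def using bij_betw_inv_into[OF f(1)] by blast
qed

lemma copies_iso_cong: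
  fixes A :: "'a graph" and B :: "'b graph" and G :: "'c graph"
  assumes "simple_graph A" "simple_graph B" "graph_iso A B"
  shows "copies G A = copies G B"
proof -
  have "graph_iso F A \<longleftrightarrow> graph_iso F B" for F :: "'c graph"
    using graph_iso_trans[of F A B] graph_iso_trans[of F B A] graph_iso_sym[OF assms(1,3)] assms(3)
    by blast
  then show ?thesis by (simp add: copies_def)
qed

lemma card_emb_iso_le:
  assumes A: "simple_graph A" and B: "finite (verts B)" and iso: "graph_iso A B" and F: "simple_graph F"
  shows "card (emb A F) \<le> card (emb B F)"
proof -
  obtain f where f: "bij_betw f (verts A) (verts B)" "edges B = (\<lambda>e. f ` e) ` edges A"
    using iso unfolding graph_iso_def by blast
  have inj: "inj_on f (verts A)" using f(1) by (simp add: bij_betw_def)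
  let ?f = "restrict f (verts A)"
  have im: "?f ` e = f ` e" if "e \<in> edges A" for e
    using simple_graphD(2)[OF A that] by (intro image_cong refl) auto
  have "?f ` e \<in> edges B" if "e \<in> edges A" for e unfolding im[OF that] using that f(2) by blast
  moreover have "?f \<in> verts A \<rightarrow>\<^sub>E verts B" using f(1) by (auto simp: bij_betw_def)
  moreover have "inj_on ?f (verts A)" using inj by simp
  ultimately have fe: "?f \<in> emb B A" unfolding emb_def by blast
  show ?thesis
  proof (rule card_inj_on_le)
    show "(compose (verts F) ?f) ` emb A F \<subseteq> emb B F" using emb_compose[OF F fe] by blast
    show "inj_on (compose (verts F) ?f) (emb A F)"
    proof (rule inj_onI)
      fix \<phi> \<psi> assume p: "\<phi> \<in> emb A F" "\<psi> \<in> emb A F" "compose (verts F) ?f \<phi> = compose (verts F) ?f \<psi>"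
      show "\<phi> = \<psi>"
      proof (rule PiE_ext[of _ "verts F" "\<lambda>_. verts A"])
        show P: "\<phi> \<in> verts F \<rightarrow>\<^sub>E verts A" "\<psi> \<in> verts F \<rightarrow>\<^sub>E verts A" using p by (auto simp: emb_def)
        fix x assume x: "x \<in> verts F"
        have xA: "\<phi> x \<in> verts A" "\<psi> x \<in> verts A" using P x by auto
        have "?f (\<phi> x) = ?f (\<psi> x)" using fun_cong[OF p(3), of x] x by (simp add: compose_eq)
        then have "f (\<phi> x) = f (\<psi> x)" using xA by simp
        then show "\<phi> x = \<psi> x" using inj xA by (simp add: inj_on_eq_iff)
      qed
    qed
    show "finite (emb B F)" by (rule finite_emb[OF simple_graphD(1)[OF F] B])
  qed
qed

section \<open>Sparse graphs\<close>

lemma q_sparseD: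
  assumes "q_sparse n q H" "0 \<le> q" "subgraph I H"
  shows "1 \<le> real (num_copies (K_graph n) I) * q ^ card (edges I)"
  using assms expected_copies_eq[of q n I] unfolding q_sparse_def by metis

lemma num_copies_K_graph_le:
  assumes I: "simple_graph I"
  shows "real (num_copies (K_graph n) I) \<le> real n ^ card (verts I)"
proof -
  have fin: "finite (verts I)" by (rule simple_graphD[OF I])
  have "num_copies (K_graph n) I \<le> card (emb (K_graph n) I)"
    using card_emb_eq[OF I, of "K_graph n"] card_emb_self_pos[OF I] by simp
  also have "\<dots> \<le> card (verts I \<rightarrow>\<^sub>E {1..n})"
    by (intro card_mono finite_PiE fin) (auto simp: emb_def)
  also have "\<dots> = n ^ card (verts I)" by (simp add: card_funcsetE fin)
  finally show ?thesis by (metis of_nat_le_iff of_nat_power)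
qed

text \<open>Forgetting the symmetries of \<open>I\<close>, which only lower its number of copies,
  leaves a condition on densities.\<close>
lemma q_sparse_density:
  assumes "q_sparse n q H" "0 \<le> q" "subgraph I H"
  shows "1 \<le> real n ^ card (verts I) * q ^ card (edges I)"
proof -
  have "simple_graph I" using assms by (simp add: subgraph_def)
  then show ?thesis
    using q_sparseD[OF assms] num_copies_K_graph_le[of I n] assms(2)
    by (meson mult_right_mono order_trans zero_le_power)
qed

lemma q_sparse_edge:
  assumes H: "simple_graph H" "e \<in> edges H" and sparse: "q_sparse n q H" "0 \<le> q"
  shows "1 \<le> (real n)\<^sup>2 * q"
proof -
  have "subgraph (e, {e}) H"
    using simple_graphD[OF H(1)] H(2) finite_subset by (fastforce simp: subgraph_def simple_graph_def)
  from q_sparse_density[OF sparse this] show ?thesis using simple_graphD(3)[OF H] by simp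
qed

lemma q_pos_if_q_sparse:
  assumes "simple_graph H" "e \<in> edges H" "q_sparse n q H" "0 \<le> q"
  shows "0 < q"
  using q_sparse_edge[OF assms] assms(4) by (cases "q = 0") auto

lemma card_verts_le_if_q_sparse:
  assumes H: "simple_graph H" and "q_sparse n q H" "0 \<le> q"
  shows "card (verts H) \<le> n"
proof -
  have "subgraph H H" using H by (simp add: subgraph_def)
  from q_sparseD[OF assms(2,3) this] have "num_copies (K_graph n) H \<noteq> 0" by (intro notI) simp
  then have "copies (K_graph n) H \<noteq> {}" by (auto simp: num_copies_def)
  then obtain \<phi> where "\<phi> \<in> emb (K_graph n) H" by (auto simp: copies_eq_image_emb[OF H])
  then have "\<phi> ` verts H \<subseteq> {1..n}" "inj_on \<phi> (verts H)" by (auto simp: emb_def)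
  then show ?thesis using card_inj_on_le[of \<phi> "verts H" "{1..n}"] by simp
qed

section \<open>Falling factorials\<close>

lemma card_injections:
  assumes "finite V" "finite C"
  shows "card {f \<in> V \<rightarrow>\<^sub>E C. inj_on f V} = (\<Prod>i<card V. card C - i)"
  using card_inj_on_subset_funcset[OF assms subset_refl] by (simp add: atLeast0LessThan)

lemma falling_mono: "N \<le> M \<Longrightarrow> (\<Prod>i<v. N - i) \<le> (\<Prod>i<v. M - i)" for N M v :: nat
  by (intro prod_mono) auto

lemma falling_split:
  fixes n v w :: nat
  assumes "w \<le> v"
  shows "(\<Prod>i<v. n - i) = (\<Prod>i<w. n - i) * (\<Prod>i<v - w. (n - w) - i)"
proof -
  have "(\<Prod>i<w + k. n - i) = (\<Prod>i<w. n - i) * (\<Prod>i<k. (n - w) - i)" for k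
    by (induction k) (auto simp: diff_diff_left)
  from this[of "v - w"] show ?thesis using assms by simp
qed

lemma falling_self: "(\<Prod>i<u. u - i) = (fact u :: nat)"
  using prod.nat_diff_reindex[of "\<lambda>i. Suc i" u] by (simp add: fact_prod_Suc atLeast0LessThan Suc_diff_Suc)

text \<open>The left-hand side is one term of the exponential series.\<close>
lemma power_div_fact_le_exp:
  fixes x :: real
  assumes "0 \<le> x"
  shows "x ^ k / fact k \<le> exp x"
proof -
  have "sum (\<lambda>n. x ^ n /\<^sub>R fact n) {k} \<le> (\<Sum>n. x ^ n /\<^sub>R fact n)"
    by (intro sum_le_suminf summable_exp_generic) (use assms in auto)
  then show ?thesis by (simp add: exp_def divide_inverse mult.commute)
qed

lemma fact_ge_power: "(real m / 3) ^ m \<le> fact m"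
proof -
  have "real m ^ m / fact m \<le> exp (real m)" by (rule power_div_fact_le_exp) simp
  also have "\<dots> = exp 1 ^ m" by (simp flip: exp_of_nat_mult)
  also have "\<dots> \<le> 3 ^ m" by (intro power_mono exp_le) simp
  finally show ?thesis by (simp add: power_divide field_simps)
qed

text \<open>The binomial coefficient is at least \<open>(n / v)\<^sup>v\<close> and
  \<open>v!\<close> is at least \<open>(v / 3)\<^sup>v\<close>.\<close>
lemma falling_ge:
  fixes n v :: nat
  assumes "v \<le> n"
  shows "(real n / 3) ^ v \<le> real (\<Prod>i<v. n - i)"
proof (cases "v = 0")
  case False
  have "(real n / 3) ^ v = (real n / real v) ^ v * (real v / 3) ^ v"
    using False by (simp flip: power_mult_distrib)
  also have "\<dots> \<le> real (n choose v) * fact v"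
    by (intro mult_mono fact_ge_power binomial_ge_n_over_k_pow_k assms) auto
  also have "\<dots> = (\<Prod>i = 0..<v. real n - real i)"
    by (simp add: binomial_gbinomial gbinomial_prod_rev)
  also have "\<dots> = real (\<Prod>i<v. n - i)"
    using assms by (auto simp: atLeast0LessThan of_nat_diff intro!: prod.cong)
  finally show ?thesis .
qed simp

lemma card_emb_K_graph:
  assumes "simple_graph F"
  shows "card (emb (K_graph n) F) = (\<Prod>i<card (verts F). n - i)"
  using card_injections[of "verts F" "{1..n}"] simple_graphD(1)[OF assms]
  by (simp add: emb_K_graph[OF assms])

lemma num_copies_K_graph_pos:
  assumes "simple_graph F" "card (verts F) \<le> n"
  shows "num_copies (K_graph n) F > 0"
proof -
  have "card (emb (K_graph n) F) > 0"
    using assms(2) unfolding card_emb_K_graph[OF assms(1)] by (intro prod_pos) auto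
  then show ?thesis using card_emb_eq[OF assms(1), of "K_graph n"] by simp
qed

section \<open>From embeddings to copies\<close>

lemma card_edges_verts_le:
  assumes "finite E" "\<And>e. e \<in> E \<Longrightarrow> card e = 2"
  shows "card (\<Union>E) \<le> 2 * card E"
  using card_Union_le_sum_card[of E] sum.cong[of E E card "\<lambda>_. 2"] assms by simp

text \<open>The isolated vertices are placed last, injectively and outside the image of the other
  vertices. This keeps the exact falling factorial for them: the estimate \<open>(n /
  3)\<^sup>v\<close> costs a factor per vertex, which can be charged to edges only for vertices that
  lie on an edge.\<close>
lemma card_emb_isolated_le:
  fixes H :: "'b graph" and F F' :: "'a graph"
  assumes H: "finite (verts H)" and F: "simple_graph F"
    and F': "F' = (\<Union>(edges F), edges F)"
  shows "real (card (emb H F)) \<le> real (card (emb H F')) *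
    real (\<Prod>i<card (verts F) - card (verts F'). (card (verts H) - card (verts F')) - i)"
proof (rule card_le_fibres[where f = "\<lambda>\<phi>. restrict \<phi> (verts F')"])
  have V': "verts F' \<subseteq> verts F" using simple_graphD(2)[OF F] F' by auto
  have fin: "finite (verts F)" "finite (verts F')"
    using simple_graphD(1)[OF F] V' by (auto intro: finite_subset)
  show "finite (emb H F)" "finite (emb H F')" using H fin by (auto intro: finite_emb)
  have res: "restrict \<phi> (verts F') ` e = \<phi> ` e" if "e \<in> edges F" for \<phi> :: "'a \<Rightarrow> 'b" and e
    using that by (intro image_cong refl) (auto simp: F')
  show "(\<lambda>\<phi>. restrict \<phi> (verts F')) ` emb H F \<subseteq> emb H F'"
  proof (rule image_subsetI)
    fix \<phi> assume \<phi>: "\<phi> \<in> emb H F"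
    have "inj_on (restrict \<phi> (verts F')) (verts F')"
      using \<phi> V' by (auto simp: emb_def intro: inj_on_subset)
    moreover have "restrict \<phi> (verts F') ` e \<in> edges H" if "e \<in> edges F'" for e
      using res[of e \<phi>] \<phi> that by (simp add: emb_def F')
    moreover have "restrict \<phi> (verts F') \<in> verts F' \<rightarrow>\<^sub>E verts H"
      using \<phi> V' by (auto simp: emb_def)
    ultimately show "restrict \<phi> (verts F') \<in> emb H F'" by (simp add: emb_def)
  qed
  fix \<psi> assume \<psi>: "\<psi> \<in> emb H F'"
  let ?W = "verts F - verts F'" and ?Z = "verts H - \<psi> ` verts F'"
  let ?A = "{\<phi> \<in> emb H F. restrict \<phi> (verts F') = \<psi>}"
  let ?B = "{\<theta> \<in> ?W \<rightarrow>\<^sub>E ?Z. inj_on \<theta> ?W}"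
  have "card ?A \<le> card ?B"
  proof (rule card_inj_on_le[where f = "\<lambda>\<phi>. restrict \<phi> ?W"])
    show "inj_on (\<lambda>\<phi>. restrict \<phi> ?W) ?A"
    proof (rule inj_onI)
      fix \<phi> \<rho> assume a: "\<phi> \<in> ?A" "\<rho> \<in> ?A" "restrict \<phi> ?W = restrict \<rho> ?W"
      show "\<phi> = \<rho>"
      proof (rule PiE_ext[of _ "verts F" "\<lambda>_. verts H"])
        show "\<phi> \<in> verts F \<rightarrow>\<^sub>E verts H" "\<rho> \<in> verts F \<rightarrow>\<^sub>E verts H" using a by (auto simp: emb_def)
        fix x assume "x \<in> verts F"
        moreover have "restrict \<phi> (verts F') x = restrict \<rho> (verts F') x" using a by simp
        moreover have "restrict \<phi> ?W x = restrict \<rho> ?W x" using a(3) by simp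
        ultimately show "\<phi> x = \<rho> x" by (auto split: if_splits)
      qed
    qed
    show "(\<lambda>\<phi>. restrict \<phi> ?W) ` ?A \<subseteq> ?B"
    proof (rule image_subsetI)
      fix \<phi> assume "\<phi> \<in> ?A"
      then have \<phi>: "\<phi> \<in> emb H F" and r: "\<psi> = restrict \<phi> (verts F')" by auto
      have inj: "inj_on \<phi> (verts F)" using \<phi> by (simp add: emb_def)
      have "\<psi> ` verts F' = \<phi> ` verts F'" using r by simp
      moreover have "\<phi> x \<notin> \<phi> ` verts F'" if "x \<in> ?W" for x
        using that inj V' by (auto dest!: inj_onD[OF inj])
      moreover have "\<phi> x \<in> verts H" if "x \<in> ?W" for x using that \<phi> by (auto simp: emb_def)
      moreover have "inj_on \<phi> ?W" using inj by (rule inj_on_subset) auto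
      ultimately show "restrict \<phi> ?W \<in> ?B" by auto
    qed
    show "finite ?B" using fin H by (intro finite_subset[OF _ finite_PiE[of ?W "\<lambda>_. ?Z"]]) auto
  qed
  also have "\<dots> = (\<Prod>i<card ?W. card ?Z - i)" using fin H by (intro card_injections) auto
  also have "card ?W = card (verts F) - card (verts F')" using V' fin by (simp add: card_Diff_subset)
  also have "card ?Z = card (verts H) - card (verts F')"
  proof -
    have "\<psi> ` verts F' \<subseteq> verts H" "inj_on \<psi> (verts F')" using \<psi> by (auto simp: emb_def)
    then show ?thesis using fin by (simp add: card_Diff_subset card_image)
  qed
  finally show "real (card ?A) \<le>
      real (\<Prod>i<card (verts F) - card (verts F'). (card (verts H) - card (verts F')) - i)"
    by (simp only: of_nat_le_iff)
qed

text \<open>A graph without isolated vertices has at most twice as many vertices as edges, so a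
  constant factor per vertex, in particular the passage from \<open>n\<^sup>v\<close> to the number
  of injections into \<open>{1..n}\<close>, is a constant factor per edge.\<close>
lemma num_copies_less_if_emb_bound:
  fixes a C q :: real and H :: "'b graph" and F :: "'b graph"
  assumes H: "simple_graph H" "card (verts H) \<le> n" and F: "subgraph F H" "edges F \<noteq> {}"
    and pos: "a \<ge> 1" "C > 0" "q > 0"
    and bound: "\<And>F'. subgraph F' H \<Longrightarrow>
      real (card (emb H F')) \<le> (a * real n) ^ card (verts F') * (C * q) ^ card (edges F')"
  shows "real (num_copies H F) < real (num_copies (K_graph n) F) * (10 * a\<^sup>2 * C * q) ^ card (edges F)"
proof -
  have sF: "simple_graph F" and sub: "verts F \<subseteq> verts H" using F by (auto simp: subgraph_def)
  define F' where "F' = (\<Union>(edges F), edges F)"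
  have F'V: "verts F' \<subseteq> verts F" using simple_graphD(2)[OF sF] by (auto simp: F'_def)
  have sF': "subgraph F' H"
    using F F'V simple_graphD[OF sF] finite_subset[OF F'V]
    by (auto simp: subgraph_def simple_graph_def F'_def)
  let ?e = "card (edges F)" and ?v = "card (verts F)" and ?w = "card (verts F')"
  let ?D = "\<lambda>n v. real (\<Prod>i<v. n - i :: nat)"
  have e: "?e > 0" using F(2) simple_graphD(4)[OF sF] by (simp add: card_gt_0_iff)
  have v: "?v \<le> n" using card_mono[OF simple_graphD(1)[OF H(1)] sub] H(2) by simp
  have wv: "?w \<le> ?v" using F'V simple_graphD(1)[OF sF] by (simp add: card_mono)
  have w: "?w \<le> 2 * ?e" unfolding F'_def
    using card_edges_verts_le[of "edges F"] simple_graphD(3,4)[OF sF] by simp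
  have "(a * real n) ^ ?w = (3 * a) ^ ?w * (real n / 3) ^ ?w"
    unfolding power_mult_distrib[symmetric] by simp
  also have "\<dots> \<le> (9 * a\<^sup>2) ^ ?e * ?D n ?w"
  proof (intro mult_mono falling_ge)
    have "(3 * a) ^ ?w \<le> (3 * a) ^ (2 * ?e)" using w pos(1) by (intro power_increasing) auto
    also have "(3 * a) ^ (2 * ?e) = (9 * a\<^sup>2) ^ ?e"
      unfolding power_mult[of "3 * a"] power_mult_distrib[of 3 a 2] by simp
    finally show "(3 * a) ^ ?w \<le> (9 * a\<^sup>2) ^ ?e" .
  qed (use v wv pos(1) in auto)
  finally have n_pow: "(a * real n) ^ ?w \<le> (9 * a\<^sup>2) ^ ?e * ?D n ?w" .
  have "real (card (emb H F)) \<le> real (card (emb H F')) * ?D (card (verts H) - ?w) (?v - ?w)"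
    using card_emb_isolated_le[OF simple_graphD(1)[OF H(1)] sF F'_def] .
  also have "\<dots> \<le> ((9 * a\<^sup>2) ^ ?e * ?D n ?w * (C * q) ^ ?e) * ?D (n - ?w) (?v - ?w)"
  proof (intro mult_mono)
    have "real (card (emb H F')) \<le> (a * real n) ^ ?w * (C * q) ^ ?e"
      using bound[OF sF'] by (simp add: F'_def)
    also have "\<dots> \<le> (9 * a\<^sup>2) ^ ?e * ?D n ?w * (C * q) ^ ?e" using pos by (intro mult_right_mono n_pow) auto
    finally show "real (card (emb H F')) \<le> (9 * a\<^sup>2) ^ ?e * ?D n ?w * (C * q) ^ ?e" .
    show "?D (card (verts H) - ?w) (?v - ?w) \<le> ?D (n - ?w) (?v - ?w)"
      unfolding of_nat_le_iff by (rule falling_mono) (use H(2) in simp)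
  qed (use pos in \<open>auto intro!: mult_nonneg_nonneg prod_nonneg\<close>)
  also have "\<dots> = ?D n ?v * (9 * (a\<^sup>2 * (C * q))) ^ ?e"
    unfolding falling_split[OF wv, of n] of_nat_mult by (simp add: power_mult_distrib mult_ac)
  also have "\<dots> < ?D n ?v * (10 * (a\<^sup>2 * (C * q))) ^ ?e"
  proof (intro mult_strict_left_mono power_strict_mono)
    have "0 < (\<Prod>i<?v. n - i)" using v by (intro prod_pos) auto
    then show "0 < ?D n ?v" by (simp only: of_nat_0_less_iff)
  qed (use pos e in auto)
  finally have "real (card (emb H F)) < real (card (emb (K_graph n) F)) * (10 * a\<^sup>2 * C * q) ^ ?e"
    by (simp add: card_emb_K_graph[OF sF] mult.assoc)
  then have "real (card (emb F F)) * real (num_copies H F) <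
      real (card (emb F F)) * (real (num_copies (K_graph n) F) * (10 * a\<^sup>2 * C * q) ^ ?e)"
    using card_emb_eq[OF sF simple_graphD(1)[OF H(1)]] card_emb_eq[OF sF, of "K_graph n"]
    by (simp add: mult_ac)
  then show ?thesis by (simp add: mult_less_cancel_left_pos card_emb_self_pos[OF sF])
qed

lemma num_copies_le_K_graph:
  assumes H: "simple_graph H" "card (verts H) \<le> n" and F: "simple_graph F"
  shows "num_copies H F \<le> num_copies (K_graph n) F"
proof -
  have fin: "finite (verts H)" "finite (verts F)" using H F by (auto simp: simple_graphD)
  have "card (emb H F) \<le> card {f \<in> verts F \<rightarrow>\<^sub>E verts H. inj_on f (verts F)}"
    using fin by (intro card_mono finite_subset[OF _ finite_PiE[of "verts F" "\<lambda>_. verts H"]]) (auto simp: emb_def)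
  also have "\<dots> = (\<Prod>i<card (verts F). card (verts H) - i)" by (rule card_injections[OF fin(2,1)])
  also have "\<dots> \<le> card (emb (K_graph n) F)" unfolding card_emb_K_graph[OF F] by (rule falling_mono[OF H(2)])
  finally have "num_copies H F * card (emb F F) \<le> num_copies (K_graph n) F * card (emb F F)"
    using card_emb_eq[OF F fin(1)] card_emb_eq[OF F, of "K_graph n"] by simp
  then show ?thesis using card_emb_self_pos[OF F] by simp
qed

section \<open>Packings\<close>

text \<open>The union \<open>I\<close> of the pieces is a subgraph of \<open>H\<close>, hence has at
  least \<open>q\<close> to the power \<open>-k |\<D>|\<close> copies in the complete graph. Such a
  copy is the union of the images of the pieces, and these form a set of \<open>|\<D>|\<close>
  elements of a menu \<open>X\<close>; there are at most \<open>|\<G>|\<close> menus with at most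
  \<open>t\<close> elements each. It is essential that only the set of images matters: the resulting
  factorial bounds the size of a packing by a multiple of \<open>t q\<^sup>k\<close>, the expected
  number of choices for a single piece.\<close>
lemma packing:
  fixes H :: "'a graph" and \<D> :: "'a graph set" and \<G> :: "nat graph set set"
  assumes H: "q_sparse n q H" "0 \<le> q"
    and \<D>: "finite \<D>" "\<And>D. D \<in> \<D> \<Longrightarrow> subgraph D H" "\<And>D. D \<in> \<D> \<Longrightarrow> card (edges D) = k"
      "\<And>D D'. D \<in> \<D> \<Longrightarrow> D' \<in> \<D> \<Longrightarrow> D \<noteq> D' \<Longrightarrow> edges D \<inter> edges D' = {}"
    and \<G>: "finite \<G>" "\<And>X. X \<in> \<G> \<Longrightarrow> finite X" "\<And>X. X \<in> \<G> \<Longrightarrow> card X \<le> t"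
      "\<And>f. inj_on f (\<Union>D\<in>\<D>. verts D) \<Longrightarrow> f ` (\<Union>D\<in>\<D>. verts D) \<subseteq> {1..n} \<Longrightarrow>
        \<exists>X\<in>\<G>. \<forall>D\<in>\<D>. image_graph f D \<in> X"
  shows "fact (card \<D>) \<le> real (card \<G>) * (real t * q ^ k) ^ card \<D>"
proof -
  let ?m = "card \<D>"
  define I where "I = (\<Union>D\<in>\<D>. verts D, \<Union>D\<in>\<D>. edges D)"
  have sD: "simple_graph D" if "D \<in> \<D>" for D using \<D>(2)[OF that] by (simp add: subgraph_def)
  have sI: "simple_graph I" unfolding simple_graph_def
  proof (intro conjI ballI)
    show "finite (verts I)" using \<D>(1) simple_graphD(1)[OF sD] by (simp add: I_def)
    fix e assume "e \<in> edges I"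
    then obtain D where "D \<in> \<D>" "e \<in> edges D" by (auto simp: I_def)
    then show "e \<subseteq> verts I" "card e = 2"
      using simple_graphD(2,3)[OF sD] unfolding I_def fst_conv by blast+
  qed
  have subI: "subgraph I H" unfolding subgraph_def
  proof (intro conjI sI)
    show "verts I \<subseteq> verts H" using \<D>(2) unfolding I_def subgraph_def fst_conv by blast
    show "edges I \<subseteq> edges H" using \<D>(2) unfolding I_def subgraph_def snd_conv by blast
  qed
  have eI: "card (edges I) = ?m * k"
    unfolding I_def snd_conv using \<D>(3,4) simple_graphD(4)[OF sD]
    by (subst card_UN_disjoint[OF \<D>(1)]) auto
  let ?U = "\<lambda>Y :: nat graph set. (\<Union>D\<in>Y. verts D, \<Union>D\<in>Y. edges D)"
  let ?P = "\<lambda>X. {Y. Y \<subseteq> X \<and> card Y = ?m}"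
  have "copies (K_graph n) I \<subseteq> (\<Union>X\<in>\<G>. ?U ` ?P X)"
  proof
    fix J assume "J \<in> copies (K_graph n) I"
    then obtain f where f: "f \<in> emb (K_graph n) I" and J: "J = image_graph f I"
      by (auto simp: copies_eq_image_emb[OF sI])
    have inj: "inj_on f (verts I)" and im: "f ` verts I \<subseteq> {1..n}" using f by (auto simp: emb_def)
    obtain X where X: "X \<in> \<G>" "\<forall>D\<in>\<D>. image_graph f D \<in> X"
      using \<G>(4)[of f] inj im by (auto simp: I_def)
    have "inj_on (image_graph f) \<D>"
    proof (rule inj_onI)
      fix D D' assume D: "D \<in> \<D>" "D' \<in> \<D>" and eq: "image_graph f D = image_graph f D'"
      have inverse_image: "image_graph (inv_into (verts I) f) (image_graph f D) = D" if "D \<in> \<D>" for D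
      proof -
        have "verts D \<subseteq> verts I" using that by (auto simp: I_def)
        then show ?thesis
          unfolding image_graph_comp using that
          by (intro image_graph_id sD) (auto simp: inv_into_f_f[OF inj])
      qed
      show "D = D'" using inverse_image[OF D(1)] inverse_image[OF D(2)] eq by metis
    qed
    then have "image_graph f ` \<D> \<in> ?P X" using X(2) by (auto simp: card_image)
    moreover have "J = ?U (image_graph f ` \<D>)" by (auto simp: J I_def image_graph_def)
    ultimately show "J \<in> (\<Union>X\<in>\<G>. ?U ` ?P X)" using X(1) by blast
  qed
  moreover have finP: "finite (?P X)" if "X \<in> \<G>" for X
    by (rule finite_subset[of _ "Pow X"]) (use \<G>(2)[OF that] in auto)
  ultimately have "num_copies (K_graph n) I \<le> card (\<Union>X\<in>\<G>. ?U ` ?P X)"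
    unfolding num_copies_def using \<G>(1) by (intro card_mono) auto
  also have "\<dots> \<le> (\<Sum>X\<in>\<G>. card (?U ` ?P X))" by (rule card_UN_le[OF \<G>(1)])
  also have "\<dots> \<le> (\<Sum>X\<in>\<G>. t choose ?m)"
  proof (rule sum_mono)
    fix X assume X: "X \<in> \<G>"
    have "card (?U ` ?P X) \<le> card (?P X)" by (rule card_image_le[OF finP[OF X]])
    also have "\<dots> = card X choose ?m" by (rule n_subsets[OF \<G>(2)[OF X]])
    also have "\<dots> \<le> t choose ?m" by (rule binomial_right_mono[OF \<G>(3)[OF X]])
    finally show "card (?U ` ?P X) \<le> t choose ?m" .
  qed
  finally have N: "real (num_copies (K_graph n) I) \<le> real (card \<G>) * real (t choose ?m)"
    by (simp flip: of_nat_mult)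
  have "1 \<le> real (num_copies (K_graph n) I) * q ^ (?m * k)" using q_sparseD[OF H subI] eI by simp
  also have "\<dots> \<le> real (card \<G>) * real (t choose ?m) * q ^ (?m * k)"
    using N H(2) by (intro mult_right_mono) auto
  finally have "fact ?m * 1 \<le> fact ?m * (real (card \<G>) * real (t choose ?m) * q ^ (?m * k))"
    by (intro mult_left_mono) auto
  also have "\<dots> = (real (card \<G>) * q ^ (?m * k)) * real ((t choose ?m) * fact ?m)"
    by (simp add: mult_ac)
  also have "\<dots> \<le> (real (card \<G>) * q ^ (?m * k)) * real (t ^ ?m)"
    using H(2) binomial_fact_pow[of t ?m] by (intro mult_left_mono of_nat_mono) auto
  also have "\<dots> = real (card \<G>) * (real t * q ^ k) ^ ?m"
    by (simp add: power_mult_distrib power_mult[symmetric] mult_ac)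
  finally show ?thesis by simp
qed

text \<open>The factor \<open>a\<close> is the price of a root that all pieces share. It is harmless
  as soon as the packing has at least \<open>log\<^sub>2 a\<close> pieces.\<close>
lemma le_if_fact_le_power:
  fixes \<mu> a :: real
  assumes "fact m \<le> a * \<mu> ^ m" "a \<le> 2 ^ m" "\<mu> \<ge> 0"
  shows "real m \<le> 6 * \<mu>"
proof (cases "m = 0")
  case False
  have "(real m / 3) ^ m \<le> a * \<mu> ^ m" using fact_ge_power[of m] assms(1) by linarith
  also have "\<dots> \<le> 2 ^ m * \<mu> ^ m" using assms by (intro mult_right_mono) auto
  finally have "(real m / 3) ^ m \<le> (2 * \<mu>) ^ m" by (simp add: power_mult_distrib)
  then have "real m / 3 \<le> 2 * \<mu>"
    by (rule iffD1[OF power_mono_iff, rotated -1]) (use False assms(3) in auto)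
  then show ?thesis by simp
qed (use assms in simp)

section \<open>Fractional orientations\<close>

text \<open>Every edge distributes one unit of weight over its ends. Among all distributions take
  one that minimises the sum of the squared loads of the vertices; it exists by compactness. If an
  edge gave weight to a vertex although another of its ends had a smaller load, moving a little
  weight would decrease the sum. Hence an edge that meets the set \<open>T\<close> of vertices of
  maximal load without being contained in it gives no weight to its ends in \<open>T\<close>, so the
  total load of \<open>T\<close> is the number of edges inside \<open>T\<close>, and the maximal
  load is at most the density of \<open>T\<close>. Edges may have any number of ends.\<close>
lemma fractional_orientation:
  fixes V :: "'a set" and E :: "'a set set" and c :: real
  assumes V: "finite V" and E: "\<And>e. e \<in> E \<Longrightarrow> e \<subseteq> V" "\<And>e. e \<in> E \<Longrightarrow> e \<noteq> {}"
    and dens: "\<And>T. T \<subseteq> V \<Longrightarrow> T \<noteq> {} \<Longrightarrow> real (card {e\<in>E. e \<subseteq> T}) \<le> c * real (card T)"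
  obtains w :: "'a \<Rightarrow> 'a set \<Rightarrow> real"
  where "\<And>e x. e \<in> E \<Longrightarrow> x \<in> e \<Longrightarrow> 0 \<le> w x e" "\<And>e. e \<in> E \<Longrightarrow> (\<Sum>x\<in>e. w x e) = 1"
    "\<And>x. x \<in> V \<Longrightarrow> (\<Sum>e\<in>{e\<in>E. x \<in> e}. w x e) \<le> c"
proof (cases "V = {}")
  case True
  then have "E = {}" using E by blast
  then show ?thesis using True that[of "\<lambda>_ _. 0"] by simp
next
  case V_ne: False
  have finE: "finite E" by (rule finite_subset[of _ "Pow V"]) (use V E in auto)
  have fine: "finite e" if "e \<in> E" for e using E(1)[OF that] V by (rule finite_subset)
  \<comment> \<open>Distributions are functions on pairs, so that they form a subset of a compact product of intervals.\<close>
  define K :: "('a \<times> 'a set \<Rightarrow> real) set" where "K = PiE UNIV (\<lambda>_. {0..1})"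
  define S where "S = K \<inter> {w. \<forall>e\<in>E. (\<Sum>x\<in>e. w (x, e)) = 1}"
  define load :: "('a \<times> 'a set \<Rightarrow> real) \<Rightarrow> 'a \<Rightarrow> real"
    where "load w x = (\<Sum>e\<in>{e\<in>E. x \<in> e}. w (x, e))" for w x
  have "compact K"
  proof -
    have "compactin (product_topology (\<lambda>_ :: 'a \<times> 'a set. euclidean :: real topology) UNIV) K"
      unfolding K_def compactin_PiE by simp
    then show ?thesis by (simp add: euclidean_product_topology)
  qed
  moreover have "closed {w :: 'a \<times> 'a set \<Rightarrow> real. \<forall>e\<in>E. (\<Sum>x\<in>e. w (x, e)) = 1}"
  proof -
    have "closed (\<Inter>e\<in>E. {w :: 'a \<times> 'a set \<Rightarrow> real. (\<Sum>x\<in>e. w (x, e)) = 1})"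
      by (intro closed_INT ballI closed_Collect_eq continuous_intros continuous_on_product_coordinates)
    then show ?thesis by (rule back_subst[of closed]) auto
  qed
  ultimately have "compact S" unfolding S_def by (rule compact_Int_closed)
  moreover have "S \<noteq> {}"
  proof -
    have "(\<lambda>(x, e). if e \<in> E then 1 / real (card e) else 0) \<in> S"
      using fine E by (auto simp: S_def K_def divide_simps Suc_le_eq card_gt_0_iff)
    then show ?thesis by blast
  qed
  moreover have "continuous_on S (\<lambda>w. \<Sum>x\<in>V. (load w x)\<^sup>2)"
    unfolding load_def
    by (intro continuous_intros continuous_on_subset[OF continuous_on_product_coordinates subset_UNIV])
  ultimately obtain w where w: "w \<in> S"
    and opt: "\<And>w'. w' \<in> S \<Longrightarrow> (\<Sum>x\<in>V. (load w x)\<^sup>2) \<le> (\<Sum>x\<in>V. (load w' x)\<^sup>2)"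
    using continuous_attains_inf[of S "\<lambda>w. \<Sum>x\<in>V. (load w x)\<^sup>2"] by blast
  have w01: "0 \<le> w p" "w p \<le> 1" for p
    using w by (cases p; auto simp: S_def K_def PiE_iff)+
  have w1: "(\<Sum>x\<in>e. w (x, e)) = 1" if "e \<in> E" for e using w that by (simp add: S_def)
  have downhill: "load w x \<le> load w y" if e: "e \<in> E" "x \<in> e" "y \<in> e" and pos: "w (x, e) > 0" for x y e
  proof (rule ccontr)
    assume less: "\<not> load w x \<le> load w y"
    then have xy: "x \<noteq> y" by auto
    have xyV: "x \<in> V" "y \<in> V" using E(1)[OF e(1)] e by auto
    \<comment> \<open>Half of the difference of the loads: the sum of squares then changes by
      \<open>2 t (t - (load w x - load w y)) < 0\<close>.\<close>
    define t where "t = min (w (x, e)) ((load w x - load w y) / 2)"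
    have "t > 0" using pos less by (simp add: t_def)
    note t = this min.cobounded1[of "w (x, e)" "(load w x - load w y) / 2", folded t_def]
      min.cobounded2[of "w (x, e)" "(load w x - load w y) / 2", folded t_def]
    define w' where "w' = w((x, e) := w (x, e) - t, (y, e) := w (y, e) + t)"
    have split_e: "(\<Sum>z\<in>e. f z) = f x + f y + (\<Sum>z\<in>e - {x, y}. f z)" for f :: "'a \<Rightarrow> real"
    proof -
      have "e = insert x (insert y (e - {x, y}))" using e by auto
      then have "(\<Sum>z\<in>e. f z) = (\<Sum>z\<in>insert x (insert y (e - {x, y})). f z)" by simp
      also have "\<dots> = f x + (f y + (\<Sum>z\<in>e - {x, y}. f z))"
        using xy fine[OF e(1)] by (subst sum.insert) auto
      finally show ?thesis by simp
    qed
    have "w' \<in> S"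
    proof -
      have sum_rest: "0 \<le> (\<Sum>z\<in>e - {x, y}. w (z, e))" by (intro sum_nonneg w01)
      have "w (y, e) + t \<le> 1"
        using w1[OF e(1)] sum_rest t(2) unfolding split_e[of "\<lambda>z. w (z, e)"] by linarith
      then have "w' p \<in> {0..1}" for p
        using w01[of p] t w01[of "(y, e)"] w01[of "(x, e)"] by (auto simp: w'_def)
      moreover have "(\<Sum>z\<in>e'. w' (z, e')) = 1" if "e' \<in> E" for e'
      proof (cases "e' = e")
        case True
        have "(\<Sum>z\<in>e - {x, y}. w' (z, e)) = (\<Sum>z\<in>e - {x, y}. w (z, e))"
          by (intro sum.cong) (auto simp: w'_def)
        then show ?thesis
          using w1[OF e(1)] xy unfolding True split_e[of "\<lambda>z. w (z, e)"] split_e[of "\<lambda>z. w' (z, e)"]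
          by (simp add: w'_def)
      next
        case False
        then show ?thesis using w1[OF that] by (simp add: w'_def)
      qed
      ultimately show ?thesis by (auto simp: S_def K_def)
    qed
    have fz: "finite {e\<in>E. z \<in> e}" for z using finE by simp
    have same: "load w' z = load w z" if "z \<noteq> x" "z \<noteq> y" for z
      using that unfolding load_def by (intro sum.cong) (auto simp: w'_def)
    have loadx: "load w' x = load w x - t"
    proof -
      have "load w' x = w' (x, e) + (\<Sum>e'\<in>{e\<in>E. x \<in> e} - {e}. w' (x, e'))"
        unfolding load_def using e by (intro sum.remove fz) auto
      also have "(\<Sum>e'\<in>{e\<in>E. x \<in> e} - {e}. w' (x, e')) = (\<Sum>e'\<in>{e\<in>E. x \<in> e} - {e}. w (x, e'))"
        by (intro sum.cong) (auto simp: w'_def)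
      also have "w' (x, e) + \<dots> = (w (x, e) + \<dots>) - t" using xy by (simp add: w'_def)
      also have "(w (x, e) + (\<Sum>e'\<in>{e\<in>E. x \<in> e} - {e}. w (x, e'))) = load w x"
        unfolding load_def using e by (intro sum.remove[symmetric] fz) auto
      finally show ?thesis .
    qed
    have loady: "load w' y = load w y + t"
    proof -
      have "load w' y = w' (y, e) + (\<Sum>e'\<in>{e\<in>E. y \<in> e} - {e}. w' (y, e'))"
        unfolding load_def using e by (intro sum.remove fz) auto
      also have "(\<Sum>e'\<in>{e\<in>E. y \<in> e} - {e}. w' (y, e')) = (\<Sum>e'\<in>{e\<in>E. y \<in> e} - {e}. w (y, e'))"
        by (intro sum.cong) (auto simp: w'_def)
      also have "w' (y, e) + \<dots> = (w (y, e) + \<dots>) + t" by (simp add: w'_def)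
      also have "(w (y, e) + (\<Sum>e'\<in>{e\<in>E. y \<in> e} - {e}. w (y, e'))) = load w y"
        unfolding load_def using e by (intro sum.remove[symmetric] fz) auto
      finally show ?thesis .
    qed
    have split_V: "(\<Sum>z\<in>V. f z) = f x + f y + (\<Sum>z\<in>V - {x, y}. f z)" for f :: "'a \<Rightarrow> real"
    proof -
      have "V = insert x (insert y (V - {x, y}))" using xyV by auto
      then have "(\<Sum>z\<in>V. f z) = (\<Sum>z\<in>insert x (insert y (V - {x, y})). f z)" by simp
      also have "\<dots> = f x + (f y + (\<Sum>z\<in>V - {x, y}. f z))"
        using xy V by (subst sum.insert) auto
      finally show ?thesis by simp
    qed
    have rest: "(\<Sum>z\<in>V - {x, y}. (load w' z)\<^sup>2) = (\<Sum>z\<in>V - {x, y}. (load w z)\<^sup>2)"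
      by (intro sum.cong refl) (simp add: same)
    have "(load w x)\<^sup>2 + (load w y)\<^sup>2 \<le> (load w x - t)\<^sup>2 + (load w y + t)\<^sup>2"
      using opt[OF \<open>w' \<in> S\<close>] unfolding split_V[of "\<lambda>z. (load w z)\<^sup>2"] split_V[of "\<lambda>z. (load w' z)\<^sup>2"]
        rest loadx loady by linarith
    then have "0 \<le> 2 * t * (t - (load w x - load w y))" by (simp add: power2_eq_square algebra_simps)
    moreover have "2 * t * (t - (load w x - load w y)) < 0"
      using t less by (intro mult_pos_neg) auto
    ultimately show False by linarith
  qed
  define M where "M = Max (load w ` V)"
  define T where "T = {x\<in>V. load w x = M}"
  have le_M: "load w x \<le> M" if "x \<in> V" for x using that V by (simp add: M_def)
  have T: "T \<subseteq> V" "T \<noteq> {}" "finite T"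
  proof -
    have "M \<in> load w ` V" unfolding M_def using V V_ne by (intro Max_in) auto
    then show "T \<subseteq> V" "T \<noteq> {}" "finite T" using V by (auto simp: T_def)
  qed
  have "real (card T) * M = (\<Sum>x\<in>T. load w x)" by (simp add: T_def)
  also have "\<dots> = (\<Sum>e\<in>E. \<Sum>x\<in>{x\<in>T. x \<in> e}. w (x, e))"
    unfolding load_def by (rule sum.swap_restrict[OF T(3) finE])
  also have "\<dots> = (\<Sum>e\<in>E. if e \<subseteq> T then 1 else 0)"
  proof (rule sum.cong[OF refl])
    fix e assume e: "e \<in> E"
    show "(\<Sum>x\<in>{x\<in>T. x \<in> e}. w (x, e)) = (if e \<subseteq> T then 1 else 0)"
    proof (cases "e \<subseteq> T")
      case True
      then have "{x\<in>T. x \<in> e} = e" by auto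
      then show ?thesis using True w1[OF e] by simp
    next
      case False
      then obtain y where y: "y \<in> e" "y \<notin> T" by auto
      then have "y \<in> V" using E(1)[OF e] by auto
      then have "load w y < M" using y(2) le_M[of y] by (auto simp: T_def)
      then have "w (x, e) = 0" if "x \<in> T" "x \<in> e" for x
        using downhill[OF e that(2) y(1)] that(1) w01(1)[of "(x, e)"] by (force simp: T_def)
      then show ?thesis using False by simp
    qed
  qed
  also have "\<dots> = real (card {e\<in>E. e \<subseteq> T})" using finE by (simp add: sum.If_cases Int_def)
  also have "\<dots> \<le> c * real (card T)" by (rule dens[OF T(1,2)])
  finally have "M \<le> c" using T(2,3) by (simp add: mult.commute card_gt_0_iff)
  then have "load w x \<le> c" if "x \<in> V" for x using le_M[OF that] by linarith
  then show ?thesis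
    using that[of "\<lambda>x e. w (x, e)"] w01 w1 by (simp add: load_def)
qed

section \<open>Growing a set vertex by vertex\<close>

lemma grow_induct [consumes 2, case_names base step]:
  assumes "finite S" "A \<subseteq> S" "P A"
    and step: "\<And>B. A \<subseteq> B \<Longrightarrow> B \<subset> S \<Longrightarrow> P B \<Longrightarrow> \<exists>y\<in>S - B. P (insert y B)"
  shows "P S"
proof -
  have "\<exists>B. A \<subseteq> B \<and> B \<subseteq> S \<and> P B \<and> card (S - B) = card (S - A) - k" for k
  proof (induction k)
    case 0
    show ?case using assms(2,3) by (intro exI[of _ A]) simp
  next
    case (Suc k)
    then obtain B where B: "A \<subseteq> B" "B \<subseteq> S" "P B" "card (S - B) = card (S - A) - k" by auto
    show ?case
    proof (cases "B = S")
      case True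
      then show ?thesis using B by (intro exI[of _ B]) simp
    next
      case False
      then obtain y where y: "y \<in> S - B" "P (insert y B)" using step B by blast
      have "card (S - insert y B) = card (S - B) - 1"
        using y(1) \<open>finite S\<close> by (metis Diff_insert card_Diff_singleton finite_Diff)
      then show ?thesis using y B by (intro exI[of _ "insert y B"]) auto
    qed
  qed
  from this[of "card (S - A)"] obtain B where "B \<subseteq> S" "P B" "card (S - B) = 0" by auto
  then show ?thesis using \<open>finite S\<close> by (metis Diff_eq_empty_iff card_eq_0_iff finite_Diff subset_antisym)
qed

text \<open>Each new vertex brings at least one new edge.\<close>
lemma card_edges_grow:
  assumes S: "finite S" "A \<subseteq> S" and E: "finite E"
    and cut: "\<And>B. A \<subseteq> B \<Longrightarrow> B \<subset> S \<Longrightarrow> \<exists>b\<in>B. \<exists>y\<in>S - B. {b, y} \<in> E"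
  shows "card {e\<in>E. e \<subseteq> A} + card S \<le> card {e\<in>E. e \<subseteq> S} + card A"
  using S
proof (induction rule: grow_induct)
  case (step B)
  obtain b y where by_: "b \<in> B" "y \<in> S - B" "{b, y} \<in> E" using cut[OF step(1,2)] by blast
  have finB: "finite B" using step(2) S(1) by (metis finite_subset psubset_imp_subset)
  have "insert {b, y} {e\<in>E. e \<subseteq> B} \<subseteq> {e\<in>E. e \<subseteq> insert y B}" using by_ by auto
  then have "card (insert {b, y} {e\<in>E. e \<subseteq> B}) \<le> card {e\<in>E. e \<subseteq> insert y B}"
    by (rule card_mono[rotated]) (use E in simp)
  moreover have "card (insert {b, y} {e\<in>E. e \<subseteq> B}) = Suc (card {e\<in>E. e \<subseteq> B})"
    using by_ E by (subst card_insert_disjoint) auto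
  moreover have "card (insert y B) = Suc (card B)" using by_ finB by simp
  ultimately have "card {e\<in>E. e \<subseteq> A} + card (insert y B) \<le> card {e\<in>E. e \<subseteq> insert y B} + card A"
    using step(3) by linarith
  then show ?case using by_ by blast
qed simp

text \<open>Each new vertex is sent to a neighbour, in the sense of \<open>N\<close>, of an image
  that is already fixed, so it has at most \<open>d\<close> possible images.\<close>
lemma card_spread_le:
  fixes \<Phi> :: "('a \<Rightarrow> 'b) set" and d :: real
  assumes S: "finite S" "x \<in> S" and z: "\<And>\<phi>. \<phi> \<in> \<Phi> \<Longrightarrow> \<phi> x = z"
    and N: "\<And>u. finite (N u)" "\<And>u. real (card (N u)) \<le> d" 
    and cut: "\<And>B. x \<in> B \<Longrightarrow> B \<subset> S \<Longrightarrow> \<exists>b\<in>B. \<exists>y\<in>S - B. \<forall>\<phi>\<in>\<Phi>. \<phi> y \<in> N (\<phi> b)"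
  shows "real (card ((\<lambda>\<phi>. restrict \<phi> S) ` \<Phi>)) \<le> d ^ (card S - 1)"
proof -
  have "{x} \<subseteq> S" using S by simp
  have "finite ((\<lambda>\<phi>. restrict \<phi> S) ` \<Phi>) \<and> card S \<ge> 1 \<and>
      real (card ((\<lambda>\<phi>. restrict \<phi> S) ` \<Phi>)) \<le> d ^ (card S - 1)"
    using S(1) \<open>{x} \<subseteq> S\<close>
  proof (induction rule: grow_induct)
    case base
    have sub: "(\<lambda>\<phi>. restrict \<phi> {x}) ` \<Phi> \<subseteq> {\<lambda>y\<in>{x}. z}" using z by (auto simp: restrict_def fun_eq_iff)
    then have "card ((\<lambda>\<phi>. restrict \<phi> {x}) ` \<Phi>) \<le> card {\<lambda>y\<in>{x}. z}" by (rule card_mono[rotated]) simp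
    then have "real (card ((\<lambda>\<phi>. restrict \<phi> {x}) ` \<Phi>)) \<le> d ^ (card {x} - 1)"
      by (simp del: restrict_apply)
    moreover have "finite ((\<lambda>\<phi>. restrict \<phi> {x}) ` \<Phi>)" by (rule finite_subset[OF sub]) simp
    moreover have "1 \<le> card {x}" by simp
    ultimately show ?case by blast
  next
    case (step B)
    obtain b y where by_: "b \<in> B" "y \<in> S - B" "\<And>\<phi>. \<phi> \<in> \<Phi> \<Longrightarrow> \<phi> y \<in> N (\<phi> b)"
      using cut[of B] step(1,2) by blast
    have finB: "finite B" using step(2) S(1) by (metis finite_subset psubset_imp_subset)
    let ?R = "\<lambda>B. (\<lambda>\<phi>. restrict \<phi> B) ` \<Phi>"
    let ?P = "Sigma (?R B) (\<lambda>\<psi>. N (\<psi> b))"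
    have "?R (insert y B) \<subseteq> (\<lambda>(\<psi>, u). \<psi>(y := u)) ` ?P"
    proof (rule image_subsetI)
      fix \<phi> assume \<phi>: "\<phi> \<in> \<Phi>"
      have "restrict \<phi> (insert y B) = (restrict \<phi> B)(y := \<phi> y)" by (auto simp: restrict_def fun_eq_iff)
      moreover have "(restrict \<phi> B, \<phi> y) \<in> ?P" using \<phi> by_ by auto
      ultimately show "restrict \<phi> (insert y B) \<in> (\<lambda>(\<psi>, u). \<psi>(y := u)) ` ?P" by force
    qed
    moreover have fR: "finite (?R B)" using step(3) by blast
    then have finP: "finite ?P" using N(1) by blast
    ultimately have "card (?R (insert y B)) \<le> card ?P" and fin: "finite (?R (insert y B))"
      by (meson card_image_le card_mono finite_imageI le_trans, meson finite_imageI finite_subset)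
    have "real (card (?R (insert y B))) \<le> real (card ?P)" by (rule of_nat_mono) fact
    also have "card ?P = (\<Sum>\<psi>\<in>?R B. card (N (\<psi> b)))" by (rule card_SigmaI[OF fR]) (use N(1) in blast)
    also have "real \<dots> = (\<Sum>\<psi>\<in>?R B. real (card (N (\<psi> b))))" by (rule of_nat_sum)
    also have "\<dots> \<le> (\<Sum>\<psi>\<in>?R B. d)" by (intro sum_mono N)
    also have "\<dots> = real (card (?R B)) * d" by (rule sum_constant)
    also have "\<dots> \<le> d ^ (card B - 1) * d"
    proof (rule mult_right_mono)
      show "0 \<le> d" using N(2)[of undefined] of_nat_0_le_iff order_trans by blast
    qed (use step(3) in blast)
    also have "d ^ (card B - 1) * d = d ^ (card (insert y B) - 1)"
    proof -
      have "card B \<ge> 1" using step(3) by blast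
      then show ?thesis using by_(2) finB by (cases "card B") auto
    qed
    finally have bound: "real (card (?R (insert y B))) \<le> d ^ (card (insert y B) - 1)" .
    have "card (insert y B) \<ge> 1" using by_(2) finB by simp
    then have "finite (?R (insert y B)) \<and> 1 \<le> card (insert y B) \<and>
        real (card (?R (insert y B))) \<le> d ^ (card (insert y B) - 1)"
      using fin bound by blast
    then show ?case using by_(2) by blast
  qed
  then show ?thesis by blast
qed

section \<open>Embeddings into an oriented graph\<close>

text \<open>The number \<open>w x e\<close> is the share of the edge \<open>e\<close> that its end
  \<open>x\<close> carries. An edge points away from an end \<open>x\<close> if \<open>x\<close>
  carries at least \<open>\<delta>\<close> of it; an edge may point both ways.\<close>
locale oriented_graph =
  fixes H :: "'b graph" and w :: "'b \<Rightarrow> 'b set \<Rightarrow> real" and c \<delta> :: real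
  assumes H: "simple_graph H"
    and w_nonneg: "e \<in> edges H \<Longrightarrow> x \<in> e \<Longrightarrow> 0 \<le> w x e"
    and w_sum: "e \<in> edges H \<Longrightarrow> (\<Sum>x\<in>e. w x e) = 1"
    and load: "x \<in> verts H \<Longrightarrow> (\<Sum>e\<in>{e\<in>edges H. x \<in> e}. w x e) \<le> c"
    and c: "0 \<le> c" and \<delta>: "0 < \<delta>"
begin

text \<open>The neighbours of a vertex along edges that point away from it. They are few because
  every such edge uses up \<open>\<delta>\<close> of the load of the vertex.\<close>
definition nbrs :: "'b \<Rightarrow> 'b set" where
  "nbrs z = {u. {z, u} \<in> edges H \<and> \<delta> \<le> w z {z, u}}"

lemma nbrs: "finite (nbrs z)" "real (card (nbrs z)) \<le> c / \<delta>"
proof -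
  have sub: "nbrs z \<subseteq> verts H" using simple_graphD(2)[OF H] by (auto simp: nbrs_def)
  then show fin: "finite (nbrs z)" using simple_graphD(1)[OF H] by (rule finite_subset)
  show "real (card (nbrs z)) \<le> c / \<delta>"
  proof (cases "z \<in> verts H")
    case True
    have "real (card (nbrs z)) * \<delta> = (\<Sum>u\<in>nbrs z. \<delta>)" by simp
    also have "\<dots> \<le> (\<Sum>u\<in>nbrs z. w z {z, u})" by (intro sum_mono) (simp add: nbrs_def)
    also have "\<dots> = (\<Sum>e\<in>(\<lambda>u. {z, u}) ` nbrs z. w z e)"
      by (subst sum.reindex) (auto simp: inj_on_def doubleton_eq_iff)
    also have "\<dots> \<le> (\<Sum>e\<in>{e\<in>edges H. z \<in> e}. w z e)"
      using simple_graphD(4)[OF H] w_nonneg by (intro sum_mono2) (auto simp: nbrs_def)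
    also have "\<dots> \<le> c" by (rule load[OF True])
    finally show ?thesis using \<delta> by (simp add: pos_le_divide_eq)
  next
    case False
    then have "nbrs z = {}" using simple_graphD(2)[OF H] by (auto simp: nbrs_def)
    then show ?thesis using c \<delta> by simp
  qed
qed

text \<open>The type \<open>\<sigma>\<close> prescribes, for every edge of the embedded graph, the ends from
  which its image points away. For a fixed type the embedded graph becomes directed, which is what
  allows a good order of embedding its vertices.\<close>
definition typed_emb :: "'a set set \<Rightarrow> ('a set \<Rightarrow> 'a set) \<Rightarrow> 'a set \<Rightarrow> ('a \<Rightarrow> 'b) set" where
  "typed_emb E \<sigma> X = {\<phi> \<in> X \<rightarrow>\<^sub>E verts H. inj_on \<phi> X \<and>
     (\<forall>e\<in>E. e \<subseteq> X \<longrightarrow> \<phi> ` e \<in> edges H \<and> {x\<in>e. \<delta> \<le> w (\<phi> x) (\<phi> ` e)} = \<sigma> e)}"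

lemma typed_embD:
  assumes "\<phi> \<in> typed_emb E \<sigma> X"
  shows "\<phi> \<in> X \<rightarrow>\<^sub>E verts H" "inj_on \<phi> X" "e \<in> E \<Longrightarrow> e \<subseteq> X \<Longrightarrow> \<phi> ` e \<in> edges H"
    "e \<in> E \<Longrightarrow> e \<subseteq> X \<Longrightarrow> x \<in> e \<Longrightarrow> \<delta> \<le> w (\<phi> x) (\<phi> ` e) \<longleftrightarrow> x \<in> \<sigma> e"
  using assms by (auto simp: typed_emb_def)

lemma finite_typed_emb: "finite X \<Longrightarrow> finite (typed_emb E \<sigma> X)"
  by (rule finite_subset[of _ "X \<rightarrow>\<^sub>E verts H"])
    (auto simp: typed_emb_def simple_graphD[OF H] intro: finite_PiE)

text \<open>An edge inside \<open>S\<close> adds 1 to the load of the image of \<open>S\<close>. An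
  edge leaving \<open>S\<close> does not point back into \<open>S\<close>, so its other end carries
  less than \<open>\<delta>\<close> of it and it adds more than \<open>1 - \<delta>\<close>. Hence
  \<open>S\<close> touches hardly more edges than the load bound \<open>c\<close> allows per
  vertex.\<close>
lemma card_touching_edges_le:
  assumes X: "finite X" "S \<subseteq> X" and E: "finite E" "\<And>e. e \<in> E \<Longrightarrow> e \<subseteq> X \<and> card e = 2"
    and no_in: "\<And>x y. x \<in> S \<Longrightarrow> y \<in> X - S \<Longrightarrow> {x, y} \<in> E \<Longrightarrow> y \<notin> \<sigma> {x, y}"
    and \<phi>: "\<phi> \<in> typed_emb E \<sigma> X"
  shows "real (card {e\<in>E. e \<inter> S \<noteq> {}}) \<le>
    c * real (card S) + \<delta> * real (card {e\<in>E. e \<inter> S \<noteq> {} \<and> \<not> e \<subseteq> S})"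
proof -
  let ?Es = "{e\<in>E. e \<inter> S \<noteq> {}}" and ?out = "\<lambda>e. \<not> e \<subseteq> S"
  have finS: "finite S" using X by (rule finite_subset[rotated])
  note inj = typed_embD(2)[OF \<phi>]
  have weight: "1 - (if ?out e then \<delta> else 0) \<le> (\<Sum>x\<in>{x\<in>S. x \<in> e}. w (\<phi> x) (\<phi> ` e))"
    if "e \<in> ?Es" for e
  proof -
    have e: "e \<in> E" "e \<inter> S \<noteq> {}" using that by auto
    have eX: "e \<subseteq> X" "card e = 2" using E(2)[OF e(1)] by auto
    have "inj_on \<phi> e" using inj eX(1) by (rule inj_on_subset)
    then have one: "(\<Sum>x\<in>e. w (\<phi> x) (\<phi> ` e)) = 1"
      using w_sum[OF typed_embD(3)[OF \<phi> e(1) eX(1)]] by (simp add: sum.reindex)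
    show ?thesis
    proof (cases "e \<subseteq> S")
      case True
      then have "{x\<in>S. x \<in> e} = e" by auto
      then show ?thesis using True one by simp
    next
      case False
      then obtain x y where xy: "x \<in> e" "x \<in> S" "y \<in> e" "y \<notin> S" using e(2) by auto
      have e_eq: "e = {x, y}" using eX(2) xy by (auto simp: card_2_iff)
      have "\<not> \<delta> \<le> w (\<phi> y) (\<phi> ` e)"
        using typed_embD(4)[OF \<phi> e(1) eX(1) xy(3)] no_in[of x y] xy eX e(1) e_eq by auto
      moreover have "w (\<phi> x) (\<phi> ` e) + w (\<phi> y) (\<phi> ` e) = 1"
        using one xy unfolding e_eq by (subst (asm) sum.insert) auto
      moreover have "{z\<in>S. z \<in> e} = {x}" using xy e_eq by auto
      ultimately show ?thesis using False by simp
    qed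
  qed
  have "real (card ?Es) - \<delta> * real (card {e\<in>?Es. ?out e}) = (\<Sum>e\<in>?Es. 1 - (if ?out e then \<delta> else 0))"
    using E(1) by (simp add: sum_subtractf sum.If_cases Int_def)
  also have "\<dots> \<le> (\<Sum>e\<in>?Es. \<Sum>x\<in>{x\<in>S. x \<in> e}. w (\<phi> x) (\<phi> ` e))" by (intro sum_mono weight)
  also have "\<dots> = (\<Sum>x\<in>S. \<Sum>e\<in>{e\<in>?Es. x \<in> e}. w (\<phi> x) (\<phi> ` e))"
    by (rule sum.swap_restrict) (use E(1) finS in auto)
  also have "\<dots> \<le> (\<Sum>x\<in>S. c)"
  proof (rule sum_mono)
    fix x assume x: "x \<in> S"
    have "inj_on (\<lambda>e. \<phi> ` e) E"
      using E(2) inj_on_image_eq_iff[OF inj] by (intro inj_onI) metis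
    then have "inj_on (\<lambda>e. \<phi> ` e) {e\<in>?Es. x \<in> e}" by (rule inj_on_subset) auto
    then have "(\<Sum>e\<in>{e\<in>?Es. x \<in> e}. w (\<phi> x) (\<phi> ` e)) = (\<Sum>e'\<in>(\<lambda>e. \<phi> ` e) ` {e\<in>?Es. x \<in> e}. w (\<phi> x) e')"
      by (simp add: sum.reindex)
    also have "\<dots> \<le> (\<Sum>e'\<in>{e'\<in>edges H. \<phi> x \<in> e'}. w (\<phi> x) e')"
      using simple_graphD(4)[OF H] w_nonneg typed_embD(3)[OF \<phi>] E(2) by (intro sum_mono2) auto
    also have "\<dots> \<le> c" using typed_embD(1)[OF \<phi>] x X(2) by (intro load) auto
    finally show "(\<Sum>e\<in>{e\<in>?Es. x \<in> e}. w (\<phi> x) (\<phi> ` e)) \<le> c" .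
  qed
  finally have "real (card ?Es) - \<delta> * real (card {e\<in>?Es. ?out e}) \<le> c * real (card S)"
    by (simp add: mult.commute)
  moreover have "{e\<in>?Es. ?out e} = {e\<in>E. e \<inter> S \<noteq> {} \<and> \<not> e \<subseteq> S}" by auto
  ultimately show ?thesis by simp
qed

text \<open>Maps that agree outside \<open>S\<close> and have disjoint images of \<open>S\<close>
  give a packing: the pieces are the images of the edges touching \<open>S\<close>. All pieces share
  the image of the root \<open>R\<close>, the set of outer ends of these edges. A menu is given by a
  placement of the root and contains at most \<open>n\<close> to the power \<open>|S|\<close>
  pieces.\<close>
lemma card_disjoint_extensions:
  fixes S X :: "'a set"
  assumes sparse: "q_sparse n q H" "0 \<le> q" and n: "n \<ge> 1"
    and X: "finite X" "S \<subseteq> X" "S \<noteq> {}" and E: "finite E" "\<And>e. e \<in> E \<Longrightarrow> e \<subseteq> X \<and> card e = 2"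
    and \<F>: "finite \<F>" "\<F> \<subseteq> typed_emb E \<sigma> X" "\<And>\<phi>. \<phi> \<in> \<F> \<Longrightarrow> restrict \<phi> (X - S) = \<psi>"
      "\<And>\<phi> \<phi>'. \<phi> \<in> \<F> \<Longrightarrow> \<phi>' \<in> \<F> \<Longrightarrow> \<phi> \<noteq> \<phi>' \<Longrightarrow> \<phi> ` S \<inter> \<phi>' ` S = {}"
  shows "fact (card \<F>) \<le>
    (real n ^ card {e\<in>E. e \<inter> S \<noteq> {} \<and> \<not> e \<subseteq> S}) *
    (real n ^ card S * q ^ card {e\<in>E. e \<inter> S \<noteq> {}}) ^ card \<F>"
proof (cases "\<F> = {}")
  case False
  then obtain \<phi>0 where \<phi>0: "\<phi>0 \<in> \<F>" by auto
  define Es where "Es = {e\<in>E. e \<inter> S \<noteq> {}}"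
  define R where "R = \<Union>Es - S"
  define Q where "Q = (S \<union> R, Es)"
  let ?out = "{e\<in>E. e \<inter> S \<noteq> {} \<and> \<not> e \<subseteq> S}"
  have finS: "finite S" using X(1,2) by (rule finite_subset[rotated])
  have RX: "R \<subseteq> X - S" using E(2) by (auto simp: R_def Es_def)
  have finR: "finite R" using RX X(1) by (auto intro: finite_subset)
  have finEs: "finite Es" using E(1) by (simp add: Es_def)
  have EsE: "e \<in> E" "e \<subseteq> X" "card e = 2" if "e \<in> Es" for e using E(2) that by (auto simp: Es_def)
  have sQ: "simple_graph Q"
    unfolding simple_graph_def Q_def using finS finR EsE(3) by (auto simp: R_def)
  have QX: "verts Q \<subseteq> X" using RX X(2) by (auto simp: Q_def)
  have \<phi>: "\<phi> \<in> X \<rightarrow>\<^sub>E verts H" "inj_on \<phi> X" "inj_on \<phi> (verts Q)"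
      "\<And>e. e \<in> Es \<Longrightarrow> \<phi> ` e \<in> edges H" "\<And>x. x \<in> X - S \<Longrightarrow> \<phi> x = \<psi> x" if "\<phi> \<in> \<F>" for \<phi>
  proof -
    have t: "\<phi> \<in> typed_emb E \<sigma> X" using that \<F>(2) by auto
    show "\<phi> \<in> X \<rightarrow>\<^sub>E verts H" "inj_on \<phi> X" using typed_embD[OF t] by auto
    then show "inj_on \<phi> (verts Q)" using QX by (auto intro: inj_on_subset)
    show "\<phi> ` e \<in> edges H" if "e \<in> Es" for e using typed_embD(3)[OF t EsE(1,2)[OF that]] .
    show "\<phi> x = \<psi> x" if "x \<in> X - S" for x 
      using fun_cong[OF \<F>(3)[OF \<open>\<phi> \<in> \<F>\<close>], of x] that by simp
  qed
  have cardR: "card R \<le> card ?out"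
  proof -
    have "\<exists>x. e - S = {x}" if "e \<in> ?out" for e
    proof -
      from that have "card e = 2" "e \<inter> S \<noteq> {}" "\<not> e \<subseteq> S" using E(2) by auto
      then show ?thesis by (auto simp: card_2_iff)
    qed
    then have "\<forall>e\<in>?out. \<exists>x. e - S = {x}" by blast
    from bchoice[OF this] obtain g where g: "\<And>e. e \<in> ?out \<Longrightarrow> e - S = {g e}" by blast
    have "R \<subseteq> g ` ?out"
    proof
      fix x assume "x \<in> R"
      then obtain e where "e \<in> ?out" "x \<in> e - S" by (auto simp: R_def Es_def)
      then show "x \<in> g ` ?out" using g by blast
    qed
    then show ?thesis using E(1) by (intro surj_card_le) auto
  qed
  define \<D> where "\<D> = (\<lambda>\<phi>. image_graph \<phi> Q) ` \<F>"
  \<comment> \<open>Distinct members of the family stay apart on \<open>S\<close>, also from the common image of the root.\<close>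
  have apart: "\<phi> z \<notin> \<phi>' ` verts Q"
    if f: "\<phi> \<in> \<F>" "\<phi>' \<in> \<F>" "\<phi> \<noteq> \<phi>'" "z \<in> S" for \<phi> \<phi>' z
  proof
    assume "\<phi> z \<in> \<phi>' ` verts Q"
    then obtain u where u: "u \<in> verts Q" "\<phi> z = \<phi>' u" by auto
    show False
    proof (cases "u \<in> S")
      case True
      then show False using \<F>(4)[OF f(1-3)] u(2) f(4) by blast
    next
      case False
      then have "u \<in> X - S" using u(1) QX by auto
      then have "\<phi> z = \<phi> u" using \<phi>(5)[OF f(1)] \<phi>(5)[OF f(2)] u(2) by simp
      then have "z = u" using inj_onD[OF \<phi>(2)[OF f(1)]] f(4) X(2) \<open>u \<in> X - S\<close> by blast
      then show False using False f(4) by simp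
    qed
  qed
  obtain s0 where s0: "s0 \<in> S" using X(3) by auto
  have injD: "inj_on (\<lambda>\<phi>. image_graph \<phi> Q) \<F>"
  proof (rule inj_onI, rule ccontr)
    fix \<phi> \<phi>' assume f: "\<phi> \<in> \<F>" "\<phi>' \<in> \<F>" "image_graph \<phi> Q = image_graph \<phi>' Q" "\<phi> \<noteq> \<phi>'"
    have "\<phi> ` verts Q = \<phi>' ` verts Q" 
      using arg_cong[OF f(3), of verts] by (simp only: verts_image_graph)
    moreover have "\<phi> s0 \<in> \<phi> ` verts Q" using s0 by (simp add: Q_def)
    ultimately show False using apart[OF f(1,2,4) s0] by simp
  qed
  have cardD: "card \<D> = card \<F>" unfolding \<D>_def by (rule card_image[OF injD])
  \<comment> \<open>The menu for the placement \<open>g\<close> of the root.\<close>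
  define X_of where "X_of g = {image_graph \<theta> Q |\<theta>. \<theta> \<in> verts Q \<rightarrow>\<^sub>E {1..n} \<and> restrict \<theta> R = g}" for g :: "'a \<Rightarrow> nat"
  define \<G> where "\<G> = X_of ` (R \<rightarrow>\<^sub>E {1..n})"
  have cX: "finite (X_of g) \<and> card (X_of g) \<le> n ^ card S" for g
  proof -
    let ?T = "{\<theta> \<in> verts Q \<rightarrow>\<^sub>E {1..n}. restrict \<theta> R = g}"
    have inj: "inj_on (\<lambda>\<theta>. restrict \<theta> S) ?T"
    proof (rule inj_onI)
      fix \<theta> \<theta>' assume t: "\<theta> \<in> ?T" "\<theta>' \<in> ?T" "restrict \<theta> S = restrict \<theta>' S"
      show "\<theta> = \<theta>'"
      proof (rule PiE_ext[of _ "verts Q" "\<lambda>_. {1..n}"])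
        fix x assume "x \<in> verts Q"
        moreover have "restrict \<theta> R x = restrict \<theta>' R x" "restrict \<theta> S x = restrict \<theta>' S x" using t by simp_all
        ultimately show "\<theta> x = \<theta>' x" by (auto simp: Q_def split: if_splits)
      qed (use t in auto)
    qed
    have "(\<lambda>\<theta>. restrict \<theta> S) ` ?T \<subseteq> S \<rightarrow>\<^sub>E {1..n}" by (auto simp: Q_def PiE_iff)
    moreover have fPi: "finite (S \<rightarrow>\<^sub>E {1..n})" using finS by (intro finite_PiE) auto
    ultimately have "card ?T \<le> card (S \<rightarrow>\<^sub>E {1..n})" by (rule card_inj_on_le[OF inj])
    then have "card ?T \<le> n ^ card S" by (simp add: card_funcsetE finS)
    moreover have "finite ?T"
      using finS finR by (intro finite_subset[OF _ finite_PiE[of "verts Q" "\<lambda>_. {1..n}"]]) (auto simp: Q_def)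
    moreover have X_eq: "X_of g = (\<lambda>\<theta>. image_graph \<theta> Q) ` ?T" by (auto simp: X_of_def)
    ultimately show ?thesis
      unfolding X_eq using card_image_le[of ?T "\<lambda>\<theta>. image_graph \<theta> Q"] by (meson finite_imageI le_trans)
  qed
  have "fact (card \<D>) \<le> real (card \<G>) * (real (n ^ card S) * q ^ card Es) ^ card \<D>"
  proof (rule packing[OF sparse])
    show "finite \<D>" using \<F>(1) by (simp add: \<D>_def)
    show "subgraph D H" if D: "D \<in> \<D>" for D
    proof -
      obtain \<phi> where f: "\<phi> \<in> \<F>" "D = image_graph \<phi> Q" using D by (auto simp: \<D>_def)
      have "\<phi> ` verts Q \<subseteq> verts H" using \<phi>(1)[OF f(1)] QX by auto
      moreover have "(\<lambda>e. \<phi> ` e) ` Es \<subseteq> edges H" using \<phi>(4)[OF f(1)] by auto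
      ultimately show ?thesis
        using simple_graph_image_graph[OF sQ \<phi>(3)[OF f(1)]] f(2) by (simp add: subgraph_def Q_def)
    qed
    show "card (edges D) = card Es" if D: "D \<in> \<D>" for D
    proof -
      obtain \<phi> where f: "\<phi> \<in> \<F>" "D = image_graph \<phi> Q" using D by (auto simp: \<D>_def)
      show ?thesis using inj_on_image_edges[OF sQ \<phi>(3)[OF f(1)]] f(2) by (simp add: card_image Q_def)
    qed
    show "edges D \<inter> edges D' = {}" if D: "D \<in> \<D>" "D' \<in> \<D>" "D \<noteq> D'" for D D'
    proof -
      obtain \<phi> where f: "\<phi> \<in> \<F>" "D = image_graph \<phi> Q" using D by (auto simp: \<D>_def)
      obtain \<phi>' where f': "\<phi>' \<in> \<F>" "D' = image_graph \<phi>' Q" using D by (auto simp: \<D>_def)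
      have ne: "\<phi> \<noteq> \<phi>'" using D(3) f f' by auto
      have "\<phi> ` e \<noteq> \<phi>' ` e'" if e: "e \<in> Es" "e' \<in> Es" for e e'
      proof -
        obtain z where z: "z \<in> e" "z \<in> S" using e(1) by (auto simp: Es_def)
        have "e' \<subseteq> verts Q" using e(2) simple_graphD(2)[OF sQ] by (simp add: Q_def)
        then show ?thesis using apart[OF f(1) f'(1) ne z(2)] z(1) by blast
      qed
      then show ?thesis using f f' by (auto simp: Q_def)
    qed
    show "finite \<G>" using finR by (auto simp: \<G>_def intro!: finite_PiE)
    show "finite Y" if "Y \<in> \<G>" for Y using that cX by (auto simp: \<G>_def)
    show "card Y \<le> n ^ card S" if "Y \<in> \<G>" for Y using that cX by (auto simp: \<G>_def)
    fix f assume f: "inj_on f (\<Union>D\<in>\<D>. verts D)" "f ` (\<Union>D\<in>\<D>. verts D) \<subseteq> {1..n}"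
    have fV: "f (\<phi> x) \<in> {1..n}" if "\<phi> \<in> \<F>" "x \<in> verts Q" for \<phi> x
    proof -
      have "\<phi> x \<in> (\<Union>D\<in>\<D>. verts D)" using that by (auto simp: \<D>_def)
      then show ?thesis using f(2) by blast
    qed
    let ?g = "restrict (f \<circ> \<phi>0) R"
    have "?g \<in> R \<rightarrow>\<^sub>E {1..n}" using fV[OF \<phi>0] by (intro restrict_PiE_iff[THEN iffD2]) (simp add: Q_def)
    moreover have "image_graph f D \<in> X_of ?g" if D: "D \<in> \<D>" for D
    proof -
      obtain \<phi> where p: "\<phi> \<in> \<F>" "D = image_graph \<phi> Q" using D by (auto simp: \<D>_def)
      let ?\<theta> = "restrict (f \<circ> \<phi>) (verts Q)"
      have "image_graph f D = image_graph ?\<theta> Q"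
        unfolding p(2) image_graph_comp by (rule image_graph_cong[OF sQ]) simp
      moreover have "?\<theta> \<in> verts Q \<rightarrow>\<^sub>E {1..n}"
        using fV[OF p(1)] by (intro restrict_PiE_iff[THEN iffD2]) simp
      moreover have "restrict ?\<theta> R = ?g"
      proof
        fix x
        show "restrict ?\<theta> R x = ?g x"
        proof (cases "x \<in> R")
          case True
          then have "\<phi> x = \<phi>0 x" using RX \<phi>(5)[OF p(1)] \<phi>(5)[OF \<phi>0] by auto
          then show ?thesis using True by (simp add: Q_def)
        qed simp
      qed
      ultimately show ?thesis unfolding X_of_def by blast
    qed
    ultimately show "\<exists>Y\<in>\<G>. \<forall>D\<in>\<D>. image_graph f D \<in> Y"
      unfolding \<G>_def by (intro bexI[of _ "X_of ?g"] ballI imageI)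
  qed
  also have "\<dots> \<le> real n ^ card ?out * (real (n ^ card S) * q ^ card Es) ^ card \<D>"
  proof (rule mult_right_mono)
    have "card \<G> \<le> card (R \<rightarrow>\<^sub>E {1..n})"
      unfolding \<G>_def using finR by (intro card_image_le finite_PiE) auto
    also have "\<dots> = n ^ card R" by (simp add: card_funcsetE finR)
    also have "\<dots> \<le> n ^ card ?out" using cardR n by (intro power_increasing) auto
    finally have "real (card \<G>) \<le> real (n ^ card ?out)" by (rule of_nat_mono)
    then show "real (card \<G>) \<le> real n ^ card ?out" by (simp only: of_nat_power)
  qed (use sparse(2) in auto)
  finally show ?thesis unfolding cardD Es_def by simp
qed (use n in simp)

end

text \<open>The number of ways to extend a typed embedding from \<open>X - S\<close> to
  \<open>X\<close>, when no edge points from \<open>X - S\<close> into \<open>S\<close> and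
  \<open>S\<close> is strongly connected. Take a maximal family of extensions with disjoint images
  of \<open>S\<close>. Every extension maps some vertex of \<open>S\<close> into the union
  \<open>Z\<close> of these images, and then the rest of \<open>S\<close> can be reached along edges
  pointing away from vertices that are already placed, with at most \<open>c / \<delta>\<close>
  choices for each. The size of the family is bounded by the packing argument, up to the number
  \<open>r log n\<close> caused by the \<open>r\<close> edges leading to the root. This is
  affordable because the expected number \<open>\<mu>\<close> of extensions is at least
  \<open>4\<close> to the power \<open>-r\<close>.\<close>
lemma (in oriented_graph) card_extensions:
  fixes S X :: "'a set" and L q :: real
  assumes sparse: "q_sparse n q H" and n: "n \<ge> 1"
    and X: "finite X" "S \<subseteq> X" "S \<noteq> {}" and E: "finite E" "\<And>e. e \<in> E \<Longrightarrow> e \<subseteq> X \<and> card e = 2"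
    and no_in: "\<And>x y. x \<in> S \<Longrightarrow> y \<in> X - S \<Longrightarrow> {x, y} \<in> E \<Longrightarrow> y \<notin> \<sigma> {x, y}"
    and cut: "\<And>B. B \<subset> S \<Longrightarrow> B \<noteq> {} \<Longrightarrow> \<exists>b\<in>B. \<exists>y\<in>S - B. {b, y} \<in> E \<and> b \<in> \<sigma> {b, y}"
    and L: "1 \<le> L" "real n = 2 powr L" and q: "0 < q" "q < 1"
    and qc: "real n * q powr c = 1" and q\<delta>: "1 / 4 \<le> q powr \<delta>" and c\<delta>: "c / \<delta> \<le> L\<^sup>2"
  shows "real (card {\<phi> \<in> typed_emb E \<sigma> X. restrict \<phi> (X - S) = \<psi>}) \<le>
    (6 * real n) ^ card S * (8 * q * L\<^sup>2) ^ card {e\<in>E. e \<inter> S \<noteq> {}}"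
proof -
  define Ext where "Ext = {\<phi> \<in> typed_emb E \<sigma> X. restrict \<phi> (X - S) = \<psi>}"
  let ?s = "card S" and ?k = "card {e\<in>E. e \<inter> S \<noteq> {}}"
  let ?r = "card {e\<in>E. e \<inter> S \<noteq> {} \<and> \<not> e \<subseteq> S}"
  define \<mu> where "\<mu> = real n ^ ?s * q ^ ?k"
  show ?thesis
  proof (cases "Ext = {}")
    case True
    then show ?thesis unfolding Ext_def[symmetric] using q by simp
  next
    case False
    then obtain \<phi>0 where \<phi>0: "\<phi>0 \<in> Ext" by auto
    have finS: "finite S" using X(1,2) by (rule finite_subset[rotated])
    have s: "?s \<ge> 1" using finS X(3) by (simp add: Suc_le_eq card_gt_0_iff)
    have finExt: "finite Ext" using finite_typed_emb[OF X(1)] by (simp add: Ext_def)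
    have L2: "1 \<le> L\<^sup>2" using L(1) by (rule one_le_power)

    \<comment> \<open>The load bound leaves \<open>n q\<^sup>c = 1\<close> per vertex of \<open>S\<close>, up to \<open>\<delta>\<close> of an edge for each edge leaving \<open>S\<close>.\<close>
    have \<mu>_ge: "1 \<le> 4 ^ ?r * \<mu>"
    proof -
      have "real ?k \<le> c * real ?s + \<delta> * real ?r"
        by (rule card_touching_edges_le[OF X(1,2) E no_in, where \<phi> = \<phi>0]) (use \<phi>0 in \<open>auto simp: Ext_def\<close>)
      then have "q powr (c * real ?s + \<delta> * real ?r) \<le> q powr real ?k"
        using q by (intro powr_mono') auto
      also have "q powr real ?k = q ^ ?k" using q by (simp add: powr_realpow)
      also have "q powr (c * real ?s + \<delta> * real ?r) = (q powr c) ^ ?s * (q powr \<delta>) ^ ?r"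
        using q by (simp add: powr_add powr_powr flip: powr_realpow)
      finally have "(real n * q powr c) ^ ?s * (4 * q powr \<delta>) ^ ?r \<le> 4 ^ ?r * \<mu>"
        unfolding \<mu>_def power_mult_distrib by (simp add: mult_ac mult_left_mono)
      then have "(4 * q powr \<delta>) ^ ?r \<le> 4 ^ ?r * \<mu>" unfolding qc power_one mult_1 .
      moreover have "1 \<le> (4 * q powr \<delta>) ^ ?r" using q\<delta> by (intro one_le_power) simp
      ultimately show ?thesis by linarith
    qed
    have \<mu>0: "0 \<le> \<mu>" using q by (simp add: \<mu>_def)

    define \<P> where "\<P> = {\<F>. \<F> \<subseteq> Ext \<and> (\<forall>\<phi>\<in>\<F>. \<forall>\<phi>'\<in>\<F>. \<phi> \<noteq> \<phi>' \<longrightarrow> \<phi> ` S \<inter> \<phi>' ` S = {})}"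
    have "finite \<P>" by (rule finite_subset[of _ "Pow Ext"]) (use finExt in \<open>auto simp: \<P>_def\<close>)
    moreover have "{} \<in> \<P>" by (simp add: \<P>_def)
    ultimately obtain \<F> where \<F>: "\<F> \<in> \<P>" "\<And>\<F>'. \<F>' \<in> \<P> \<Longrightarrow> \<F> \<subseteq> \<F>' \<Longrightarrow> \<F> = \<F>'"
      using finite_has_maximal[of \<P>] by blast
    have \<F>_sub: "\<F> \<subseteq> Ext" and \<F>_disj: "\<And>\<phi> \<phi>'. \<phi> \<in> \<F> \<Longrightarrow> \<phi>' \<in> \<F> \<Longrightarrow> \<phi> \<noteq> \<phi>' \<Longrightarrow> \<phi> ` S \<inter> \<phi>' ` S = {}"
      using \<F>(1) by (auto simp: \<P>_def)
    have fin\<F>: "finite \<F>" using \<F>_sub finExt by (rule finite_subset)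
    have packed: "fact (card \<F>) \<le> real n ^ ?r * \<mu> ^ card \<F>"
      unfolding \<mu>_def using sparse q(1) n X E fin\<F> \<F>_sub \<F>_disj
      by (intro card_disjoint_extensions[where X = X and \<psi> = \<psi> and \<sigma> = \<sigma>]) (auto simp: Ext_def)
    \<comment> \<open>Either the packing is large enough to absorb the factor for the root, or its size
      is less than \<open>r L\<close>.\<close>
    have m: "real (card \<F>) \<le> 6 * \<mu> * (8 * L\<^sup>2) ^ ?r"
    proof (cases "real ?r * L \<le> real (card \<F>)")
      case True
      have "real n ^ ?r = 2 powr (L * real ?r)" by (simp add: L(2) powr_powr flip: powr_realpow)
      also have "\<dots> \<le> 2 powr real (card \<F>)" using True by (simp add: mult.commute)
      also have "\<dots> = 2 ^ card \<F>" by (simp add: powr_realpow)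
      finally have "real (card \<F>) \<le> 6 * \<mu>" by (intro le_if_fact_le_power[OF packed] \<mu>0)
      also have "\<dots> \<le> 6 * \<mu> * (8 * L\<^sup>2) ^ ?r"
        using mult_left_mono[OF one_le_power[of "8 * L\<^sup>2" ?r], of "6 * \<mu>"] L2 \<mu>0 by simp
      finally show ?thesis .
    next
      case False
      then have r: "?r \<noteq> 0" using L(1) by (intro notI) simp
      have "real (card \<F>) \<le> real ?r * L" using False by simp
      also have "\<dots> \<le> 2 ^ ?r * (L\<^sup>2) ^ ?r"
      proof (intro mult_mono)
        show "real ?r \<le> 2 ^ ?r" by (simp add: of_nat_less_two_power less_imp_le)
        have "L \<le> L\<^sup>2" using L(1) by (simp add: power2_eq_square)
        also have "\<dots> \<le> (L\<^sup>2) ^ ?r" using L2 r by (intro self_le_power) auto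
        finally show "L \<le> (L\<^sup>2) ^ ?r" .
      qed (use L(1) in auto)
      also have "\<dots> \<le> (4 ^ ?r * \<mu>) * (2 ^ ?r * (L\<^sup>2) ^ ?r)"
        using mult_right_mono[OF \<mu>_ge, of "2 ^ ?r * (L\<^sup>2) ^ ?r"] by simp
      also have "\<dots> = \<mu> * (4 * 2 * L\<^sup>2) ^ ?r" unfolding power_mult_distrib by (simp only: mult_ac)
      also have "\<dots> \<le> 6 * \<mu> * (8 * L\<^sup>2) ^ ?r" using \<mu>0 by simp
      finally show ?thesis .
    qed

    define Z where "Z = (\<Union>\<phi>\<in>\<F>. \<phi> ` S)"
    have cardZ: "card Z \<le> card \<F> * ?s"
    proof -
      have "card Z \<le> (\<Sum>\<phi>\<in>\<F>. card (\<phi> ` S))" unfolding Z_def by (rule card_UN_le[OF fin\<F>])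
      also have "\<dots> \<le> (\<Sum>\<phi>\<in>\<F>. ?s)" by (intro sum_mono card_image_le finS)
      finally show ?thesis by simp
    qed
    have finZ: "finite Z" using fin\<F> finS by (simp add: Z_def)
    have hit: "\<exists>x\<in>S. \<phi> x \<in> Z" if \<phi>: "\<phi> \<in> Ext" for \<phi>
    proof (rule ccontr)
      assume "\<not> (\<exists>x\<in>S. \<phi> x \<in> Z)"
      then have dis: "\<phi> ` S \<inter> \<phi>' ` S = {}" if "\<phi>' \<in> \<F>" for \<phi>' using that by (auto simp: Z_def)
      then have "insert \<phi> \<F> \<in> \<P>" using \<phi> \<F>_sub \<F>_disj unfolding \<P>_def by blast
      then have "\<phi> \<in> \<F>" using \<F>(2) by blast
      then show False using dis[of \<phi>] X(3) by blast
    qed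
    define Fix where "Fix x z = {\<phi>\<in>Ext. \<phi> x = z}" for x z
    have fix_bound: "real (card (Fix x z)) \<le> (c / \<delta>) ^ (?s - 1)" if x: "x \<in> S" for x z
    proof -
      have "inj_on (\<lambda>\<phi>. restrict \<phi> S) (Fix x z)"
      proof (rule inj_onI)
        fix \<phi> \<phi>' assume p: "\<phi> \<in> Fix x z" "\<phi>' \<in> Fix x z" "restrict \<phi> S = restrict \<phi>' S"
        show "\<phi> = \<phi>'"
        proof (rule PiE_ext[of _ X "\<lambda>_. verts H"])
          show "\<phi> \<in> X \<rightarrow>\<^sub>E verts H" "\<phi>' \<in> X \<rightarrow>\<^sub>E verts H"
            using p by (auto simp: Fix_def Ext_def typed_emb_def)
          fix y assume "y \<in> X"
          moreover have "restrict \<phi> (X - S) y = restrict \<phi>' (X - S) y"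
            using p(1,2) unfolding Fix_def Ext_def by simp
          moreover have "restrict \<phi> S y = restrict \<phi>' S y" using p(3) by simp
          ultimately show "\<phi> y = \<phi>' y" by (cases "y \<in> S") simp_all
        qed
      qed
      then have "card (Fix x z) = card ((\<lambda>\<phi>. restrict \<phi> S) ` Fix x z)" by (rule card_image[symmetric])
      also have "real \<dots> \<le> (c / \<delta>) ^ (?s - 1)"
      proof (rule card_spread_le[OF finS x])
        show "\<phi> x = z" if "\<phi> \<in> Fix x z" for \<phi> using that by (simp add: Fix_def)
        show "finite (nbrs u)" "real (card (nbrs u)) \<le> c / \<delta>" for u by (rule nbrs)+
        fix B assume B: "x \<in> B" "B \<subset> S"
        then obtain b y where by_: "b \<in> B" "y \<in> S - B" "{b, y} \<in> E" "b \<in> \<sigma> {b, y}"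
          using cut[of B] by blast
        have "\<phi> y \<in> nbrs (\<phi> b)" if "\<phi> \<in> Fix x z" for \<phi>
        proof -
          have t: "\<phi> \<in> typed_emb E \<sigma> X" using that by (simp add: Fix_def Ext_def)
          have e: "{b, y} \<subseteq> X" using E(2)[OF by_(3)] by simp
          show ?thesis
            using typed_embD(3)[OF t by_(3) e] typed_embD(4)[OF t by_(3) e, of b] by_(4)
            by (simp add: nbrs_def)
        qed
        then show "\<exists>b\<in>B. \<exists>y\<in>S - B. \<forall>\<phi>\<in>Fix x z. \<phi> y \<in> nbrs (\<phi> b)" using by_ by blast
      qed
      finally show ?thesis .
    qed
    have "Ext \<subseteq> (\<Union>(x, z)\<in>S \<times> Z. Fix x z)" using hit by (fastforce simp: Fix_def)
    then have "card Ext \<le> card (\<Union>(x, z)\<in>S \<times> Z. Fix x z)"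
      by (rule card_mono[rotated]) (use finS finZ finExt in \<open>auto simp: Fix_def\<close>)
    also have "\<dots> \<le> (\<Sum>(x, z)\<in>S \<times> Z. card (Fix x z))"
      using card_UN_le[of "S \<times> Z" "\<lambda>(x, z). Fix x z"] finS finZ by (simp add: case_prod_unfold)
    finally have "real (card Ext) \<le> real (\<Sum>(x, z)\<in>S \<times> Z. card (Fix x z))" by (rule of_nat_mono)
    also have "\<dots> = (\<Sum>p\<in>S \<times> Z. real (card (Fix (fst p) (snd p))))" by (simp add: case_prod_unfold)
    also have "\<dots> \<le> (\<Sum>p\<in>S \<times> Z. (c / \<delta>) ^ (?s - 1))" by (intro sum_mono fix_bound) auto
    also have "\<dots> = real (?s * card Z) * (c / \<delta>) ^ (?s - 1)" by (simp add: card_cartesian_product)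
    also have "\<dots> \<le> real (?s * (card \<F> * ?s)) * (L\<^sup>2) ^ (?s - 1)"
      using cardZ c \<delta> c\<delta> by (intro mult_mono power_mono of_nat_mono mult_le_mono) auto
    also have "\<dots> = (real ?s)\<^sup>2 * (L\<^sup>2) ^ (?s - 1) * real (card \<F>)"
      by (simp add: power2_eq_square mult_ac)
    also have "\<dots> \<le> 4 ^ (?s - 1) * (L\<^sup>2) ^ (?s - 1) * (6 * \<mu> * (8 * L\<^sup>2) ^ ?r)"
    proof (intro mult_mono m)
      have "(real t + 1)\<^sup>2 \<le> 4 ^ t" for t
      proof -
        have "real t + 1 \<le> 2 ^ t" by (induction t) auto
        then have "(real t + 1)\<^sup>2 \<le> (2 ^ t)\<^sup>2" by (intro power_mono) auto
        then show ?thesis by (simp add: power_even_eq[symmetric] power_mult[symmetric] mult.commute power2_eq_square power_mult_distrib[symmetric])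
      qed
      from this[of "?s - 1"] show "(real ?s)\<^sup>2 \<le> 4 ^ (?s - 1)" using s by (simp add: of_nat_diff)
    qed auto
    also have "\<dots> = 6 * \<mu> * ((4 * L\<^sup>2) ^ (?s - 1) * (8 * L\<^sup>2) ^ ?r)"
      unfolding power_mult_distrib[of 4] by (simp only: mult_ac)
    also have "\<dots> \<le> 6 ^ ?s * \<mu> * (8 * L\<^sup>2) ^ ?k"
    proof (intro mult_mono)
      show "(6::real) \<le> 6 ^ ?s" using s by (intro self_le_power) auto
      \<comment> \<open>The factors \<open>L\<^sup>2\<close> for the vertices of \<open>S\<close> other than the first are charged to the edges inside \<open>S\<close>.\<close>
      have inner: "?s - 1 + ?r \<le> ?k"
      proof -
        have ne: "{} \<notin> {e\<in>E. e \<subseteq> S}" using E(2) by force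
        obtain x where x: "x \<in> S" using X(3) by auto
        have "card {e\<in>E. e \<subseteq> {x}} + card S \<le> card {e\<in>E. e \<subseteq> S} + card {x}"
        proof (rule card_edges_grow[OF finS _ E(1)])
          fix B assume "{x} \<subseteq> B" "B \<subset> S"
          then show "\<exists>b\<in>B. \<exists>y\<in>S - B. {b, y} \<in> E" using cut[of B] by blast
        qed (use x in simp)
        then have "?s - 1 \<le> card {e\<in>E. e \<subseteq> S}" by simp
        moreover have "?k = card {e\<in>E. e \<subseteq> S} + ?r"
        proof -
          have "{e\<in>E. e \<inter> S \<noteq> {}} = {e\<in>E. e \<subseteq> S} \<union> {e\<in>E. e \<inter> S \<noteq> {} \<and> \<not> e \<subseteq> S}"
            using ne by (auto simp: Int_absorb2)
          then show ?thesis using E(1) by (simp add: card_Un_disjoint disjoint_iff)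
        qed
        ultimately show ?thesis by simp
      qed
      have "(4 * L\<^sup>2) ^ (?s - 1) * (8 * L\<^sup>2) ^ ?r \<le> (8 * L\<^sup>2) ^ (?s - 1) * (8 * L\<^sup>2) ^ ?r"
        by (intro mult_right_mono power_mono) auto
      also have "\<dots> = (8 * L\<^sup>2) ^ (?s - 1 + ?r)" by (simp add: power_add)
      also have "\<dots> \<le> (8 * L\<^sup>2) ^ ?k" using inner L2 by (intro power_increasing) auto
      finally show "(4 * L\<^sup>2) ^ (?s - 1) * (8 * L\<^sup>2) ^ ?r \<le> (8 * L\<^sup>2) ^ ?k" .
    qed (use \<mu>0 in auto)
    also have "\<dots> = (6 * real n) ^ ?s * (8 * q * L\<^sup>2) ^ ?k"
      unfolding \<mu>_def power_mult_distrib by (simp only: mult_ac)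
    finally show ?thesis by (simp only: Ext_def)
  qed
qed

text \<open>Induction over \<open>X\<close>, splitting off a source of the directed graph given by
  the type: a minimal nonempty set \<open>S\<close> that no edge enters. Minimality makes
  \<open>S\<close> strongly connected in the form of a cut condition: if no edge pointed from
  \<open>B\<close> to \<open>S - B\<close>, then no edge would enter \<open>S - B\<close> at
  all.\<close>
lemma (in oriented_graph) card_typed_emb_le:
  fixes X :: "'a set" and L q :: real
  assumes sparse: "q_sparse n q H" and n: "n \<ge> 1"
    and X: "finite X" and E: "finite E" "\<And>e. e \<in> E \<Longrightarrow> card e = 2"
    and L: "1 \<le> L" "real n = 2 powr L" and q: "0 < q" "q < 1"
    and qc: "real n * q powr c = 1" and q\<delta>: "1 / 4 \<le> q powr \<delta>" and c\<delta>: "c / \<delta> \<le> L\<^sup>2"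
  shows "real (card (typed_emb E \<sigma> X)) \<le>
    (6 * real n) ^ card X * (8 * q * L\<^sup>2) ^ card {e\<in>E. e \<subseteq> X}"
  using X
proof (induction "card X" arbitrary: X rule: less_induct)
  case less
  show ?case
  proof (cases "X = {}")
    case True
    have "card (typed_emb E \<sigma> X) \<le> card {\<lambda>_ :: 'a. undefined :: 'b}"
      unfolding True by (intro card_mono) (auto simp: typed_emb_def)
    moreover have none: "{e\<in>E. e \<subseteq> X} = {}" using E(2) True by force
    ultimately show ?thesis unfolding none using True by simp
  next
    case False
    define \<S> where "\<S> = {S. S \<subseteq> X \<and> S \<noteq> {} \<and> (\<forall>x\<in>S. \<forall>y\<in>X - S. {x, y} \<in> E \<longrightarrow> y \<notin> \<sigma> {x, y})}"
    have "finite \<S>" by (rule finite_subset[of _ "Pow X"]) (use less.prems in \<open>auto simp: \<S>_def\<close>)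
    moreover have "X \<in> \<S>" using False by (simp add: \<S>_def)
    ultimately obtain S where S: "S \<in> \<S>" "\<And>T. T \<in> \<S> \<Longrightarrow> T \<subseteq> S \<Longrightarrow> T = S"
      using finite_has_minimal[of \<S>] by blast
    have SX: "S \<subseteq> X" "S \<noteq> {}" and no_in: "\<And>x y. x \<in> S \<Longrightarrow> y \<in> X - S \<Longrightarrow> {x, y} \<in> E \<Longrightarrow> y \<notin> \<sigma> {x, y}"
      using S(1) by (auto simp: \<S>_def)
    have cut: "\<exists>b\<in>B. \<exists>y\<in>S - B. {b, y} \<in> E \<and> b \<in> \<sigma> {b, y}" if B: "B \<subset> S" "B \<noteq> {}" for B
    proof (rule ccontr)
      assume none: "\<not> ?thesis"
      have "S - B \<in> \<S>"
        unfolding \<S>_def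
      proof (intro CollectI conjI ballI impI)
        show "S - B \<subseteq> X" "S - B \<noteq> {}" using SX B by auto
        fix x y assume xy: "x \<in> S - B" "y \<in> X - (S - B)" "{x, y} \<in> E"
        show "y \<notin> \<sigma> {x, y}"
        proof (cases "y \<in> B")
          case True
          then show ?thesis using none xy(1,3) by (metis insert_commute)
        next
          case False
          then show ?thesis using xy no_in by blast
        qed
      qed
      from S(2)[OF this] have "S - B = S" by blast
      then show False using B by blast
    qed
    let ?E = "{e\<in>E. e \<subseteq> X}" and ?Y = "X - S"
    have "real (card (typed_emb E \<sigma> X)) \<le> real (card (typed_emb E \<sigma> ?Y)) *
      ((6 * real n) ^ card S * (8 * q * L\<^sup>2) ^ card {e\<in>?E. e \<inter> S \<noteq> {}})"
    proof (rule card_le_fibres[where f = "\<lambda>\<phi>. restrict \<phi> ?Y"])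
      show "finite (typed_emb E \<sigma> X)" "finite (typed_emb E \<sigma> ?Y)"
        using less.prems by (auto intro: finite_typed_emb)
      show "(\<lambda>\<phi>. restrict \<phi> ?Y) ` typed_emb E \<sigma> X \<subseteq> typed_emb E \<sigma> ?Y"
      proof (rule image_subsetI)
        fix \<phi> assume \<phi>: "\<phi> \<in> typed_emb E \<sigma> X"
        show "restrict \<phi> ?Y \<in> typed_emb E \<sigma> ?Y"
          unfolding typed_emb_def
        proof (intro CollectI conjI ballI impI)
          show "restrict \<phi> ?Y \<in> ?Y \<rightarrow>\<^sub>E verts H" using typed_embD(1)[OF \<phi>] by auto
          have "inj_on \<phi> ?Y" using typed_embD(2)[OF \<phi>] by (rule inj_on_subset) auto
          then show "inj_on (restrict \<phi> ?Y) ?Y" by simp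
          fix e assume e: "e \<in> E" "e \<subseteq> ?Y"
          then have eX: "e \<subseteq> X" by auto
          have im: "restrict \<phi> ?Y ` e = \<phi> ` e" using e(2) by (intro image_cong refl) auto
          show "restrict \<phi> ?Y ` e \<in> edges H" unfolding im by (rule typed_embD(3)[OF \<phi> e(1) eX])
          have same: "restrict \<phi> ?Y x = \<phi> x" if "x \<in> e" for x using that e(2) by auto
          have "{x\<in>e. \<delta> \<le> w (restrict \<phi> ?Y x) (restrict \<phi> ?Y ` e)} = {x\<in>e. \<delta> \<le> w (\<phi> x) (\<phi> ` e)}"
            unfolding im by (intro Collect_cong conj_cong refl) (simp only: same)
          also have "\<dots> = \<sigma> e" using \<phi> e(1) eX by (simp add: typed_emb_def)
          finally show "{x\<in>e. \<delta> \<le> w (restrict \<phi> ?Y x) (restrict \<phi> ?Y ` e)} = \<sigma> e" .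
        qed
      qed
      fix \<psi>
      have same: "typed_emb E \<sigma> X = typed_emb ?E \<sigma> X" by (auto simp: typed_emb_def)
      show "real (card {\<phi> \<in> typed_emb E \<sigma> X. restrict \<phi> ?Y = \<psi>}) \<le>
          (6 * real n) ^ card S * (8 * q * L\<^sup>2) ^ card {e\<in>?E. e \<inter> S \<noteq> {}}"
        unfolding same
      proof (rule card_extensions[OF sparse n less.prems SX _ _ _ _ L q qc q\<delta> c\<delta>])
        show "finite ?E" using E(1) by simp
        show "e \<subseteq> X \<and> card e = 2" if "e \<in> ?E" for e using that E(2) by simp
        show "y \<notin> \<sigma> {x, y}" if "x \<in> S" "y \<in> X - S" "{x, y} \<in> ?E" for x y
          using no_in[of x y] that by simp
        show "\<exists>b\<in>B. \<exists>y\<in>S - B. {b, y} \<in> ?E \<and> b \<in> \<sigma> {b, y}" if B: "B \<subset> S" "B \<noteq> {}" for B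
        proof -
          obtain b y where "b \<in> B" "y \<in> S - B" "{b, y} \<in> E" "b \<in> \<sigma> {b, y}"
            using cut[OF B] by blast
          moreover from this have "{b, y} \<subseteq> X" using B(1) SX(1) by blast
          ultimately show ?thesis by blast
        qed
      qed
    qed
    also have "\<dots> \<le> ((6 * real n) ^ card ?Y * (8 * q * L\<^sup>2) ^ card {e\<in>E. e \<subseteq> ?Y}) *
      ((6 * real n) ^ card S * (8 * q * L\<^sup>2) ^ card {e\<in>?E. e \<inter> S \<noteq> {}})"
    proof (rule mult_right_mono)
      have "card ?Y < card X" using SX less.prems by (intro psubset_card_mono) auto
      then show "real (card (typed_emb E \<sigma> ?Y)) \<le> (6 * real n) ^ card ?Y * (8 * q * L\<^sup>2) ^ card {e\<in>E. e \<subseteq> ?Y}"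
        using less.prems by (intro less.hyps) auto
    qed (use q in auto)
    also have "\<dots> = (6 * real n) ^ (card ?Y + card S) *
        (8 * q * L\<^sup>2) ^ (card {e\<in>E. e \<subseteq> ?Y} + card {e\<in>?E. e \<inter> S \<noteq> {}})"
      unfolding power_add by (simp only: mult_ac)
    also have "card ?Y + card S = card X"
      using SX(1) less.prems by (metis Diff_partition Diff_disjoint Int_commute card_Un_disjoint finite_Diff finite_subset add.commute)
    also have "card {e\<in>E. e \<subseteq> ?Y} + card {e\<in>?E. e \<inter> S \<noteq> {}} = card ?E"
    proof -
      have "card ({e\<in>E. e \<subseteq> ?Y} \<union> {e\<in>?E. e \<inter> S \<noteq> {}}) =
          card {e\<in>E. e \<subseteq> ?Y} + card {e\<in>?E. e \<inter> S \<noteq> {}}"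
        by (intro card_Un_disjoint) (use E(1) in auto)
      moreover have "{e\<in>E. e \<subseteq> ?Y} \<union> {e\<in>?E. e \<inter> S \<noteq> {}} = ?E" by auto
      ultimately show ?thesis by (simp only:)
    qed
    finally show ?thesis .
  qed
qed

section \<open>The bound with a squared logarithm\<close>

text \<open>Sparsity bounds the density of every subgraph of \<open>H\<close> by \<open>c = log n /
  log (1 / q)\<close>, so \<open>H\<close> has a fractional orientation with load at most
  \<open>c\<close>. With the threshold \<open>\<delta> = 1 / log n\<close> a vertex has at most
  \<open>c log n \<le> log\<^sup>2 n\<close> neighbours along edges pointing away from it, while
  \<open>q\<close> to the power \<open>\<delta>\<close> is still bounded below, because \<open>q
  \<ge> 1 / n\<^sup>2\<close>. Each edge has four types, which costs a factor 4 per edge.\<close>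
lemma emb_bound_log_squared:
  fixes H :: "'b graph" and F :: "'a graph"
  assumes H: "simple_graph H" "edges H \<noteq> {}" and sparse: "q_sparse n q H"
    and q: "0 < q" "q \<le> 1 / 2" and n: "2 \<le> n" and F: "simple_graph F"
  shows "real (card (emb H F)) \<le>
    (6 * real n) ^ card (verts F) * (32 * (log 2 (real n))\<^sup>2 * q) ^ card (edges F)"
proof -
  define L where "L = log 2 (real n)"
  define c where "c = ln (real n) / ln (1 / q)"
  define \<delta> where "\<delta> = 1 / L"
  have L: "1 \<le> L" "real n = 2 powr L" using n by (simp_all add: L_def le_log_iff)
  have lnq: "ln 2 \<le> ln (1 / q)" using q by (simp add: field_simps)
  have ln_pos: "0 < ln (1 / q)" using lnq ln_gt_zero[of "2::real"] by linarith
  have c0: "0 \<le> c" using n ln_pos by (simp add: c_def)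
  have cL: "c \<le> L"
    unfolding c_def L_def log_def using lnq ln_pos n by (intro divide_left_mono mult_pos_pos) auto
  have qc: "real n * q powr c = 1"
  proof -
    have "c * ln q = - ln (real n)" using ln_pos q by (simp add: c_def ln_div)
    then show ?thesis using q n by (simp add: powr_def exp_minus)
  qed
  obtain e0 where e0: "e0 \<in> edges H" using H(2) by auto
  have q\<delta>: "1 / 4 \<le> q powr \<delta>"
  proof -
    have "1 / 4 = (2::real) powr (-2)" by (simp add: powr_minus)
    also have "\<dots> = (2 powr (- 2 * L)) powr \<delta>" using L(1) by (simp add: powr_powr \<delta>_def)
    also have "\<dots> \<le> q powr \<delta>"
    proof (rule powr_mono2)
      have "2 powr (- 2 * L) = 1 / (real n)\<^sup>2"
        unfolding L(2) by (simp add: powr_minus powr_power divide_inverse mult.commute)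
      then show "2 powr (- 2 * L) \<le> q"
        using q_sparse_edge[OF H(1) e0 sparse] q n by (simp add: divide_le_eq mult.commute)
    qed (use L(1) in \<open>auto simp: \<delta>_def\<close>)
    finally show ?thesis .
  qed
  have dens: "real (card {e\<in>edges H. e \<subseteq> T}) \<le> c * real (card T)" if T: "T \<subseteq> verts H" for T
  proof -
    let ?I = "(T, {e\<in>edges H. e \<subseteq> T})"
    have "subgraph ?I H"
      using T simple_graphD[OF H(1)] finite_subset[OF T] by (auto simp: subgraph_def simple_graph_def)
    from q_sparse_density[OF sparse _ this]
    have "1 \<le> real n ^ card T * q ^ card {e\<in>edges H. e \<subseteq> T}" using q by simp
    then have "0 \<le> ln (real n ^ card T * q ^ card {e\<in>edges H. e \<subseteq> T})"
      by (rule ln_ge_zero)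
    also have "\<dots> = real (card T) * ln (real n) - real (card {e\<in>edges H. e \<subseteq> T}) * ln (1 / q)"
      using q n by (simp add: ln_mult ln_realpow ln_div)
    finally have "real (card {e\<in>edges H. e \<subseteq> T}) * ln (1 / q) \<le> real (card T) * ln (real n)" by simp
    then show ?thesis using ln_pos by (simp add: c_def field_simps)
  qed
  obtain w where w: "\<And>e x. e \<in> edges H \<Longrightarrow> x \<in> e \<Longrightarrow> 0 \<le> w x e"
      "\<And>e. e \<in> edges H \<Longrightarrow> (\<Sum>x\<in>e. w x e) = 1"
      "\<And>x. x \<in> verts H \<Longrightarrow> (\<Sum>e\<in>{e\<in>edges H. x \<in> e}. w x e) \<le> c"
  proof (rule fractional_orientation[of "verts H" "edges H" c])
    show "e \<noteq> {}" if "e \<in> edges H" for e using simple_graphD(3)[OF H(1) that] by auto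
  qed (use simple_graphD[OF H(1)] dens in auto)
  interpret oriented_graph H w c \<delta>
    by unfold_locales (use H w c0 L in \<open>auto simp: \<delta>_def\<close>)
  let ?V = "verts F" and ?E = "edges F"
  let ?\<Sigma> = "PiE ?E Pow"
  have fin: "finite ?V" "finite ?E" using F by (auto simp: simple_graphD)
  have fin\<Sigma>: "finite ?\<Sigma>" using simple_graphD[OF F] finite_subset by (intro finite_PiE) blast+
  have "emb H F \<subseteq> (\<Union>\<sigma>\<in>?\<Sigma>. typed_emb ?E \<sigma> ?V)"
  proof
    fix \<phi> assume \<phi>: "\<phi> \<in> emb H F"
    let ?\<sigma> = "\<lambda>e\<in>?E. {x\<in>e. \<delta> \<le> w (\<phi> x) (\<phi> ` e)}"
    have "?\<sigma> \<in> ?\<Sigma>" by auto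
    moreover have "\<phi> \<in> typed_emb ?E ?\<sigma> ?V" using \<phi> by (auto simp: typed_emb_def emb_def)
    ultimately show "\<phi> \<in> (\<Union>\<sigma>\<in>?\<Sigma>. typed_emb ?E \<sigma> ?V)" by blast
  qed
  then have "card (emb H F) \<le> card (\<Union>\<sigma>\<in>?\<Sigma>. typed_emb ?E \<sigma> ?V)"
    by (rule card_mono[rotated]) (use fin\<Sigma> finite_typed_emb[OF fin(1)] in auto)
  also have "\<dots> \<le> (\<Sum>\<sigma>\<in>?\<Sigma>. card (typed_emb ?E \<sigma> ?V))" by (rule card_UN_le[OF fin\<Sigma>])
  finally have "real (card (emb H F)) \<le> (\<Sum>\<sigma>\<in>?\<Sigma>. real (card (typed_emb ?E \<sigma> ?V)))"
    by (simp flip: of_nat_sum)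
  also have "\<dots> \<le> (\<Sum>\<sigma>\<in>?\<Sigma>. (6 * real n) ^ card ?V * (8 * q * L\<^sup>2) ^ card ?E)"
  proof (rule sum_mono)
    fix \<sigma>
    have "c / \<delta> \<le> L\<^sup>2" using cL L(1) by (simp add: \<delta>_def power2_eq_square mult_right_mono)
    moreover have all: "{e\<in>?E. e \<subseteq> ?V} = ?E" using simple_graphD(2)[OF F] by auto
    ultimately show "real (card (typed_emb ?E \<sigma> ?V)) \<le> (6 * real n) ^ card ?V * (8 * q * L\<^sup>2) ^ card ?E"
      using card_typed_emb_le[OF sparse _ fin(1,2) simple_graphD(3)[OF F] L q(1) _ qc q\<delta>, of \<sigma>] q(2) n
      by simp
  qed
  also have "\<dots> = real (card ?\<Sigma>) * ((6 * real n) ^ card ?V * (8 * q * L\<^sup>2) ^ card ?E)" by simp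
  also have "card ?\<Sigma> = 4 ^ card ?E"
  proof -
    have "card ?\<Sigma> = (\<Prod>e\<in>?E. card (Pow e))" by (rule card_PiE[OF fin(2)])
    also have "\<dots> = (\<Prod>e\<in>?E. 4)"
      using simple_graphD[OF F] by (intro prod.cong refl) (simp add: card_Pow card_ge_0_finite)
    finally show ?thesis by simp
  qed
  also have "real (4 ^ card ?E) * ((6 * real n) ^ card ?V * (8 * q * L\<^sup>2) ^ card ?E) =
      (6 * real n) ^ card ?V * (4 * (8 * q * L\<^sup>2)) ^ card ?E"
    unfolding power_mult_distrib[of 4] by simp
  also have "4 * (8 * q * L\<^sup>2) = 32 * L\<^sup>2 * q" by simp
  finally show ?thesis by (simp only: L_def)
qed

text \<open>If \<open>p > 1\<close>, the expectation exceeds the number of copies in the complete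
  graph, which is at least that in \<open>H\<close>. Otherwise \<open>q \<le> 1 / 2\<close>, as the
  bound on embeddings requires.\<close>
lemma num_copies_less_expected_log_squared:
  assumes "1 \<le> n" and q: "0 \<le> q" and H: "simple_graph H" and sparse: "q_sparse n q H"
    and p: "p = 11520 * q * (log 2 (real n))\<^sup>2" and F: "subgraph F H" "edges F \<noteq> {}"
  shows "real (num_copies H F) < expected_copies n p F"
proof -
  have sF: "simple_graph F" using F(1) by (simp add: subgraph_def)
  obtain e0 where e0: "e0 \<in> edges H" using F by (auto simp: subgraph_def)
  have cardH: "card (verts H) \<le> n" by (rule card_verts_le_if_q_sparse[OF H sparse q])
  have n: "2 \<le> n"
    using card_mono[OF simple_graphD(1)[OF H] simple_graphD(2)[OF H e0]] simple_graphD(3)[OF H e0] cardH by simp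
  have q0: "0 < q" by (rule q_pos_if_q_sparse[OF H e0 sparse q])
  let ?L = "log 2 (real n)"
  have L: "1 \<le> ?L" using n by (simp add: le_log_iff)
  have p0: "0 \<le> p" using q by (simp add: p)
  have "real (num_copies H F) < real (num_copies (K_graph n) F) * p ^ card (edges F)"
  proof (cases "p \<le> 1")
    case True
    have "1 * q \<le> ?L\<^sup>2 * q" using L q by (intro mult_right_mono one_le_power) auto
    moreover have "11520 * (?L\<^sup>2 * q) \<le> 1" using True by (simp add: p mult_ac)
    ultimately have "q \<le> 1 / 2" using q by linarith
    then have "real (num_copies H F) <
        real (num_copies (K_graph n) F) * (10 * 6\<^sup>2 * (32 * ?L\<^sup>2) * q) ^ card (edges F)"
      using L q0 emb_bound_log_squared[OF H _ sparse q0 _ n] e0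
      by (intro num_copies_less_if_emb_bound[OF H cardH F]) (auto simp: subgraph_def)
    also have "10 * 6\<^sup>2 * (32 * ?L\<^sup>2) * q = p" by (simp add: p)
    finally show ?thesis .
  next
    case False
    have vF: "card (verts F) \<le> n"
      using card_mono[OF simple_graphD(1)[OF H], of "verts F"] F(1) cardH by (simp add: subgraph_def)
    have N: "0 < num_copies (K_graph n) F" by (rule num_copies_K_graph_pos[OF sF vF])
    have "real (num_copies H F) \<le> real (num_copies (K_graph n) F) * 1"
      using num_copies_le_K_graph[OF H cardH sF] by simp
    also have "\<dots> < real (num_copies (K_graph n) F) * p ^ card (edges F)"
      using N False F(2) simple_graphD(4)[OF sF]
      by (intro mult_strict_left_mono one_less_power) (auto simp: card_gt_0_iff)
    finally show ?thesis .
  qed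
  then show ?thesis by (simp add: expected_copies_eq[OF p0])
qed

section \<open>Connected graphs and components\<close>

text \<open>Connectedness is expressed by cuts and not by paths, since it is only used to find an
  edge that leaves a given set.\<close>
definition connected_graph :: "'a graph \<Rightarrow> bool" where
  "connected_graph G \<longleftrightarrow> verts G \<noteq> {} \<and>
     (\<forall>B. B \<subset> verts G \<longrightarrow> B \<noteq> {} \<longrightarrow> (\<exists>b\<in>B. \<exists>y\<in>verts G - B. {b, y} \<in> edges G))"

definition induced :: "'a graph \<Rightarrow> 'a set \<Rightarrow> 'a graph" where
  "induced G P = (P, {e\<in>edges G. e \<subseteq> P})"

lemma verts_induced [simp]: "verts (induced G P) = P"
  and edges_induced [simp]: "edges (induced G P) = {e\<in>edges G. e \<subseteq> P}"
  by (simp_all add: induced_def)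

lemma connected_image_graph:
  assumes "connected_graph G"
  shows "connected_graph (image_graph f G)"
  unfolding connected_graph_def
proof (intro conjI allI impI)
  show "verts (image_graph f G) \<noteq> {}" using assms by (simp add: connected_graph_def)
  fix B assume B: "B \<subset> verts (image_graph f G)" "B \<noteq> {}"
  let ?B = "{x\<in>verts G. f x \<in> B}"
  have "?B \<subset> verts G" "?B \<noteq> {}" using B by auto
  then obtain b y where by_: "b \<in> ?B" "y \<in> verts G - ?B" "{b, y} \<in> edges G"
    using assms unfolding connected_graph_def by blast
  have "f ` {b, y} \<in> edges (image_graph f G)" unfolding edges_image_graph by (rule imageI[OF by_(3)])
  then show "\<exists>b\<in>B. \<exists>y\<in>verts (image_graph f G) - B. {b, y} \<in> edges (image_graph f G)"
    using by_(1,2) by (intro bexI[of _ "f b"] bexI[of _ "f y"]) auto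
qed

lemma subgraph_induced:
  assumes "simple_graph G" "P \<subseteq> verts G"
  shows "subgraph (induced G P) G"
  using assms finite_subset[OF assms(2)] simple_graphD[OF assms(1)]
  by (auto simp: subgraph_def simple_graph_def)

lemma simple_graph_induced:
  assumes "simple_graph G" "P \<subseteq> verts G"
  shows "simple_graph (induced G P)"
  using subgraph_induced[OF assms] by (simp add: subgraph_def)

lemma edge_on_one_side:
  assumes "card e = 2" "e \<subseteq> U" "\<And>b y. b \<in> B \<Longrightarrow> y \<in> U - B \<Longrightarrow> {b, y} \<noteq> e"
  shows "e \<subseteq> B \<or> e \<subseteq> U - B"
proof -
  obtain x y where e: "e = {x, y}" using assms(1) by (auto simp: card_2_iff)
  have "{x, y} = {y, x}" by blast
  then show ?thesis using assms(2) assms(3)[of x y] assms(3)[of y x] unfolding e by blast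
qed

lemma obtain_components:
  assumes H: "simple_graph H"
  obtains \<P> where "\<Union>\<P> = verts H" "disjoint \<P>"
    "\<forall>P\<in>\<P>. connected_graph (induced H P)" "\<forall>e\<in>edges H. \<exists>P\<in>\<P>. e \<subseteq> P"
proof -
  have "\<exists>\<P>. \<Union>\<P> = U \<and> disjoint \<P> \<and> (\<forall>P\<in>\<P>. connected_graph (induced H P)) \<and>
      (\<forall>e\<in>edges H. e \<subseteq> U \<longrightarrow> (\<exists>P\<in>\<P>. e \<subseteq> P))" if "U \<subseteq> verts H" for U
    using that
  proof (induction "card U" arbitrary: U rule: less_induct)
    case less
    have finU: "finite U" using less.prems simple_graphD(1)[OF H] by (rule finite_subset)
    consider "U = {}" | "connected_graph (induced H U)"
      | B where "B \<subset> U" "B \<noteq> {}" "\<And>b y. b \<in> B \<Longrightarrow> y \<in> U - B \<Longrightarrow> {b, y} \<notin> edges H"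
    proof (cases "U = {} \<or> connected_graph (induced H U)")
      case False
      then obtain B where B: "B \<subset> U" "B \<noteq> {}"
          "\<not> (\<exists>b\<in>B. \<exists>y\<in>U - B. {b, y} \<in> edges (induced H U))"
        unfolding connected_graph_def verts_induced by blast
      then have "{b, y} \<notin> edges H" if "b \<in> B" "y \<in> U - B" for b y
        using that unfolding edges_induced by blast
      then show ?thesis using that(3) B by blast
    qed blast
    then show ?case
    proof cases
      case 1
      then have "\<not> e \<subseteq> U" if "e \<in> edges H" for e using simple_graphD(3)[OF H that] by auto
      then show ?thesis using 1 by (intro exI[of _ "{}"]) auto
    next
      case 2
      then show ?thesis by (intro exI[of _ "{U}"]) auto
    next
      case 3
      have "card B < card U" "card (U - B) < card U"
        using 3(1,2) finU by (auto intro: psubset_card_mono)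
      moreover have "B \<subseteq> verts H" "U - B \<subseteq> verts H" using less.prems 3(1) by auto
      ultimately have ex: "\<exists>\<P>. \<Union>\<P> = T \<and> disjoint \<P> \<and> (\<forall>P\<in>\<P>. connected_graph (induced H P)) \<and>
          (\<forall>e\<in>edges H. e \<subseteq> T \<longrightarrow> (\<exists>P\<in>\<P>. e \<subseteq> P))" if "T = B \<or> T = U - B" for T
        using less.hyps[of T] \<open>card B < card U\<close> \<open>card (U - B) < card U\<close> that by (elim disjE) simp_all
      obtain \<P>1 where 1: "\<Union>\<P>1 = B" "disjoint \<P>1" "\<forall>P\<in>\<P>1. connected_graph (induced H P)"
          "\<forall>e\<in>edges H. e \<subseteq> B \<longrightarrow> (\<exists>P\<in>\<P>1. e \<subseteq> P)"
        using ex[OF disjI1[OF refl]] by (elim exE conjE) (rule that)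
      obtain \<P>2 where 2: "\<Union>\<P>2 = U - B" "disjoint \<P>2" "\<forall>P\<in>\<P>2. connected_graph (induced H P)"
          "\<forall>e\<in>edges H. e \<subseteq> U - B \<longrightarrow> (\<exists>P\<in>\<P>2. e \<subseteq> P)"
        using ex[OF disjI2[OF refl]] by (elim exE conjE) (rule that)
      have "\<exists>P\<in>\<P>1 \<union> \<P>2. e \<subseteq> P" if e: "e \<in> edges H" "e \<subseteq> U" for e
      proof -
        have "e \<subseteq> B \<or> e \<subseteq> U - B"
          using simple_graphD(3)[OF H e(1)] e(2) by (rule edge_on_one_side) (use 3(3) e(1) in blast)
        then show ?thesis
        proof
          assume "e \<subseteq> B"
          then have "\<exists>P\<in>\<P>1. e \<subseteq> P" using 1(4) e(1) by simp
          then show ?thesis by auto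
        next
          assume "e \<subseteq> U - B"
          then have "\<exists>P\<in>\<P>2. e \<subseteq> P" using 2(4) e(1) by simp
          then show ?thesis by auto
        qed
      qed
      then have "\<forall>e\<in>edges H. e \<subseteq> U \<longrightarrow> (\<exists>P\<in>\<P>1 \<union> \<P>2. e \<subseteq> P)" by (intro ballI impI)
      moreover have "disjoint (\<P>1 \<union> \<P>2)" by (rule disjoint_union) (use 1 2 in auto)
      moreover have "\<Union>(\<P>1 \<union> \<P>2) = U" using 1(1) 2(1) 3(1) by auto
      moreover have "\<forall>P\<in>\<P>1 \<union> \<P>2. connected_graph (induced H P)" using 1(3) 2(3) by auto
      ultimately show ?thesis by (intro exI[of _ "\<P>1 \<union> \<P>2"] conjI)
    qed
  qed
  from this[OF subset_refl] obtain \<P> where "\<Union>\<P> = verts H" "disjoint \<P>"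
      "\<forall>P\<in>\<P>. connected_graph (induced H P)" "\<forall>e\<in>edges H. e \<subseteq> verts H \<longrightarrow> (\<exists>P\<in>\<P>. e \<subseteq> P)"
    by (elim exE conjE) (rule that)
  then show ?thesis using that[of \<P>] simple_graphD(2)[OF H] by simp
qed

lemma card_edges_connected_ge:
  assumes G: "simple_graph G" and conn: "connected_graph G"
  shows "card (verts G) \<le> card (edges G) + 1"
proof -
  obtain x where x: "x \<in> verts G" using conn by (auto simp: connected_graph_def)
  have "card {e\<in>edges G. e \<subseteq> {x}} + card (verts G) \<le> card {e\<in>edges G. e \<subseteq> verts G} + card {x}"
  proof (rule card_edges_grow)
    fix B assume "{x} \<subseteq> B" "B \<subset> verts G"
    then show "\<exists>b\<in>B. \<exists>y\<in>verts G - B. {b, y} \<in> edges G" using conn unfolding connected_graph_def by blast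
  qed (use x simple_graphD[OF G] in auto)
  moreover have "{e\<in>edges G. e \<subseteq> verts G} = edges G" using simple_graphD(2)[OF G] by auto
  ultimately show ?thesis by simp
qed

text \<open>A subgraph with at least as many edges as vertices would have expected number of copies
  at most \<open>(n q)\<^sup>v < 1\<close>.\<close>
lemma card_edges_forest_le:
  assumes sparse: "q_sparse n q H" "0 \<le> q" and nq: "real n * q < 1 / 3" and n: "1 \<le> n"
    and I: "subgraph I H" "verts I \<noteq> {}"
  shows "card (edges I) + 1 \<le> card (verts I)"
proof (rule ccontr)
  assume "\<not> ?thesis"
  then have le: "card (verts I) \<le> card (edges I)" by simp
  have "finite (verts I)" using I(1) by (auto simp: subgraph_def simple_graphD)
  then have pos: "card (verts I) \<noteq> 0" using I(2) by simp
  have "1 * q \<le> real n * q" using n sparse(2) by (intro mult_right_mono) auto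
  then have "q \<le> 1" using nq by linarith
  have "1 \<le> real n ^ card (verts I) * q ^ card (edges I)" by (rule q_sparse_density[OF sparse I(1)])
  also have "\<dots> \<le> real n ^ card (verts I) * q ^ card (verts I)"
    using le sparse(2) \<open>q \<le> 1\<close> by (intro mult_left_mono power_decreasing) auto
  also have "\<dots> = (real n * q) ^ card (verts I)" by (simp add: power_mult_distrib)
  also have "\<dots> < 1" 
    using nq sparse(2) pos power_strict_mono[of "real n * q" 1 "card (verts I)"] by simp
  finally show False by simp
qed

section \<open>Trees containing a given tree\<close>

text \<open>Trees on \<open>{1..u}\<close> are given by their edge sets, as connected graphs with
  \<open>u - 1\<close> edges.\<close>
definition trees :: "nat \<Rightarrow> nat set set set" where
  "trees u = {E. E \<subseteq> edges (K_graph u) \<and> connected_graph ({1..u}, E) \<and> card E + 1 = u}"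

lemma finite_trees: "finite (trees u)"
  by (rule finite_subset[of _ "Pow (edges (K_graph u))"]) (auto simp: trees_def finite_edges_K_graph)

lemma simple_graph_tree: "E \<in> trees u \<Longrightarrow> simple_graph ({1..u}, E)"
  by (auto simp: trees_def simple_graph_def K_graph_def)

text \<open>Such a tree is determined by \<open>E0\<close> and a parent function: grow the vertex
  set from \<open>A\<close> and map each new vertex to a vertex through which it is attached. The
  edges found in this way are distinct, and their number shows that they are all edges of the
  tree.\<close>
lemma card_trees_containing_le:
  assumes A: "A \<subseteq> {1..u}" "A \<noteq> {}" and E0: "\<And>e. e \<in> E0 \<Longrightarrow> e \<subseteq> A" "card E0 + 1 = card A" "finite E0"
  shows "card {E\<in>trees u. E0 \<subseteq> E} \<le> u ^ (u - card A)"
proof -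
  let ?W = "{1..u} - A"
  let ?g = "\<lambda>f B. E0 \<union> (\<lambda>x. {x, f x}) ` (B - A)"
  have "\<exists>f\<in>?W \<rightarrow>\<^sub>E {1..u}. E = ?g f {1..u}" if E: "E \<in> trees u" "E0 \<subseteq> E" for E
  proof -
    have conn: "connected_graph ({1..u}, E)" and cE: "card E + 1 = u" and finE: "finite E"
      using E(1) finite_subset[OF _ finite_edges_K_graph] by (auto simp: trees_def)
    have "\<exists>f. (\<forall>x\<in>{1..u} - A. f x \<in> {1..u}) \<and> ?g f {1..u} \<subseteq> E \<and> (\<forall>e\<in>?g f {1..u}. e \<subseteq> {1..u}) \<and>
        card E0 + card {1..u} = card (?g f {1..u}) + card A"
      using finite_atLeastAtMost[of 1 u] A(1)
    proof (induction rule: grow_induct)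
      case base
      show ?case using E(2) E0(1) by (intro exI[of _ "\<lambda>_. 0"]) auto
    next
      case (step B)
      have finB: "finite B" using step(2) by (metis finite_atLeastAtMost finite_subset psubset_imp_subset)
      from step(3) obtain f where f: "\<forall>x\<in>B - A. f x \<in> B" "?g f B \<subseteq> E" "\<forall>e\<in>?g f B. e \<subseteq> B"
          "card E0 + card B = card (?g f B) + card A"
        by (elim exE conjE) (rule that)
      have "B \<noteq> {}" using A(2) step(1) by blast
      then obtain b y where by_: "b \<in> B" "y \<in> {1..u} - B" "{b, y} \<in> E"
        using conn step(2) unfolding connected_graph_def fst_conv snd_conv by blast
      have yA: "y \<notin> A" using by_(2) step(1) by blast
      let ?f = "f(y := b)"
      have g: "?g ?f (insert y B) = insert {y, b} (?g f B)"
      proof -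
        have "insert y B - A = insert y (B - A)" using yA by blast
        moreover have "(\<lambda>x. {x, ?f x}) ` (B - A) = (\<lambda>x. {x, f x}) ` (B - A)"
          using by_(2) by (intro image_cong) auto
        ultimately show ?thesis by simp
      qed
      have new: "{y, b} \<notin> ?g f B"
      proof
        assume "{y, b} \<in> ?g f B"
        then have "{y, b} \<subseteq> B" by (rule bspec[OF f(3)])
        then show False using by_(2) by simp
      qed
      have "finite (?g f B)" using f(2) finE by (rule finite_subset)
      then have "card (?g ?f (insert y B)) = Suc (card (?g f B))" unfolding g using new by simp
      moreover have "card (insert y B) = Suc (card B)" using finB by_(2) by simp
      ultimately have c: "card E0 + card (insert y B) = card (?g ?f (insert y B)) + card A" using f(4) by simp
      have "\<forall>x\<in>insert y B - A. ?f x \<in> insert y B" using f(1) by_ by auto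
      moreover have "?g ?f (insert y B) \<subseteq> E" unfolding g using f(2) by_(3) by (auto simp: insert_commute)
      moreover have "\<forall>e\<in>?g ?f (insert y B). e \<subseteq> insert y B"
        unfolding g
      proof (rule ballI, erule insertE)
        fix e assume "e = {y, b}"
        then show "e \<subseteq> insert y B" using by_(1) by simp
      next
        fix e assume "e \<in> ?g f B"
        then have "e \<subseteq> B" by (rule bspec[OF f(3)])
        then show "e \<subseteq> insert y B" by (rule subset_insertI2)
      qed
      ultimately show ?case using by_(2) c by (intro bexI[of _ y] exI[of _ ?f] conjI)
    qed
    then obtain f where f: "\<forall>x\<in>?W. f x \<in> {1..u}" "?g f {1..u} \<subseteq> E" "card E0 + u = card (?g f {1..u}) + card A"
      by auto
    have "card (?g f {1..u}) = card E" using f(3) cE E0(2) by linarith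
    then have "?g f {1..u} = E" using f(2) finE by (intro card_subset_eq) auto
    moreover have "?g (restrict f ?W) {1..u} = ?g f {1..u}"
    proof -
      have "(\<lambda>x. {x, restrict f ?W x}) ` ?W = (\<lambda>x. {x, f x}) ` ?W" by (intro image_cong refl) simp
      then show ?thesis by simp
    qed
    ultimately have eq: "E = ?g (restrict f ?W) {1..u}" by (simp only:)
    have "restrict f ?W \<in> ?W \<rightarrow>\<^sub>E {1..u}" using f(1) by auto
    then show ?thesis using eq by (intro bexI[of _ "restrict f ?W"])
  qed
  then have "{E\<in>trees u. E0 \<subseteq> E} \<subseteq> (\<lambda>f. ?g f {1..u}) ` (?W \<rightarrow>\<^sub>E {1..u})"
    by (intro subsetI) (simp only: mem_Collect_eq image_iff)
  then have "card {E\<in>trees u. E0 \<subseteq> E} \<le> card (?W \<rightarrow>\<^sub>E {1..u})"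
    by (rule surj_card_le[rotated]) (auto intro: finite_PiE)
  also have "\<dots> = u ^ (u - card A)" using A(1) by (simp add: card_funcsetE card_Diff_subset finite_subset)
  finally show ?thesis .
qed

text \<open>Double counting of pairs of a tree on \<open>{1..u}\<close> and an embedding of
  \<open>F\<close> into it: each injection \<open>\<phi>\<close> of the vertices of \<open>F\<close>
  is counted once for every tree that contains the image of \<open>F\<close>.\<close>
lemma sum_emb_trees_le:
  assumes F: "simple_graph F" "verts F \<noteq> {}" "card (edges F) + 1 = card (verts F)"
  shows "(\<Sum>E\<in>trees u. card (emb ({1..u}, E) F)) \<le>
    (\<Prod>i<card (verts F). u - i) * u ^ (u - card (verts F))"
proof -
  let ?V = "verts F"
  let ?I = "{\<phi> \<in> ?V \<rightarrow>\<^sub>E {1..u}. inj_on \<phi> ?V}"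
  have finV: "finite ?V" by (rule simple_graphD[OF F(1)])
  have finI: "finite ?I" using finV by (intro finite_subset[OF _ finite_PiE[of ?V "\<lambda>_. {1..u}"]]) auto
  have emb_eq: "emb ({1..u}, E) F = {\<phi>\<in>?I. (\<lambda>e. \<phi> ` e) ` edges F \<subseteq> E}" for E
    by (auto simp: emb_def)
  have "(\<Sum>E\<in>trees u. card (emb ({1..u}, E) F)) = (\<Sum>E\<in>trees u. \<Sum>\<phi>\<in>{\<phi>\<in>?I. (\<lambda>e. \<phi> ` e) ` edges F \<subseteq> E}. 1)"
    unfolding emb_eq by simp
  also have "\<dots> = (\<Sum>\<phi>\<in>?I. \<Sum>E\<in>{E\<in>trees u. (\<lambda>e. \<phi> ` e) ` edges F \<subseteq> E}. 1)"
    by (rule sum.swap_restrict[OF finite_trees finI])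
  also have "\<dots> = (\<Sum>\<phi>\<in>?I. card {E\<in>trees u. (\<lambda>e. \<phi> ` e) ` edges F \<subseteq> E})" by simp
  also have "\<dots> \<le> (\<Sum>\<phi>\<in>?I. u ^ (u - card ?V))"
  proof (rule sum_mono)
    fix \<phi> assume \<phi>: "\<phi> \<in> ?I"
    then have inj: "inj_on \<phi> ?V" by simp
    have c: "card (\<phi> ` ?V) = card ?V" using inj by (rule card_image)
    have "card {E\<in>trees u. (\<lambda>e. \<phi> ` e) ` edges F \<subseteq> E} \<le> u ^ (u - card (\<phi> ` ?V))"
    proof (rule card_trees_containing_le)
      show "\<phi> ` ?V \<subseteq> {1..u}" using \<phi> by auto
      show "\<phi> ` ?V \<noteq> {}" using F(2) by simp
      show "e \<subseteq> \<phi> ` ?V" if "e \<in> (\<lambda>e. \<phi> ` e) ` edges F" for e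
        using that simple_graphD(2)[OF F(1)] by blast
      show "card ((\<lambda>e. \<phi> ` e) ` edges F) + 1 = card (\<phi> ` ?V)"
        using inj_on_image_edges[OF F(1) inj] c F(3) by (simp add: card_image)
      show "finite ((\<lambda>e. \<phi> ` e) ` edges F)" using simple_graphD(4)[OF F(1)] by simp
    qed
    then show "card {E\<in>trees u. (\<lambda>e. \<phi> ` e) ` edges F \<subseteq> E} \<le> u ^ (u - card ?V)" by (simp only: c)
  qed
  also have "\<dots> = card ?I * u ^ (u - card ?V)" by simp
  also have "card ?I = (\<Prod>i<card ?V. u - i)" using card_injections[OF finV, of "{1..u}"] by simp
  finally show ?thesis .
qed

section \<open>The bound for small edge densities\<close>

text \<open>Isomorphic parts form a packing whose only menu is the set of all copies of
  \<open>W\<close> in the complete graph. Taking copies and not embeddings as menu keeps the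
  symmetries of \<open>W\<close> in the bound; these are what makes the sum over all isomorphism
  types of parts converge.\<close>
lemma card_isomorphic_parts_le:
  fixes W :: "'b graph" and H :: "'a graph"
  assumes H: "simple_graph H" and sparse: "q_sparse n q H" "0 \<le> q"
    and \<Q>: "finite \<Q>" "disjoint \<Q>" "\<And>P. P \<in> \<Q> \<Longrightarrow> P \<subseteq> verts H"
    and W: "simple_graph W" "\<And>P. P \<in> \<Q> \<Longrightarrow> graph_iso (induced H P) W"
  shows "real (card \<Q>) \<le> 6 * (real (num_copies (K_graph n) W) * q ^ card (edges W))"
proof -
  have sP: "simple_graph (induced H P)" if "P \<in> \<Q>" for P by (rule simple_graph_induced[OF H \<Q>(3)[OF that]])
  have cop: "copies (K_graph n) (induced H P) = copies (K_graph n) W" if "P \<in> \<Q>" for P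
    by (rule copies_iso_cong[OF sP[OF that] W(1) W(2)[OF that]])
  have inj: "inj_on (induced H) \<Q>" by (rule inj_onI) (metis verts_induced)
  have "fact (card (induced H ` \<Q>)) \<le> real (card {copies (K_graph n) W}) *
      (real (num_copies (K_graph n) W) * q ^ card (edges W)) ^ card (induced H ` \<Q>)"
  proof (rule packing[OF sparse])
    show "finite (induced H ` \<Q>)" using \<Q>(1) by simp
    show "subgraph D H" if "D \<in> induced H ` \<Q>" for D using that subgraph_induced[OF H \<Q>(3)] by blast
    show "card (edges D) = card (edges W)" if D: "D \<in> induced H ` \<Q>" for D
    proof -
      obtain P where P: "P \<in> \<Q>" "D = induced H P" using D by blast
      show ?thesis using card_edges_graph_iso[OF sP[OF P(1)] W(2)[OF P(1)]] P(2) by simp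
    qed
    show "edges D \<inter> edges D' = {}" if D: "D \<in> induced H ` \<Q>" "D' \<in> induced H ` \<Q>" "D \<noteq> D'" for D D'
    proof -
      obtain P P' where P: "P \<in> \<Q>" "D = induced H P" "P' \<in> \<Q>" "D' = induced H P'" using D(1,2) by blast
      have "P \<inter> P' = {}" using \<Q>(2) P D(3) by (auto dest: disjointD)
      then have "e = {}" if "e \<in> edges D \<inter> edges D'" for e using that P by auto
      then show ?thesis using simple_graphD(3)[OF H] P by fastforce
    qed
    show "finite Y" if "Y \<in> {copies (K_graph n) W}" for Y
      using that finite_copies_K_graph by simp
    show "card Y \<le> num_copies (K_graph n) W" if "Y \<in> {copies (K_graph n) W}" for Y
      using that by (simp add: num_copies_def)
    fix f :: "'a \<Rightarrow> nat"
    assume f: "inj_on f (\<Union>D\<in>induced H ` \<Q>. verts D)" "f ` (\<Union>D\<in>induced H ` \<Q>. verts D) \<subseteq> {1..n}"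
    have "image_graph f D \<in> copies (K_graph n) W" if D: "D \<in> induced H ` \<Q>" for D
    proof -
      obtain P where P: "P \<in> \<Q>" "D = induced H P" using D by blast
      have fP: "inj_on f P" "f ` P \<subseteq> {1..n}" using f P(1) by (auto intro: inj_on_subset)
      have "restrict f P \<in> emb (K_graph n) D"
        unfolding P(2) emb_K_graph[OF sP[OF P(1)]] verts_induced using fP by auto
      moreover have "image_graph (restrict f P) D = image_graph f D"
        by (rule image_graph_cong) (use sP[OF P(1)] P(2) in auto)
      ultimately show ?thesis
        using cop[OF P(1)] P(2) copies_eq_image_emb[OF sP[OF P(1)], of "K_graph n"] by (metis image_eqI)
    qed
    then show "\<exists>Y\<in>{copies (K_graph n) W}. \<forall>D\<in>induced H ` \<Q>. image_graph f D \<in> Y" by simp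
  qed simp
  then have "fact (card \<Q>) \<le> 1 * (real (num_copies (K_graph n) W) * q ^ card (edges W)) ^ card \<Q>"
    by (simp add: card_image[OF inj])
  then show ?thesis by (rule le_if_fact_le_power) (use sparse(2) in auto)
qed

text \<open>Both numbers, multiplied by the number of automorphisms of \<open>W\<close>, are numbers
  of injections.\<close>
lemma num_copies_K_graph_scale:
  assumes W: "simple_graph W" "verts W = {1..u}"
  shows "num_copies (K_graph n) W * fact u \<le> n ^ u * num_copies (K_graph u) W"
proof -
  let ?a = "card (emb W W)"
  have cW: "card (verts W) = u" using W(2) by simp
  have "(\<Prod>i<u. n - i) \<le> (\<Prod>i<u. n)" by (intro prod_mono) auto
  then have n: "num_copies (K_graph n) W * ?a \<le> n ^ u"
    using card_emb_eq[OF W(1), of "K_graph n"] card_emb_K_graph[OF W(1), of n] cW by simp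
  have u: "num_copies (K_graph u) W * ?a = fact u"
    using card_emb_eq[OF W(1), of "K_graph u"] card_emb_K_graph[OF W(1), of u] cW falling_self[of u] by simp
  have "num_copies (K_graph n) W * fact u * ?a = (num_copies (K_graph n) W * ?a) * (num_copies (K_graph u) W * ?a)"
    unfolding u by (simp only: mult_ac)
  also have "\<dots> \<le> n ^ u * (num_copies (K_graph u) W * ?a)" by (intro mult_right_mono n) simp
  finally show ?thesis using card_emb_self_pos[OF W(1)] by (simp add: mult.assoc[symmetric])
qed

lemma sum_shifted_geometric_le:
  fixes r :: real
  assumes "0 \<le> r" "r < 1"
  shows "(\<Sum>u\<le>n. if v \<le> u then r ^ (u - v) else 0) \<le> 1 / (1 - r)"
proof -
  have "(\<Sum>u\<le>n. if v \<le> u then r ^ (u - v) else 0) \<le> (1 - r ^ (n + 1 - v)) / (1 - r)"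
  proof (induction n)
    case 0
    show ?case using assms by (cases v) auto
  next
    case (Suc n)
    show ?case
    proof (cases "v \<le> Suc n")
      case True
      then have e: "Suc n + 1 - v = Suc (n + 1 - v)" "Suc n - v = n + 1 - v" by auto
      have "(1 - r ^ (n + 1 - v)) / (1 - r) + r ^ (n + 1 - v) = (1 - r ^ Suc (n + 1 - v)) / (1 - r)"
        using assms by (simp add: field_simps)
      then show ?thesis using Suc True unfolding e sum.atMost_Suc by simp
    next
      case False
      then have "n + 1 - v = 0" "Suc n + 1 - v = 0" by auto
      then show ?thesis using Suc False unfolding sum.atMost_Suc by simp
    qed
  qed
  also have "\<dots> \<le> 1 / (1 - r)" using assms by (intro divide_right_mono) auto
  finally show ?thesis .
qed

text \<open>An embedding of a connected graph \<open>F\<close> lands in one component of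
  \<open>H\<close>, and components are trees. The number of components isomorphic to a tree
  \<open>W\<close> with \<open>u\<close> vertices is at most six times the expected number of copies
  of \<open>W\<close>. Spreading every component evenly over its labelled copies on
  \<open>{1..u}\<close> turns the sum over components of size \<open>u\<close> into a count of trees
  on \<open>{1..u}\<close> with an embedding of \<open>F\<close>. What remains is a series in
  \<open>u\<close> with ratio \<open>e n q < e / 3 < 1\<close>; this is where the constant 3 in the
  bound on \<open>q\<close> enters.\<close>
lemma card_emb_connected_le:
  fixes H :: "'b graph" and F :: "'a graph"
  assumes H: "simple_graph H" and sparse: "q_sparse n q H" "0 \<le> q"
    and nq: "real n * q < 1 / 3" and n: "1 \<le> n"
    and F: "simple_graph F" "connected_graph F" "card (edges F) + 1 = card (verts F)"
  shows "real (card (emb H F)) \<le> 198 * real n * (3 * (real n * q)) ^ (card (verts F) - 1)"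
proof -
  let ?v = "card (verts F)"
  obtain \<P> where part: "\<Union>\<P> = verts H" "disjoint \<P>"
      "\<forall>P\<in>\<P>. connected_graph (induced H P)" "\<forall>e\<in>edges H. \<exists>P\<in>\<P>. e \<subseteq> P"
    by (rule obtain_components[OF H])
  note \<P> = part(1,2) bspec[OF part(3)] bspec[OF part(4)]
  have PH: "P \<subseteq> verts H" if "P \<in> \<P>" for P using \<P>(1) that by auto
  have fin\<P>: "finite \<P>" using \<P>(1) simple_graphD(1)[OF H] by (metis finite_UnionD)
  have finP: "finite P" if "P \<in> \<P>" for P using PH[OF that] simple_graphD(1)[OF H] by (rule finite_subset)
  have sP: "simple_graph (induced H P)" if "P \<in> \<P>" for P by (rule simple_graph_induced[OF H PH[OF that]])
  have P_ne: "P \<noteq> {}" if "P \<in> \<P>" for P using \<P>(3)[OF that] by (simp add: connected_graph_def)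
  have Pn: "card P \<le> n" if "P \<in> \<P>" for P
    using card_mono[OF simple_graphD(1)[OF H] PH[OF that]] card_verts_le_if_q_sparse[OF H sparse] by simp
  have P_edges: "card (edges (induced H P)) + 1 = card P" if "P \<in> \<P>" for P
    using card_edges_connected_ge[OF sP[OF that] \<P>(3)[OF that]]
      card_edges_forest_le[OF sparse nq n subgraph_induced[OF H PH[OF that]]] P_ne[OF that] by simp

  define W where "W u E = ({1..u}, E)" for u :: nat and E :: "nat set set"
  have vW: "verts (W u E) = {1..u}" "edges (W u E) = E" for u E by (simp_all add: W_def)
  have sW: "simple_graph (W u E)" if "E \<in> trees u" for u E using simple_graph_tree[OF that] by (simp add: W_def)
  have copies_trees: "copies (K_graph u) (induced H P) = W u ` {E\<in>trees u. W u E \<in> copies (K_graph u) (induced H P)}"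
    if P: "P \<in> \<P>" and u: "card P = u" for P u
  proof (intro equalityI subsetI)
    fix C assume C: "C \<in> copies (K_graph u) (induced H P)"
    then obtain f where f: "f \<in> emb (K_graph u) (induced H P)" and C_eq: "C = image_graph f (induced H P)"
      unfolding copies_eq_image_emb[OF sP[OF P]] by blast
    have inj: "inj_on f P" and im: "f ` P \<subseteq> {1..u}" using f by (auto simp: emb_def)
    have "f ` P = {1..u}" using inj im u by (intro card_subset_eq) (auto simp: card_image)
    then have C_W: "C = W u (edges C)" by (simp add: C_eq W_def prod_eq_iff)
    have "connected_graph C" unfolding C_eq by (rule connected_image_graph[OF \<P>(3)[OF P]])
    then have "connected_graph (W u (edges C))" using C_W by simp
    moreover have "edges C \<subseteq> edges (K_graph u)" using C by (simp add: copies_def subgraph_def)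
    moreover have "card (edges C) + 1 = u"
      using inj_on_image_edges[OF sP[OF P], of f] inj P_edges[OF P] u unfolding C_eq by (simp add: card_image)
    ultimately have "edges C \<in> trees u" by (simp add: trees_def W_def)
    then show "C \<in> W u ` {E\<in>trees u. W u E \<in> copies (K_graph u) (induced H P)}"
      using C C_W by (intro image_eqI[of _ _ "edges C"]) auto
  qed auto

  define t where "t u = (\<Sum>P\<in>{P\<in>\<P>. card P = u}. real (card (emb (induced H P) F)))" for u
  define \<Q> where "\<Q> u E = {P\<in>{P\<in>\<P>. card P = u}. W u E \<in> copies (K_graph u) (induced H P)}" for u E
  \<comment> \<open>\<open>\<Q> u E\<close> collects the components isomorphic to the tree with edge set \<open>E\<close>; the quotient
    is the contribution of this labelled copy to each of them.\<close>
  have class_le: "real (card (\<Q> u E)) * (real (card (emb (W u E) F)) / real (num_copies (K_graph u) (W u E))) \<le>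
      6 * q ^ (u - 1) * real n ^ u / fact u * real (card (emb (W u E) F))" if E: "E \<in> trees u" for u E
  proof -
    let ?g = "real (card (emb (W u E) F))" and ?N = "real (num_copies (K_graph u) (W u E))"
    have N: "?N > 0" using num_copies_K_graph_pos[OF sW[OF E], of u] vW by simp
    have eE: "card E = u - 1" using E by (auto simp: trees_def)
    have "real (card (\<Q> u E)) \<le> 6 * (real (num_copies (K_graph n) (W u E)) * q ^ card (edges (W u E)))"
    proof (rule card_isomorphic_parts_le[OF H sparse])
      show "finite (\<Q> u E)" using fin\<P> by (simp add: \<Q>_def)
      have "\<Q> u E \<subseteq> \<P>" by (auto simp: \<Q>_def)
      then show "disjoint (\<Q> u E)" using \<P>(2) by (auto simp: disjoint_def pairwise_def)
      show "P \<subseteq> verts H" if "P \<in> \<Q> u E" for P using that PH by (simp add: \<Q>_def)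
      show "simple_graph (W u E)" by (rule sW[OF E])
      show "graph_iso (induced H P) (W u E)" if "P \<in> \<Q> u E" for P
        by (rule graph_iso_sym[OF sW[OF E]]) (use that in \<open>simp add: \<Q>_def copies_def\<close>)
    qed
    also have "\<dots> = 6 * q ^ (u - 1) * real (num_copies (K_graph n) (W u E))" by (simp add: vW eE)
    also have "\<dots> \<le> 6 * q ^ (u - 1) * (real n ^ u * ?N / fact u)"
    proof (rule mult_left_mono)
      have "real (num_copies (K_graph n) (W u E) * fact u) \<le> real (n ^ u * num_copies (K_graph u) (W u E))"
        by (rule of_nat_mono[OF num_copies_K_graph_scale[OF sW[OF E] vW(1)]])
      then show "real (num_copies (K_graph n) (W u E)) \<le> real n ^ u * ?N / fact u" by (simp add: field_simps)
    qed (use sparse(2) in simp)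
    finally have "real (card (\<Q> u E)) * (?g / ?N) \<le> 6 * q ^ (u - 1) * (real n ^ u * ?N / fact u) * (?g / ?N)"
      by (rule mult_right_mono) simp
    also have "\<dots> = 6 * q ^ (u - 1) * real n ^ u / fact u * ?g" using N by simp
    finally show ?thesis .
  qed
  have t_le_trees: "t u \<le> 6 * q ^ (u - 1) * real n ^ u / fact u * real (\<Sum>E\<in>trees u. card (emb (W u E) F))" for u
  proof -
    let ?g = "\<lambda>E. real (card (emb (W u E) F)) / real (num_copies (K_graph u) (W u E))"
    let ?\<P> = "{P\<in>\<P>. card P = u}"
    have "t u \<le> (\<Sum>P\<in>?\<P>. \<Sum>E\<in>{E\<in>trees u. W u E \<in> copies (K_graph u) (induced H P)}. ?g E)"
      unfolding t_def
    proof (rule sum_mono)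
      fix P assume "P \<in> ?\<P>"
      then have P: "P \<in> \<P>" "card P = u" by auto
      let ?T = "{E\<in>trees u. W u E \<in> copies (K_graph u) (induced H P)}"
      let ?N = "num_copies (K_graph u) (induced H P)"
      have N: "?N > 0" using num_copies_K_graph_pos[OF sP[OF P(1)], of u] P(2) by simp
      have "inj_on (W u) ?T" by (auto simp: inj_on_def W_def)
      then have "card ?T = card (W u ` ?T)" by (rule card_image[symmetric])
      also have "\<dots> = ?N" unfolding num_copies_def using copies_trees[OF P] by simp
      finally have cT: "card ?T = ?N" .
      have "real (card (emb (induced H P) F)) = (\<Sum>E\<in>?T. real (card (emb (induced H P) F)) / real ?N)"
        using N cT by simp
      also have "\<dots> \<le> (\<Sum>E\<in>?T. ?g E)"
      proof (rule sum_mono)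
        fix E assume "E \<in> ?T"
        then have E: "E \<in> trees u" and iso: "graph_iso (W u E) (induced H P)" by (auto simp: copies_def)
        have iso': "graph_iso (induced H P) (W u E)" by (rule graph_iso_sym[OF sW[OF E] iso])
        have "copies (K_graph u) (induced H P) = copies (K_graph u) (W u E)"
          by (rule copies_iso_cong[OF sP[OF P(1)] sW[OF E] iso'])
        then have "?N = num_copies (K_graph u) (W u E)" by (simp add: num_copies_def)
        moreover have "card (emb (induced H P) F) \<le> card (emb (W u E) F)"
          by (rule card_emb_iso_le[OF sP[OF P(1)] _ iso' F(1)]) (simp add: vW)
        ultimately show "real (card (emb (induced H P) F)) / real ?N \<le> ?g E" by (simp add: divide_right_mono)
      qed
      finally show "real (card (emb (induced H P) F)) \<le> (\<Sum>E\<in>?T. ?g E)" .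
    qed
    also have "\<dots> = (\<Sum>E\<in>trees u. \<Sum>P\<in>{P\<in>?\<P>. W u E \<in> copies (K_graph u) (induced H P)}. ?g E)"
      by (rule sum.swap_restrict) (use fin\<P> finite_trees in auto)
    also have "\<dots> = (\<Sum>E\<in>trees u. real (card (\<Q> u E)) * ?g E)" by (simp add: \<Q>_def)
    also have "\<dots> \<le> (\<Sum>E\<in>trees u. 6 * q ^ (u - 1) * real n ^ u / fact u * real (card (emb (W u E) F)))"
      by (intro sum_mono class_le)
    also have "\<dots> = 6 * q ^ (u - 1) * real n ^ u / fact u * real (\<Sum>E\<in>trees u. card (emb (W u E) F))"
      by (simp only: of_nat_sum sum_distrib_left)
    finally show ?thesis .
  qed

  have v: "?v \<ge> 1" using F(3) by simp
  have Fne: "verts F \<noteq> {}" using F(2) by (simp add: connected_graph_def)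
  \<comment> \<open>The ratio is \<open>2.72 / 3\<close>, where \<open>2.72 > e\<close>.\<close>
  let ?r = "68 / 75 :: real"
  let ?c = "6 * (68 / 25) * real n * (3 * (real n * q)) ^ (?v - 1)"
  have t_le: "t u \<le> ?c * (if ?v \<le> u then ?r ^ (u - ?v) else 0)" for u
  proof -
    have nq0: "0 \<le> real n * q" using sparse(2) by simp
    have "t u \<le> 6 * q ^ (u - 1) * real n ^ u / fact u * real ((\<Prod>i<?v. u - i) * u ^ (u - ?v))"
      by (rule order_trans[OF t_le_trees])
        (intro mult_left_mono of_nat_mono sum_emb_trees_le[OF F(1) Fne F(3), of u, folded W_def]; use sparse(2) in simp)
    also have "\<dots> \<le> ?c * (if ?v \<le> u then ?r ^ (u - ?v) else 0)"
    proof (cases "?v \<le> u")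
      case False
      then have "(\<Prod>i<?v. u - i) = 0" by (intro prod_zero) auto
      show ?thesis unfolding \<open>(\<Prod>i<?v. u - i) = 0\<close> using False by simp
    next
      case True
      define k where "k = u - ?v"
      have u: "u = ?v + k" "u - 1 = (?v - 1) + k" "u = Suc (u - 1)" using True v by (auto simp: k_def)
      have "fact u = (\<Prod>i<?v. u - i) * (fact k :: nat)"
        using falling_split[OF True, of u] falling_self[of u] falling_self[of k] by (simp add: k_def)
      then have "real (\<Prod>i<?v. u - i) = fact u / fact k"
        by (metis nonzero_mult_div_cancel_right of_nat_fact of_nat_mult fact_nonzero)
      then have "6 * q ^ (u - 1) * real n ^ u / fact u * real ((\<Prod>i<?v. u - i) * u ^ (u - ?v)) =
          6 * q ^ (u - 1) * real n ^ u * (real u ^ k / fact k)"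
        unfolding of_nat_mult of_nat_power k_def[symmetric] by simp
      also have "\<dots> \<le> 6 * q ^ (u - 1) * real n ^ u * (68 / 25) ^ u"
      proof (rule mult_left_mono)
        have "real u ^ k / fact k \<le> exp (real u)" by (rule power_div_fact_le_exp) simp
        also have "\<dots> = exp 1 ^ u" by (simp flip: exp_of_nat_mult)
        also have "\<dots> \<le> (68 / 25) ^ u" using e_less_272 by (intro power_mono) auto
        finally show "real u ^ k / fact k \<le> (68 / 25) ^ u" .
      qed (use sparse(2) in simp)
      also have "\<dots> = 6 * (68 / 25) * real n * (68 / 25 * (real n * q)) ^ (u - 1)"
      proof -
        obtain j where j: "u = Suc j" using u(3) by blast
        have "6 * q ^ j * real n ^ Suc j * x ^ Suc j = 6 * x * real n * (x * (real n * q)) ^ j" for x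
          by (simp add: power_mult_distrib)
        then show ?thesis unfolding j diff_Suc_1 .
      qed
      also have "(68 / 25 * (real n * q)) ^ (u - 1) =
          (68 / 25 * (real n * q)) ^ (?v - 1) * (68 / 25 * (real n * q)) ^ k"
        unfolding u(2) by (rule power_add)
      also have "6 * (68 / 25) * real n * \<dots> \<le> 6 * (68 / 25) * real n * ((3 * (real n * q)) ^ (?v - 1) * ?r ^ k)"
      proof -
        have "68 / 25 * (real n * q) \<le> 3 * (real n * q)" using nq0 by linarith
        moreover have "68 / 25 * (real n * q) \<le> ?r" using nq by linarith
        ultimately show ?thesis using nq0 by (intro mult_left_mono mult_mono power_mono) auto
      qed
      finally show ?thesis using True by (simp add: k_def mult.assoc)
    qed
    finally show ?thesis .
  qed

  have "emb H F \<subseteq> (\<Union>P\<in>\<P>. emb (induced H P) F)"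
  proof
    fix \<phi> assume \<phi>: "\<phi> \<in> emb H F"
    obtain x0 where x0: "x0 \<in> verts F" using Fne by auto
    then have "\<phi> x0 \<in> \<Union>\<P>" using \<phi> \<P>(1) by (auto simp: emb_def)
    then obtain P where P: "P \<in> \<P>" "\<phi> x0 \<in> P" by auto
    let ?B = "{x\<in>verts F. \<phi> x \<in> P}"
    have "?B = verts F"
    proof (rule ccontr)
      assume "?B \<noteq> verts F"
      then have "?B \<subset> verts F" "?B \<noteq> {}" using x0 P by auto
      then obtain b y where by_: "b \<in> ?B" "y \<in> verts F - ?B" "{b, y} \<in> edges F"
        using F(2) unfolding connected_graph_def by blast
      then have "\<phi> ` {b, y} \<in> edges H" using \<phi> by (auto simp: emb_def)
      then obtain P' where P': "P' \<in> \<P>" "\<phi> ` {b, y} \<subseteq> P'" using \<P>(4) by blast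
      then have "P = P'" using \<P>(2) P(1) by_(1) by (auto dest: disjointD)
      then show False using P' by_(2) by auto
    qed
    then have VP: "\<phi> x \<in> P" if "x \<in> verts F" for x using that by blast
    have "\<phi> \<in> emb (induced H P) F"
      unfolding emb_def verts_induced edges_induced
    proof (intro CollectI conjI ballI)
      show "\<phi> \<in> verts F \<rightarrow>\<^sub>E P" using \<phi> VP by (auto simp: emb_def PiE_iff)
      show "inj_on \<phi> (verts F)" using \<phi> by (simp add: emb_def)
      fix e assume e: "e \<in> edges F"
      show "\<phi> ` e \<in> edges H" using \<phi> e by (simp add: emb_def)
      show "\<phi> ` e \<subseteq> P" using VP simple_graphD(2)[OF F(1) e] by auto
    qed
    then show "\<phi> \<in> (\<Union>P\<in>\<P>. emb (induced H P) F)" using P(1) by blast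
  qed
  then have "card (emb H F) \<le> card (\<Union>P\<in>\<P>. emb (induced H P) F)"
    by (rule card_mono[rotated]) (use fin\<P> finP in \<open>auto intro!: finite_emb simple_graphD(1)[OF F(1)]\<close>)
  also have "\<dots> \<le> (\<Sum>P\<in>\<P>. card (emb (induced H P) F))" by (rule card_UN_le[OF fin\<P>])
  finally have "real (card (emb H F)) \<le> (\<Sum>P\<in>\<P>. real (card (emb (induced H P) F)))"
    by (simp flip: of_nat_sum)
  also have "\<dots> = (\<Sum>u\<le>n. t u)"
    unfolding t_def by (rule sum.group[symmetric]) (use fin\<P> Pn in auto)
  also have "\<dots> \<le> (\<Sum>u\<le>n. ?c * (if ?v \<le> u then ?r ^ (u - ?v) else 0))" by (intro sum_mono t_le)
  also have "\<dots> = ?c * (\<Sum>u\<le>n. if ?v \<le> u then ?r ^ (u - ?v) else 0)" by (rule sum_distrib_left[symmetric])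
  also have "\<dots> \<le> ?c * (1 / (1 - ?r))"
    using sparse(2) by (intro mult_left_mono sum_shifted_geometric_le) auto
  also have "\<dots> \<le> 198 * real n * (3 * (real n * q)) ^ (?v - 1)"
    using sparse(2) mult_nonneg_nonneg[of "real n" "(3 * (real n * q)) ^ (?v - 1)"] by simp
  finally show ?thesis .
qed

lemma card_emb_split_le:
  assumes H: "finite (verts H)" and F: "simple_graph F" and B: "B \<subseteq> verts F"
  shows "card (emb H F) \<le> card (emb H (induced F B)) * card (emb H (induced F (verts F - B)))"
proof -
  let ?C = "verts F - B"
  let ?r = "\<lambda>\<phi>. (restrict \<phi> B, restrict \<phi> ?C)"
  have res: "restrict \<phi> T \<in> emb H (induced F T)" if \<phi>: "\<phi> \<in> emb H F" and T: "T \<subseteq> verts F" for \<phi> T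
  proof -
    have "restrict \<phi> T ` e \<in> edges H" if "e \<in> edges (induced F T)" for e
    proof -
      have "restrict \<phi> T ` e = \<phi> ` e" using that by (intro image_cong refl) auto
      then show ?thesis using \<phi> that by (simp add: emb_def)
    qed
    moreover have "inj_on (restrict \<phi> T) T" using \<phi> T by (auto simp: emb_def intro: inj_on_subset)
    moreover have "restrict \<phi> T \<in> T \<rightarrow>\<^sub>E verts H" using \<phi> T by (auto simp: emb_def)
    ultimately show ?thesis unfolding emb_def verts_induced by blast
  qed
  have "card (emb H F) \<le> card (emb H (induced F B) \<times> emb H (induced F ?C))"
  proof (rule card_inj_on_le)
    show "?r ` emb H F \<subseteq> emb H (induced F B) \<times> emb H (induced F ?C)"
      using res[of _ B] res[of _ ?C] B by blast
    show "inj_on ?r (emb H F)"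
    proof (rule inj_onI)
      fix \<phi> \<psi> assume p: "\<phi> \<in> emb H F" "\<psi> \<in> emb H F" "?r \<phi> = ?r \<psi>"
      show "\<phi> = \<psi>"
      proof (rule PiE_ext[of _ "verts F" "\<lambda>_. verts H"])
        show "\<phi> \<in> verts F \<rightarrow>\<^sub>E verts H" "\<psi> \<in> verts F \<rightarrow>\<^sub>E verts H" using p by (auto simp: emb_def)
        fix x assume x: "x \<in> verts F"
        have "restrict \<phi> B x = restrict \<psi> B x" "restrict \<phi> ?C x = restrict \<psi> ?C x" using p(3) by simp_all
        then show "\<phi> x = \<psi> x" using x by (cases "x \<in> B") simp_all
      qed
    qed
    have "finite B" using B simple_graphD(1)[OF F] by (rule finite_subset)
    then show "finite (emb H (induced F B) \<times> emb H (induced F ?C))"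
      using H simple_graphD(1)[OF F] by (intro finite_cartesian_product finite_emb) auto
  qed
  then show ?thesis by (simp add: card_cartesian_product)
qed

text \<open>The bound is multiplicative over unions without edges between the parts, so a
  disconnected \<open>F\<close> can be split along an empty cut.\<close>
lemma emb_bound_forest:
  assumes H: "simple_graph H" and sparse: "q_sparse n q H" "0 \<le> q"
    and nq: "real n * q < 1 / 3" and n: "1 \<le> n" and F: "subgraph F H"
  shows "real (card (emb H F)) \<le> (198 * real n) ^ card (verts F) * (3 * q) ^ card (edges F)"
  using F
proof (induction "card (verts F)" arbitrary: F rule: less_induct)
  case less
  have sF: "simple_graph F" using less.prems by (simp add: subgraph_def)
  note finV = simple_graphD(1)[OF sF] and finE = simple_graphD(4)[OF sF]
  consider "verts F = {}" | "connected_graph F"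
    | B where "B \<subset> verts F" "B \<noteq> {}" "\<And>b y. b \<in> B \<Longrightarrow> y \<in> verts F - B \<Longrightarrow> {b, y} \<notin> edges F"
  proof (cases "verts F = {} \<or> connected_graph F")
    case False
    then obtain B where "B \<subset> verts F" "B \<noteq> {}" "\<not> (\<exists>b\<in>B. \<exists>y\<in>verts F - B. {b, y} \<in> edges F)"
      unfolding connected_graph_def by blast
    then show ?thesis using that(3)[of B] by blast
  qed blast
  then show ?case
  proof cases
    case 1
    have "edges F = {}" using simple_graphD(2,3)[OF sF] 1 by force
    moreover have "card (emb H F) \<le> card {\<lambda>_ :: 'a. undefined :: 'a}"
      by (intro card_mono) (auto simp: emb_def 1)
    ultimately show ?thesis using 1 by simp
  next
    case 2
    have ne: "verts F \<noteq> {}" using 2 by (simp add: connected_graph_def)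
    have e: "card (edges F) + 1 = card (verts F)"
      using card_edges_connected_ge[OF sF 2] card_edges_forest_le[OF sparse nq n less.prems ne] by simp
    then have v: "card (verts F) = Suc (card (edges F))" by simp
    have "real (card (emb H F)) \<le> 198 * real n * (3 * (real n * q)) ^ card (edges F)"
      using card_emb_connected_le[OF H sparse nq n sF 2 e] by (simp add: v)
    also have "\<dots> = 198 * (real n ^ card (verts F) * (3 * q) ^ card (edges F))"
      unfolding v power_mult_distrib by (simp add: mult_ac)
    also have "\<dots> \<le> 198 ^ card (verts F) * (real n ^ card (verts F) * (3 * q) ^ card (edges F))"
      using sparse(2) v by (intro mult_right_mono self_le_power) auto
    finally show ?thesis unfolding power_mult_distrib[of 198] by (simp only: mult.assoc)
  next
    case 3
    let ?C = "verts F - B"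
    have sub: "subgraph (induced F T) H" if "T \<subseteq> verts F" for T
      using subgraph_induced[OF sF that] less.prems by (auto simp: subgraph_def)
    have lt: "card B < card (verts F)" "card ?C < card (verts F)"
      using 3(1,2) finV by (auto intro: psubset_card_mono)
    have IH: "real (card (emb H (induced F T))) \<le>
        (198 * real n) ^ card T * (3 * q) ^ card {e\<in>edges F. e \<subseteq> T}" if "T = B \<or> T = ?C" for T
      using less.hyps[of "induced F T"] sub[of T] lt 3(1) that by auto
    have "real (card (emb H F)) \<le> real (card (emb H (induced F B))) * real (card (emb H (induced F ?C)))"
      using card_emb_split_le[OF simple_graphD(1)[OF H] sF, of B] 3(1)
      by (metis of_nat_le_iff of_nat_mult psubset_imp_subset)
    also have "\<dots> \<le> ((198 * real n) ^ card B * (3 * q) ^ card {e\<in>edges F. e \<subseteq> B}) *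
        ((198 * real n) ^ card ?C * (3 * q) ^ card {e\<in>edges F. e \<subseteq> ?C})"
      using sparse(2) by (intro mult_mono IH) auto
    also have "\<dots> = (198 * real n) ^ (card B + card ?C) *
        (3 * q) ^ (card {e\<in>edges F. e \<subseteq> B} + card {e\<in>edges F. e \<subseteq> ?C})"
      unfolding power_add by (simp only: mult_ac)
    also have "card B + card ?C = card (verts F)"
      using 3(1) finV by (metis card_Diff_subset card_mono finite_subset le_add_diff_inverse psubset_imp_subset)
    also have "card {e\<in>edges F. e \<subseteq> B} + card {e\<in>edges F. e \<subseteq> ?C} = card (edges F)"
    proof -
      have "card ({e\<in>edges F. e \<subseteq> B} \<union> {e\<in>edges F. e \<subseteq> ?C}) =
          card {e\<in>edges F. e \<subseteq> B} + card {e\<in>edges F. e \<subseteq> ?C}"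
      proof (rule card_Un_disjoint)
        have False if "e \<in> edges F" "e \<subseteq> B" "e \<subseteq> ?C" for e
        proof -
          have "e = {}" using that(2,3) by blast
          then show False using simple_graphD(3)[OF sF that(1)] by simp
        qed
        then show "{e\<in>edges F. e \<subseteq> B} \<inter> {e\<in>edges F. e \<subseteq> ?C} = {}" by blast
      qed (use finE in auto)
      moreover have "{e\<in>edges F. e \<subseteq> B} \<union> {e\<in>edges F. e \<subseteq> ?C} = edges F"
      proof -
        have "e \<subseteq> B \<or> e \<subseteq> ?C" if "e \<in> edges F" for e
          using simple_graphD(3)[OF sF that] simple_graphD(2)[OF sF that]
          by (rule edge_on_one_side) (use 3(3) that in blast)
        then show ?thesis by blast
      qed
      ultimately show ?thesis by (simp only:)
    qed
    finally show ?thesis .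
  qed
qed

lemma num_copies_less_expected_forest:
  assumes n: "1 \<le> n" and q: "0 \<le> q" and H: "simple_graph H" and sparse: "q_sparse n q H"
    and qp: "q = p / 1176120" and small: "q < 1 / (3 * real n)" and F: "subgraph F H" "edges F \<noteq> {}"
  shows "real (num_copies H F) < expected_copies n p F"
proof -
  obtain e0 where e0: "e0 \<in> edges H" using F by (auto simp: subgraph_def)
  have q0: "0 < q" by (rule q_pos_if_q_sparse[OF H e0 sparse q])
  have nq: "real n * q < 1 / 3" using small n by (simp add: field_simps)
  have "real (num_copies H F) < real (num_copies (K_graph n) F) * (10 * 198\<^sup>2 * 3 * q) ^ card (edges F)"
    by (rule num_copies_less_if_emb_bound[OF H card_verts_le_if_q_sparse[OF H sparse q] F])
      (use q0 emb_bound_forest[OF H sparse q nq n] in auto)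
  also have "10 * 198\<^sup>2 * 3 * q = p" using qp by simp
  finally show ?thesis using q0 qp by (simp add: expected_copies_eq)
qed

section \<open>Few copies in sparse graphs\<close>

theorem theorem1p8:
  shows "(\<exists>K::real. K > 0 \<and>
            (\<forall>(n::nat) (q::real) (p::real) (H::nat graph).
               n \<ge> 1 \<longrightarrow> 0 \<le> q \<longrightarrow> q \<le> 1 \<longrightarrow> simple_graph H \<longrightarrow> q_sparse n q H \<longrightarrow>
               p = K * q * (log 2 (real n))\<^sup>2 \<longrightarrow>
               (\<forall>F. subgraph F H \<and> edges F \<noteq> {} \<longrightarrow>
                  real (num_copies H F) < expected_copies n p F)))
       \<and> (\<exists>\<alpha>::real. \<alpha> > 0 \<and>
            (\<forall>(n::nat) (q::real) (p::real) (H::nat graph).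
               n \<ge> 1 \<longrightarrow> 0 \<le> q \<longrightarrow> q \<le> 1 \<longrightarrow> simple_graph H \<longrightarrow> q_sparse n q H \<longrightarrow>
               q = \<alpha> * p \<longrightarrow> \<alpha> * p < 1 / (3 * real n) \<longrightarrow>
               (\<forall>F. subgraph F H \<and> edges F \<noteq> {} \<longrightarrow>
                  real (num_copies H F) < expected_copies n p F)))"
proof (rule conjI; intro exI conjI allI impI)
  \<comment> \<open>With \<open>a\<close> and \<open>C\<close> from the bounds on embeddings, \<open>10 a\<^sup>2 C\<close> is \<open>10 \<cdot> 6\<^sup>2 \<cdot> 32 = 11520\<close>, apart from
    the logarithm, and \<open>10 \<cdot> 198\<^sup>2 \<cdot> 3 = 1176120\<close>.\<close>
  show "(0::real) < 11520" "(0::real) < 1 / 1176120" by simp_all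
next
  fix n :: nat and q p :: real and H F :: "nat graph"
  assume "n \<ge> 1" "0 \<le> q" "simple_graph H" "q_sparse n q H" "p = 11520 * q * (log 2 (real n))\<^sup>2"
    "subgraph F H \<and> edges F \<noteq> {}"
  then show "real (num_copies H F) < expected_copies n p F"
    using num_copies_less_expected_log_squared by blast
next
  fix n :: nat and q p :: real and H F :: "nat graph"
  assume "n \<ge> 1" "0 \<le> q" "simple_graph H" "q_sparse n q H" "q = 1 / 1176120 * p"
    "1 / 1176120 * p < 1 / (3 * real n)" "subgraph F H \<and> edges F \<noteq> {}"
  then show "real (num_copies H F) < expected_copies n p F"
    by (intro num_copies_less_expected_forest) auto
qed

end
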